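(* Let $\mathcal{G}\rightrightarrows M$ be a Lie groupoid. (1) An affine $(p,0)$-tensor on $\mathcal{G}$ is an affine $p$-vector field on $\mathcal{G}$. (2) An affine $(0,q)$-tensor on $\mathcal{G}$ is an affine $q$-form on $\mathcal{G}$.
   Context: Conventions: $\mathcal{G}\rightrightarrows M$ has source $s$ and target $t$; $gh$ is defined iff $s(g)=t(h)$; units embed $M$ in $\mathcal{G}$ by $\iota$. $A=\ker(ds)|_M$ is the Lie algebroid; for $u\in\Gamma(A)$, $\overrightarrow{u}(g)=dR_g(u_{t(g)})$, $\overleftarrow{u}(g)=-dL_g(d\,\mathrm{inv}(u_{s(g)}))$. The tangent groupoid $T\mathcal{G}\rightrightarrows TM$ has as structure maps the differentials of those of $\mathcal{G}$. The cotangent groupoid $T^*\mathcal{G}\rightrightarrows A^*$ has source and target of $\xi\in T_g^*\mathcal{G}$ given by $\langle s(\xi),u\rangle=\langle\xi,\overleftarrow{u}\rangle$ for $u\in A_{s(g)}$ and $\langle t(\xi),v\rangle=\langle\xi,\overrightarrow{v}\rangle$ for $v\in A_{t(g)}$, and product $(\xi\cdot\eta)(X\cdot Y)=\xi(X)+\eta(Y)$ for composable $X,Y$ in $T\mathcal{G}$; units $A^*\subset T^*\mathcal{G}|_M=T^*M\oplus A^*$. Tensors: a $(p,q)$-tensor $F\in\Gamma(\wedge^pT\mathcal{G}\otimes\wedge^qT^*\mathcal{G})$ is viewed as a function on the Lie groupoid $\Gamma:\ \oplus^qT\mathcal{G}\oplus^pT^*\mathcal{G}\rightrightarrows\oplus^qTM\oplus^pA^*$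 (direct sums over $\mathcal{G}$ and over $M$, componentwise structure). A function $F$ on a Lie groupoid is affine if $F(gh)=F(g)+F(h)-F(s(g))$ for all composable $g,h$ (units identified with objects). A $(p,q)$-tensor on $\mathcal{G}$ is affine if it is an affine function on $\Gamma$. Affine multivector fields: a submanifold $S\subset N$ is coisotropic with respect to $\Lambda\in\mathfrak{X}^k(N)$ if for all $x\in S$, $\Lambda_x(\xi_1,\dots,\xi_k)=0$ whenever all $\xi_i\in T_x^*N$ annihilate $T_xS$. $\Pi\in\mathfrak{X}^k(\mathcal{G})$ is an affine $k$-vector field if $\{(g,h,l,hg^{-1}l): s(g)=s(h),\,t(g)=t(l)\}\subset\mathcal{G}^4$ is coisotropic with respect to $\Pi\oplus(-1)^{k+1}\Pi\oplus(-1)^{k+1}\Pi\oplus\Pi$. Affine forms: with $\mathcal{G}^{(2)}=\{(g,h):s(g)=t(h)\}$, $m,\mathrm{pr}_1,\mathrm{pr}_2:\mathcal{G}^{(2)}\to\mathcal{G}$ multiplication and projections, $\Theta\in\Omega^k(\mathcal{G})$ is an affine $k$-form if $m^*\Theta=\mathrm{pr}_1^*\Theta+\mathrm{pr}_2^*\Theta-\mathrm{pr}_1^*s^*\iota^*\Theta$. *)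

theory Defs
  imports "HOL-Analysis.Analysis"
begin

section \<open>Smooth maps between open subsets of normed spaces\<close>

text \<open>On an open subset of a finite-dimensional space this is the usual class \<open>C\<^sup>k\<close>: a map is
  \<open>C\<^sup>k\<^sup>+\<^sup>1\<close> iff it is differentiable and all its directional derivatives are \<open>C\<^sup>k\<close>.\<close>

primrec ck_on :: "nat \<Rightarrow> 'e::real_normed_vector set \<Rightarrow> ('e \<Rightarrow> 'f::real_normed_vector) \<Rightarrow> bool" where
  "ck_on 0 V f \<longleftrightarrow> continuous_on V f"
| "ck_on (Suc k) V f \<longleftrightarrow>
     (\<forall>x\<in>V. f differentiable (at x)) \<and> (\<forall>v. ck_on k V (\<lambda>x. frechet_derivative f (at x) v))"

definition smooth_on :: "'e::real_normed_vector set \<Rightarrow> ('e \<Rightarrow> 'f::real_normed_vector) \<Rightarrow> bool" where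
  "smooth_on V f \<longleftrightarrow> (\<forall>k. ck_on k V f)"


section \<open>Smooth manifolds\<close>

text \<open>A chart is a pair \<open>(U, \<phi>)\<close>; only the values of \<open>\<phi>\<close> on \<open>U\<close> are relevant. A manifold is given
  by an atlas (not assumed maximal), its underlying set being the union of the chart domains.
  The model space is an arbitrary finite-dimensional real inner product space, i.e. \<open>\<real>\<^sup>n\<close> with
  \<open>n \<ge> 0\<close>. The class \<open>euclidean_space\<close> is not used because it forces \<open>n \<ge> 1\<close>, which would exclude
  Lie groups (Lie groupoids over a point).\<close>

type_synonym ('a, 'e) chart = "'a set \<times> ('a \<Rightarrow> 'e)"
type_synonym ('a, 'e) atlas = "('a, 'e) chart set"

definition points :: "('a, 'e) atlas \<Rightarrow> 'a set" where
  "points N = (\<Union>\<kappa>\<in>N. fst \<kappa>)"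

definition transition :: "('a, 'e) chart \<Rightarrow> ('a, 'f) chart \<Rightarrow> 'e \<Rightarrow> 'f" where
  "transition \<kappa> \<mu> = snd \<mu> \<circ> inv_into (fst \<kappa>) (snd \<kappa>)"

definition manifold_topology :: "('a, 'e::real_normed_vector) atlas \<Rightarrow> 'a topology" where
  "manifold_topology N = topology_generated_by {W. \<exists>(U, \<phi>)\<in>N. W \<subseteq> U \<and> open (\<phi> ` W)}"

definition smooth_manifold :: "('a, 'e::real_inner) atlas \<Rightarrow> bool" where
  "smooth_manifold N \<longleftrightarrow>
     (\<exists>B::'e set. finite B \<and> span B = UNIV) \<and>
     (\<forall>(U, \<phi>)\<in>N. inj_on \<phi> U \<and> open (\<phi> ` U)) \<and>
     (\<forall>\<kappa>\<in>N. \<forall>\<mu>\<in>N. open (snd \<kappa> ` (fst \<kappa> \<inter> fst \<mu>)) \<and>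
        smooth_on (snd \<kappa> ` (fst \<kappa> \<inter> fst \<mu>)) (transition \<kappa> \<mu>)) \<and>
     Hausdorff_space (manifold_topology N) \<and> second_countable (manifold_topology N)"

definition prod_atlas :: "('a, 'e) atlas \<Rightarrow> ('b, 'f) atlas \<Rightarrow> ('a \<times> 'b, 'e \<times> 'f) atlas" where
  "prod_atlas N P = {(U \<times> V, map_prod \<phi> \<psi>) | U \<phi> V \<psi>. (U, \<phi>) \<in> N \<and> (V, \<psi>) \<in> P}"

definition smooth_at ::
  "('a, 'e::real_normed_vector) atlas \<Rightarrow> ('b, 'f::real_normed_vector) atlas \<Rightarrow> ('a \<Rightarrow> 'b) \<Rightarrow> 'a \<Rightarrow> bool" where
  "smooth_at N P f x \<longleftrightarrow>
     (\<exists>(U, \<phi>)\<in>N. \<exists>(V, \<psi>)\<in>P. x \<in> U \<and> f x \<in> V \<and>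
        (\<exists>W. W \<subseteq> U \<and> x \<in> W \<and> open (\<phi> ` W) \<and> f ` W \<subseteq> V \<and>
             smooth_on (\<phi> ` W) (\<psi> \<circ> f \<circ> inv_into U \<phi>)))"

text \<open>Smoothness of a map on a subset \<open>S\<close>: locally it extends to a smooth map on an open set. For an
  embedded submanifold \<open>S\<close> this is smoothness for the induced manifold structure; for
  \<open>S = points N\<close> it is smoothness on the whole manifold.\<close>

definition smooth_map_on ::
  "('a, 'e::real_normed_vector) atlas \<Rightarrow> ('b, 'f::real_normed_vector) atlas \<Rightarrow> 'a set \<Rightarrow> ('a \<Rightarrow> 'b) \<Rightarrow> bool" where
  "smooth_map_on N P S f \<longleftrightarrow> S \<subseteq> points N \<and>
     (\<forall>x\<in>S. \<exists>g W. smooth_at N P g x \<and> openin (manifold_topology N) W \<and> x \<in> W \<and>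
        (\<forall>y\<in>W \<inter> S. g y = f y))"


section \<open>Tangent vectors and differentials\<close>

text \<open>A tangent vector at \<open>p\<close> is the family of its coordinate expressions in all charts around \<open>p\<close>,
  related by the derivatives of the transition maps; the components at all other charts are 0.
  Hence the vector space operations are pointwise. The base point is not part of the vector.\<close>

type_synonym ('a, 'e) tvec = "('a, 'e) chart \<Rightarrow> 'e"

definition tangent_space :: "('a, 'e::real_normed_vector) atlas \<Rightarrow> 'a \<Rightarrow> ('a, 'e) tvec set" where
  "tangent_space N p = {X.
     (\<forall>\<kappa>\<in>N. \<forall>\<mu>\<in>N. p \<in> fst \<kappa> \<and> p \<in> fst \<mu> \<longrightarrow>
        X \<mu> = frechet_derivative (transition \<kappa> \<mu>) (at (snd \<kappa> p)) (X \<kappa>)) \<and>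
     (\<forall>\<kappa>. \<not> (\<kappa> \<in> N \<and> p \<in> fst \<kappa>) \<longrightarrow> X \<kappa> = 0)}"

text \<open>\<open>X\<close> is the velocity at time 0 of the curve \<open>c\<close>, which need only be differentiable at 0.\<close>

definition has_velocity ::
  "('a, 'e::real_normed_vector) atlas \<Rightarrow> (real \<Rightarrow> 'a) \<Rightarrow> ('a, 'e) tvec \<Rightarrow> bool" where
  "has_velocity N c X \<longleftrightarrow> c 0 \<in> points N \<and>
     (\<forall>\<kappa>\<in>N. c 0 \<in> fst \<kappa> \<longrightarrow>
        (\<forall>\<^sub>F \<tau> in nhds 0. c \<tau> \<in> fst \<kappa>) \<and>
        ((\<lambda>\<tau>. snd \<kappa> (c \<tau>)) has_vector_derivative X \<kappa>) (at 0)) \<and>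
     (\<forall>\<kappa>. \<not> (\<kappa> \<in> N \<and> c 0 \<in> fst \<kappa>) \<longrightarrow> X \<kappa> = 0)"

text \<open>\<open>T\<^sub>xS\<close>, as a subset of \<open>T\<^sub>xN\<close>, for an embedded submanifold \<open>S\<close> of \<open>N\<close>. For such \<open>S\<close>, curves in
  \<open>S\<close> that are differentiable at 0 have the same velocities as smooth curves in \<open>S\<close>.\<close>

definition tangent_of_subset ::
  "('a, 'e::real_normed_vector) atlas \<Rightarrow> 'a set \<Rightarrow> 'a \<Rightarrow> ('a, 'e) tvec set" where
  "tangent_of_subset N S x =
     {X. \<exists>c. c 0 = x \<and> (\<forall>\<^sub>F \<tau> in nhds 0. c \<tau> \<in> S) \<and> has_velocity N c X}"

text \<open>The differential at \<open>x\<close> of a smooth map \<open>f : S \<rightarrow> P\<close> defined on an embedded submanifold \<open>S\<close>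
  of \<open>N\<close> (possibly all of \<open>N\<close>), applied to \<open>X \<in> T\<^sub>xS\<close>.\<close>

definition differential ::
  "('a, 'e::real_normed_vector) atlas \<Rightarrow> ('b, 'f::real_normed_vector) atlas \<Rightarrow> 'a set \<Rightarrow> ('a \<Rightarrow> 'b)
     \<Rightarrow> 'a \<Rightarrow> ('a, 'e) tvec \<Rightarrow> ('b, 'f) tvec" where
  "differential N P S f x X =
     (THE V. \<exists>c. c 0 = x \<and> (\<forall>\<^sub>F \<tau> in nhds 0. c \<tau> \<in> S) \<and>
        has_velocity N c X \<and> has_velocity P (f \<circ> c) V)"

abbreviation diff ::
  "('a, 'e::real_normed_vector) atlas \<Rightarrow> ('b, 'f::real_normed_vector) atlas \<Rightarrow> ('a \<Rightarrow> 'b)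
     \<Rightarrow> 'a \<Rightarrow> ('a, 'e) tvec \<Rightarrow> ('b, 'f) tvec" where
  "diff N P f \<equiv> differential N P (points N) f"

text \<open>The vector \<open>(X, Y) \<in> T\<^sub>(\<^sub>x\<^sub>,\<^sub>y\<^sub>)(N \<times> P) = T\<^sub>xN \<times> T\<^sub>yP\<close>.\<close>

definition tpair ::
  "('a, 'e::real_normed_vector) atlas \<Rightarrow> ('b, 'f::real_normed_vector) atlas \<Rightarrow> 'a \<Rightarrow> 'b
     \<Rightarrow> ('a, 'e) tvec \<Rightarrow> ('b, 'f) tvec \<Rightarrow> ('a \<times> 'b, 'e \<times> 'f) tvec" where
  "tpair N P x y X Y = (THE Z. Z \<in> tangent_space (prod_atlas N P) (x, y) \<and>
     diff (prod_atlas N P) N fst (x, y) Z = X \<and> diff (prod_atlas N P) P snd (x, y) Z = Y)"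

definition submersion ::
  "('a, 'e::real_normed_vector) atlas \<Rightarrow> ('b, 'f::real_normed_vector) atlas \<Rightarrow> ('a \<Rightarrow> 'b) \<Rightarrow> bool" where
  "submersion N P f \<longleftrightarrow> smooth_map_on N P (points N) f \<and>
     (\<forall>x\<in>points N. diff N P f x ` tangent_space N x = tangent_space P (f x))"


section \<open>Covectors and tensor fields\<close>

text \<open>The dual of a vector space \<open>V\<close> of functions; functionals are extended by 0 outside \<open>V\<close>.\<close>

definition dual_space :: "('k \<Rightarrow> 'e::real_vector) set \<Rightarrow> (('k \<Rightarrow> 'e) \<Rightarrow> real) set" where
  "dual_space V = {\<xi>.
     (\<forall>X\<in>V. \<forall>Y\<in>V. \<xi> (\<lambda>k. X k + Y k) = \<xi> X + \<xi> Y) \<and>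
     (\<forall>a. \<forall>X\<in>V. \<xi> (\<lambda>k. a *\<^sub>R X k) = a * \<xi> X) \<and>
     (\<forall>X. X \<notin> V \<longrightarrow> \<xi> X = 0)}"

type_synonym ('a, 'e) covec = "('a, 'e) tvec \<Rightarrow> real"

definition cotangent_space :: "('a, 'e::real_normed_vector) atlas \<Rightarrow> 'a \<Rightarrow> ('a, 'e) covec set" where
  "cotangent_space N p = dual_space (tangent_space N p)"

definition alternating_multilinear ::
  "('k \<Rightarrow> 'v::real_vector) set \<Rightarrow> nat \<Rightarrow> (('k \<Rightarrow> 'v) list \<Rightarrow> real) \<Rightarrow> bool" where
  "alternating_multilinear V k f \<longleftrightarrow>
     (\<forall>xs. length xs = k \<and> set xs \<subseteq> V \<longrightarrow> (\<forall>i<k.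
        (\<forall>x\<in>V. \<forall>y\<in>V. f (xs[i := \<lambda>j. x j + y j]) = f (xs[i := x]) + f (xs[i := y])) \<and>
        (\<forall>a. \<forall>x\<in>V. f (xs[i := \<lambda>j. a *\<^sub>R x j]) = a * f (xs[i := x])) \<and>
        (\<forall>j<k. i \<noteq> j \<and> xs ! i = xs ! j \<longrightarrow> f xs = 0)))"

text \<open>The tangent vector at \<open>x\<close> whose expression in the chart \<open>\<kappa>\<close> is \<open>v\<close>, and the covector at \<open>x\<close>
  whose expression in \<open>\<kappa>\<close> is \<open>\<beta>\<close>.\<close>

definition coord_vec ::
  "('a, 'e::real_normed_vector) atlas \<Rightarrow> ('a, 'e) chart \<Rightarrow> 'a \<Rightarrow> 'e \<Rightarrow> ('a, 'e) tvec" where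
  "coord_vec N \<kappa> x v = (\<lambda>\<mu>. if \<mu> \<in> N \<and> x \<in> fst \<mu>
     then frechet_derivative (transition \<kappa> \<mu>) (at (snd \<kappa> x)) v else 0)"

definition coord_covec ::
  "('a, 'e::real_normed_vector) atlas \<Rightarrow> ('a, 'e) chart \<Rightarrow> 'a \<Rightarrow> ('e \<Rightarrow> real) \<Rightarrow> ('a, 'e) covec" where
  "coord_covec N \<kappa> x \<beta> = (\<lambda>X. if X \<in> tangent_space N x then \<beta> (X \<kappa>) else 0)"

text \<open>Smooth sections of \<open>\<wedge>\<^sup>pTN \<otimes> \<wedge>\<^sup>qT\<^sup>*N\<close>: at \<open>x\<close> such a section is a function of \<open>q\<close> vectors and
  \<open>p\<close> covectors at \<open>x\<close>. Smoothness is smoothness of the coefficients in every chart.\<close>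

type_synonym ('a, 'e) tensor = "'a \<Rightarrow> ('a, 'e) tvec list \<Rightarrow> ('a, 'e) covec list \<Rightarrow> real"

definition tensor_field ::
  "('a, 'e::real_normed_vector) atlas \<Rightarrow> nat \<Rightarrow> nat \<Rightarrow> ('a, 'e) tensor \<Rightarrow> bool" where
  "tensor_field N p q F \<longleftrightarrow>
     (\<forall>x\<in>points N.
        (\<forall>\<xi>s. length \<xi>s = p \<and> set \<xi>s \<subseteq> cotangent_space N x \<longrightarrow>
           alternating_multilinear (tangent_space N x) q (\<lambda>Xs. F x Xs \<xi>s)) \<and>
        (\<forall>Xs. length Xs = q \<and> set Xs \<subseteq> tangent_space N x \<longrightarrow>
           alternating_multilinear (cotangent_space N x) p (\<lambda>\<xi>s. F x Xs \<xi>s))) \<and>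
     (\<forall>(U, \<phi>)\<in>N. \<forall>vs \<beta>s. length vs = q \<and> length \<beta>s = p \<and> (\<forall>\<beta>\<in>set \<beta>s. linear \<beta>) \<longrightarrow>
        smooth_on (\<phi> ` U) (\<lambda>y. let x = inv_into U \<phi> y in
          F x (map (coord_vec N (U, \<phi>) x) vs) (map (coord_covec N (U, \<phi>) x) \<beta>s)))"

type_synonym ('a, 'e) multivector = "'a \<Rightarrow> ('a, 'e) covec list \<Rightarrow> real"
type_synonym ('a, 'e) form = "'a \<Rightarrow> ('a, 'e) tvec list \<Rightarrow> real"

definition multivector_field ::
  "('a, 'e::real_normed_vector) atlas \<Rightarrow> nat \<Rightarrow> ('a, 'e) multivector \<Rightarrow> bool" where
  "multivector_field N k \<Lambda> \<longleftrightarrow> tensor_field N k 0 (\<lambda>x Xs \<xi>s. \<Lambda> x \<xi>s)"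

definition differential_form ::
  "('a, 'e::real_normed_vector) atlas \<Rightarrow> nat \<Rightarrow> ('a, 'e) form \<Rightarrow> bool" where
  "differential_form N k \<Theta> \<longleftrightarrow> tensor_field N 0 k (\<lambda>x Xs \<xi>s. \<Theta> x Xs)"

definition pullback_form ::
  "('a, 'e::real_normed_vector) atlas \<Rightarrow> ('b, 'f::real_normed_vector) atlas \<Rightarrow> 'a set \<Rightarrow> ('a \<Rightarrow> 'b)
     \<Rightarrow> ('b, 'f) form \<Rightarrow> ('a, 'e) form" where
  "pullback_form N P S f \<Theta> = (\<lambda>x Xs. \<Theta> (f x) (map (differential N P S f x) Xs))"

definition pullback_covec ::
  "('a, 'e::real_normed_vector) atlas \<Rightarrow> ('b, 'f::real_normed_vector) atlas \<Rightarrow> ('a \<Rightarrow> 'b) \<Rightarrow> 'a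
     \<Rightarrow> ('b, 'f) covec \<Rightarrow> ('a, 'e) covec" where
  "pullback_covec N P f x \<xi> = (\<lambda>X. if X \<in> tangent_space N x then \<xi> (diff N P f x X) else 0)"

text \<open>The multivector field \<open>\<Lambda>\<^sub>1 \<oplus> \<Lambda>\<^sub>2\<close> on \<open>N \<times> P\<close>: push each summand forward along the inclusion
  of the corresponding factor, i.e. restrict covectors to that factor.\<close>

definition mv_sum ::
  "('a, 'e::real_normed_vector) atlas \<Rightarrow> ('b, 'f::real_normed_vector) atlas
     \<Rightarrow> ('a, 'e) multivector \<Rightarrow> ('b, 'f) multivector \<Rightarrow> ('a \<times> 'b, 'e \<times> 'f) multivector" where
  "mv_sum N P \<Lambda>1 \<Lambda>2 = (\<lambda>(x, y) \<xi>s.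
     \<Lambda>1 x (map (pullback_covec N (prod_atlas N P) (\<lambda>z. (z, y)) x) \<xi>s) +
     \<Lambda>2 y (map (pullback_covec P (prod_atlas N P) (\<lambda>z. (x, z)) y) \<xi>s))"

text \<open>Meant for submanifolds \<open>S\<close> of \<open>N\<close>. The set to which it is applied below is one, because source
  and target of a Lie groupoid are submersions.\<close>

definition coisotropic ::
  "('a, 'e::real_normed_vector) atlas \<Rightarrow> nat \<Rightarrow> ('a, 'e) multivector \<Rightarrow> 'a set \<Rightarrow> bool" where
  "coisotropic N k \<Lambda> S \<longleftrightarrow>
     (\<forall>x\<in>S. \<forall>\<xi>s. length \<xi>s = k \<and> set \<xi>s \<subseteq> cotangent_space N x \<and>
        (\<forall>\<xi>\<in>set \<xi>s. \<forall>X\<in>tangent_of_subset N S x. \<xi> X = 0) \<longrightarrow> \<Lambda> x \<xi>s = 0)"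


section \<open>Groupoids\<close>

record ('g, 'm) groupoid =
  Arr :: "'g set"
  Obj :: "'m set"
  src :: "'g \<Rightarrow> 'm"
  tgt :: "'g \<Rightarrow> 'm"
  unt :: "'m \<Rightarrow> 'g"
  ivt :: "'g \<Rightarrow> 'g"
  mul :: "'g \<Rightarrow> 'g \<Rightarrow> 'g"

definition composable :: "('g, 'm) groupoid \<Rightarrow> ('g \<times> 'g) set" where
  "composable G = {(g, h). g \<in> Arr G \<and> h \<in> Arr G \<and> src G g = tgt G h}"

definition is_groupoid :: "('g, 'm) groupoid \<Rightarrow> bool" where
  "is_groupoid G \<longleftrightarrow>
     src G \<in> Arr G \<rightarrow> Obj G \<and> tgt G \<in> Arr G \<rightarrow> Obj G \<and>
     unt G \<in> Obj G \<rightarrow> Arr G \<and> ivt G \<in> Arr G \<rightarrow> Arr G \<and>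
     (\<forall>x\<in>Obj G. src G (unt G x) = x \<and> tgt G (unt G x) = x) \<and>
     (\<forall>(g, h)\<in>composable G. mul G g h \<in> Arr G \<and>
        src G (mul G g h) = src G h \<and> tgt G (mul G g h) = tgt G g) \<and>
     (\<forall>g h k. (g, h) \<in> composable G \<and> (h, k) \<in> composable G \<longrightarrow>
        mul G (mul G g h) k = mul G g (mul G h k)) \<and>
     (\<forall>g\<in>Arr G. mul G (unt G (tgt G g)) g = g \<and> mul G g (unt G (src G g)) = g \<and>
        src G (ivt G g) = tgt G g \<and> tgt G (ivt G g) = src G g \<and>
        mul G g (ivt G g) = unt G (tgt G g) \<and> mul G (ivt G g) g = unt G (src G g))"

definition affine_function :: "('g, 'm) groupoid \<Rightarrow> ('g \<Rightarrow> real) \<Rightarrow> bool" where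
  "affine_function G F \<longleftrightarrow>
     (\<forall>(g, h)\<in>composable G. F (mul G g h) = F g + F h - F (unt G (src G g)))"

text \<open>\<open>N\<close> and \<open>M\<close> are the manifold structures on the sets of arrows and of objects.\<close>

definition lie_groupoid ::
  "('g, 'e::real_inner) atlas \<Rightarrow> ('m, 'f::real_inner) atlas \<Rightarrow> ('g, 'm) groupoid \<Rightarrow> bool" where
  "lie_groupoid N M G \<longleftrightarrow>
     smooth_manifold N \<and> smooth_manifold M \<and> is_groupoid G \<and>
     Arr G = points N \<and> Obj G = points M \<and>
     submersion N M (src G) \<and> submersion N M (tgt G) \<and>
     smooth_map_on M N (points M) (unt G) \<and> smooth_map_on N N (points N) (ivt G) \<and>
     smooth_map_on (prod_atlas N N) N (composable G) (\<lambda>(g, h). mul G g h)"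


section \<open>The tangent and the cotangent groupoid\<close>

definition tangent_mul ::
  "('g, 'e::real_normed_vector) atlas \<Rightarrow> ('g, 'm) groupoid
     \<Rightarrow> 'g \<Rightarrow> ('g, 'e) tvec \<Rightarrow> 'g \<Rightarrow> ('g, 'e) tvec \<Rightarrow> ('g, 'e) tvec" where
  "tangent_mul N G g X h Y =
     differential (prod_atlas N N) N (composable G) (\<lambda>(a, b). mul G a b) (g, h) (tpair N N g h X Y)"

definition tangent_groupoid ::
  "('g, 'e::real_normed_vector) atlas \<Rightarrow> ('m, 'f::real_normed_vector) atlas \<Rightarrow> ('g, 'm) groupoid
     \<Rightarrow> ('g \<times> ('g, 'e) tvec, 'm \<times> ('m, 'f) tvec) groupoid" where
  "tangent_groupoid N M G = \<lparr>
     Arr = (SIGMA g:Arr G. tangent_space N g),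
     Obj = (SIGMA x:Obj G. tangent_space M x),
     src = (\<lambda>(g, X). (src G g, diff N M (src G) g X)),
     tgt = (\<lambda>(g, X). (tgt G g, diff N M (tgt G) g X)),
     unt = (\<lambda>(x, v). (unt G x, diff M N (unt G) x v)),
     ivt = (\<lambda>(g, X). (ivt G g, diff N N (ivt G) g X)),
     mul = (\<lambda>(g, X) (h, Y). (mul G g h, tangent_mul N G g X h Y)) \<rparr>"

definition algebroid_fibre ::
  "('g, 'e::real_normed_vector) atlas \<Rightarrow> ('m, 'f::real_normed_vector) atlas \<Rightarrow> ('g, 'm) groupoid
     \<Rightarrow> 'm \<Rightarrow> ('g, 'e) tvec set" where
  "algebroid_fibre N M G x =
     {u \<in> tangent_space N (unt G x). diff N M (src G) (unt G x) u = (\<lambda>\<kappa>. 0)}"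

text \<open>\<open>R\<^sub>g\<close> is defined on the source fibre over \<open>t(g)\<close> and \<open>L\<^sub>g\<close> on the target fibre over \<open>s(g)\<close>.\<close>

definition right_vec ::
  "('g, 'e::real_normed_vector) atlas \<Rightarrow> ('g, 'm) groupoid \<Rightarrow> 'g \<Rightarrow> ('g, 'e) tvec \<Rightarrow> ('g, 'e) tvec" where
  "right_vec N G g u =
     differential N N {k \<in> Arr G. src G k = tgt G g} (\<lambda>k. mul G k g) (unt G (tgt G g)) u"

definition left_vec ::
  "('g, 'e::real_normed_vector) atlas \<Rightarrow> ('g, 'm) groupoid \<Rightarrow> 'g \<Rightarrow> ('g, 'e) tvec \<Rightarrow> ('g, 'e) tvec" where
  "left_vec N G g u = (\<lambda>\<kappa>. -
     differential N N {k \<in> Arr G. tgt G k = src G g} (\<lambda>k. mul G g k) (unt G (src G g))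
       (diff N N (ivt G) (unt G (src G g)) u) \<kappa>)"

text \<open>The unit at \<open>a \<in> A\<^sup>*\<^sub>x\<close> is the covector vanishing on \<open>T\<^sub>xM\<close> and equal to \<open>a\<close> on \<open>A\<^sub>x\<close>; the projection
  of \<open>T\<^sub>x\<G> = T\<^sub>xM \<oplus> A\<^sub>x\<close> to \<open>A\<^sub>x\<close> is \<open>X \<mapsto> X - d\<iota>(ds(X))\<close>. The inverse is determined by
  \<open>\<xi>\<^sup>-\<^sup>1(d inv(X)) = - \<xi>(X)\<close>.\<close>

definition cotangent_groupoid ::
  "('g, 'e::real_normed_vector) atlas \<Rightarrow> ('m, 'f::real_normed_vector) atlas \<Rightarrow> ('g, 'm) groupoid
     \<Rightarrow> ('g \<times> ('g, 'e) covec, 'm \<times> ('g, 'e) covec) groupoid" where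
  "cotangent_groupoid N M G = \<lparr>
     Arr = (SIGMA g:Arr G. cotangent_space N g),
     Obj = (SIGMA x:Obj G. dual_space (algebroid_fibre N M G x)),
     src = (\<lambda>(g, \<xi>). (src G g,
       \<lambda>u. if u \<in> algebroid_fibre N M G (src G g) then \<xi> (left_vec N G g u) else 0)),
     tgt = (\<lambda>(g, \<xi>). (tgt G g,
       \<lambda>u. if u \<in> algebroid_fibre N M G (tgt G g) then \<xi> (right_vec N G g u) else 0)),
     unt = (\<lambda>(x, a). (unt G x,
       \<lambda>X. if X \<in> tangent_space N (unt G x)
         then a (\<lambda>\<kappa>. X \<kappa> - diff M N (unt G) x (diff N M (src G) (unt G x) X) \<kappa>) else 0)),
     ivt = (\<lambda>(g, \<xi>). (ivt G g,
       \<lambda>X. if X \<in> tangent_space N (ivt G g) then - \<xi> (diff N N (ivt G) (ivt G g) X) else 0)),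
     mul = (\<lambda>(g, \<xi>) (h, \<eta>). (mul G g h,
       THE \<zeta>. \<zeta> \<in> cotangent_space N (mul G g h) \<and>
         (\<forall>X Y. ((g, X), (h, Y)) \<in> composable (tangent_groupoid N M G) \<longrightarrow>
            \<zeta> (tangent_mul N G g X h Y) = \<xi> X + \<eta> Y))) \<rparr>"

text \<open>The direct sum of \<open>q\<close> copies of \<open>V\<close> and \<open>p\<close> copies of \<open>W\<close> over \<open>G\<close>, for groupoids \<open>V\<close> and \<open>W\<close>
  whose arrows and objects are pairs of a base point and a fibre element.\<close>

definition direct_sum_groupoid ::
  "nat \<Rightarrow> nat \<Rightarrow> ('g, 'm) groupoid \<Rightarrow> ('g \<times> 'v, 'm \<times> 'a) groupoid \<Rightarrow> ('g \<times> 'w, 'm \<times> 'b) groupoid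
     \<Rightarrow> ('g \<times> 'v list \<times> 'w list, 'm \<times> 'a list \<times> 'b list) groupoid" where
  "direct_sum_groupoid q p G V W = \<lparr>
     Arr = {(g, Xs, \<xi>s). g \<in> Arr G \<and> length Xs = q \<and> length \<xi>s = p \<and>
       (\<forall>X\<in>set Xs. (g, X) \<in> Arr V) \<and> (\<forall>\<xi>\<in>set \<xi>s. (g, \<xi>) \<in> Arr W)},
     Obj = {(x, vs, bs). x \<in> Obj G \<and> length vs = q \<and> length bs = p \<and>
       (\<forall>v\<in>set vs. (x, v) \<in> Obj V) \<and> (\<forall>a\<in>set bs. (x, a) \<in> Obj W)},
     src = (\<lambda>(g, Xs, \<xi>s). (src G g,
       map (\<lambda>X. snd (src V (g, X))) Xs, map (\<lambda>\<xi>. snd (src W (g, \<xi>))) \<xi>s)),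
     tgt = (\<lambda>(g, Xs, \<xi>s). (tgt G g,
       map (\<lambda>X. snd (tgt V (g, X))) Xs, map (\<lambda>\<xi>. snd (tgt W (g, \<xi>))) \<xi>s)),
     unt = (\<lambda>(x, vs, bs). (unt G x,
       map (\<lambda>v. snd (unt V (x, v))) vs, map (\<lambda>a. snd (unt W (x, a))) bs)),
     ivt = (\<lambda>(g, Xs, \<xi>s). (ivt G g,
       map (\<lambda>X. snd (ivt V (g, X))) Xs, map (\<lambda>\<xi>. snd (ivt W (g, \<xi>))) \<xi>s)),
     mul = (\<lambda>(g, Xs, \<xi>s) (h, Ys, \<eta>s). (mul G g h,
       map2 (\<lambda>X Y. snd (mul V (g, X) (h, Y))) Xs Ys,
       map2 (\<lambda>\<xi> \<eta>. snd (mul W (g, \<xi>) (h, \<eta>))) \<xi>s \<eta>s)) \<rparr>"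


section \<open>Affine tensors, multivector fields and forms\<close>

definition affine_tensor ::
  "('g, 'e::real_normed_vector) atlas \<Rightarrow> ('m, 'f::real_normed_vector) atlas \<Rightarrow> ('g, 'm) groupoid
     \<Rightarrow> nat \<Rightarrow> nat \<Rightarrow> ('g, 'e) tensor \<Rightarrow> bool" where
  "affine_tensor N M G p q F \<longleftrightarrow> tensor_field N p q F \<and>
     affine_function
       (direct_sum_groupoid q p G (tangent_groupoid N M G) (cotangent_groupoid N M G))
       (\<lambda>(g, Xs, \<xi>s). F g Xs \<xi>s)"

definition affine_multivector_field ::
  "('g, 'e::real_normed_vector) atlas \<Rightarrow> ('g, 'm) groupoid \<Rightarrow> nat \<Rightarrow> ('g, 'e) multivector \<Rightarrow> bool" where
  "affine_multivector_field N G k \<Lambda> \<longleftrightarrow> multivector_field N k \<Lambda> \<and>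
     (let N2 = prod_atlas N N; N3 = prod_atlas N N2; N4 = prod_atlas N N3;
          \<Lambda>' = (\<lambda>g \<xi>s. (-1) ^ (k + 1) * \<Lambda> g \<xi>s)
      in coisotropic N4 k (mv_sum N N3 \<Lambda> (mv_sum N N2 \<Lambda>' (mv_sum N N \<Lambda>' \<Lambda>)))
           {(g, h, l, mul G (mul G h (ivt G g)) l) | g h l.
              g \<in> Arr G \<and> h \<in> Arr G \<and> l \<in> Arr G \<and> src G g = src G h \<and> tgt G g = tgt G l})"

definition affine_form ::
  "('g, 'e::real_normed_vector) atlas \<Rightarrow> ('m, 'f::real_normed_vector) atlas \<Rightarrow> ('g, 'm) groupoid
     \<Rightarrow> nat \<Rightarrow> ('g, 'e) form \<Rightarrow> bool" where
  "affine_form N M G k \<Theta> \<longleftrightarrow> differential_form N k \<Theta> \<and>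
     (let N2 = prod_atlas N N; G2 = composable G in
      \<forall>z\<in>G2. \<forall>Zs. length Zs = k \<and> set Zs \<subseteq> tangent_of_subset N2 G2 z \<longrightarrow>
        pullback_form N2 N G2 (\<lambda>(g, h). mul G g h) \<Theta> z Zs =
          pullback_form N2 N G2 fst \<Theta> z Zs + pullback_form N2 N G2 snd \<Theta> z Zs
          - pullback_form N2 N G2 fst
              (pullback_form N M (points N) (src G) (pullback_form M N (points M) (unt G) \<Theta>)) z Zs)"

end

theory Submission
  imports Defs
begin

text \<open>Differentials are computed on velocities of curves. Since source and target are submersions,
  composable tangent vectors are velocities of composable curves, which makes the multiplication of
  the tangent groupoid linear on composable pairs.

  For forms, the tangent vectors of \<open>\<G>\<^sup>(\<^sup>2\<^sup>)\<close> are thereby the composable pairs of tangent vectors of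
  \<open>\<G>\<close>, and the two affinity conditions become the same identity.

  For multivector fields, a conormal covector \<open>(\<xi>1, \<xi>2, \<xi>3, \<xi>4)\<close> at \<open>(g, h, l, h g\<^sup>-\<^sup>1 l)\<close> yields a
  covector \<open>\<kappa>\<close> at \<open>h g\<^sup>-\<^sup>1\<close> with \<open>\<kappa> \<cdot> \<xi>1 = -\<xi>2\<close> and \<open>\<kappa> \<cdot> (-\<xi>3) = \<xi>4\<close>. Applying affinity to both
  products and subtracting, the values at \<open>\<kappa>\<close> and at the unit cancel.\<close>

section \<open>Finite-dimensional inner product spaces\<close>

text \<open>Velocities are asked of curves that are merely differentiable at 0. This makes lifting
  along a submersion cheap: the lift can be chosen separately for each time, and only its
  first-order behaviour at 0 has to be controlled. Identities in the tangent groupoid then come from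
  differentiating identities between curves of arrows.

  The product of the cotangent groupoid is a definite description, so every product is first
  exhibited: a covector \<open>\<zeta>\<close> with the multiplicative property is at hand, and it
  is unique because tangent products fill the whole tangent space at \<open>g h\<close>.
  Composability of the two factors follows from the existence of \<open>\<zeta>\<close> too: they
  must add up to 0 on pairs of tangent vectors with zero product, and the pairs made of left and
  right translates express equality of source and target.

  The factor \<open>(-1) ^ (p + 1)\<close> consists of \<open>p\<close> signs from negating
  \<open>p\<close> covectors and one more from moving the two middle terms across the
  equation.\<close>

lemma orthogonal_expansion:
  fixes C :: "'e::real_inner set"
  assumes "finite C" "pairwise orthogonal C" "x \<in> span C"
  shows "x = (\<Sum>b\<in>C. ((x \<bullet> b) / (b \<bullet> b)) *\<^sub>R b)"
proof -
  define y where "y = x - (\<Sum>b\<in>C. ((x \<bullet> b) / (b \<bullet> b)) *\<^sub>R b)"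
  have perp: "orthogonal y b" if b: "b \<in> C" for b
  proof -
    have "(\<Sum>a\<in>C. ((x \<bullet> a) / (a \<bullet> a)) *\<^sub>R a) \<bullet> b = (\<Sum>a\<in>C. ((x \<bullet> a) / (a \<bullet> a)) * (a \<bullet> b))"
      by (simp add: inner_sum_left)
    \<comment> \<open>The vector 0 may belong to \<open>C\<close>: for \<open>a = b = 0\<close> both
      summands are 0.\<close>
    also have "\<dots> = (\<Sum>a\<in>C. if a = b then x \<bullet> b else 0)"
      using assms(2) b by (intro sum.cong) (auto simp: pairwise_def orthogonal_def)
    also have "\<dots> = x \<bullet> b"
      using assms(1) b by simp
    finally show ?thesis
      by (simp add: y_def orthogonal_def inner_diff_left)
  qed
  \<comment> \<open>\<open>y\<close> lies in the span of \<open>C\<close> and is orthogonal to it,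
    hence to itself.\<close>
  have "y \<in> span C"
    unfolding y_def using assms(3) by (intro span_diff span_sum span_scale) (auto intro: span_base)
  then have "orthogonal y y"
    using perp by (metis orthogonal_to_span)
  then show ?thesis
    by (simp add: y_def orthogonal_self)
qed

text \<open>Gram-Schmidt supplies coordinates on the model spaces, which may have dimension 0 and
  are therefore not assumed to be of class \<open>euclidean_space\<close>.\<close>

lemma finite_dim_expansion:
  assumes "\<exists>B::'e::real_inner set. finite B \<and> span B = UNIV"
  obtains C :: "'e::real_inner set" where "finite C" "\<And>x. x = (\<Sum>b\<in>C. ((x \<bullet> b) / (b \<bullet> b)) *\<^sub>R b)"
proof -
  obtain C :: "'e set" where "finite C" "span C = UNIV" "pairwise orthogonal C"
    using assms by (metis basis_orthogonal)
  then show ?thesis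
    using that[of C] orthogonal_expansion[of C] by (metis UNIV_I)
qed

text \<open>The coordinates of a Cauchy sequence converge in the reals. Completeness serves the
  Banach fixed point argument by which curves are lifted.\<close>

lemma finite_dim_complete:
  assumes "\<exists>B::'e::real_inner set. finite B \<and> span B = UNIV"
  shows "complete (UNIV :: 'e::real_inner set)"
  unfolding complete_def
proof (intro allI impI)
  fix f :: "nat \<Rightarrow> 'e" assume f: "(\<forall>n. f n \<in> UNIV) \<and> Cauchy f"
  obtain C :: "'e set" where C: "finite C" "\<And>x. x = (\<Sum>b\<in>C. ((x \<bullet> b) / (b \<bullet> b)) *\<^sub>R b)"
    using finite_dim_expansion[OF assms] by blast
  have "\<exists>l. (\<lambda>n. f n \<bullet> b) \<longlonglongrightarrow> l" for b
    using bounded_linear.Cauchy[OF bounded_linear_inner_left, of f b] f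
    by (meson Cauchy_convergent_iff convergentD)
  then obtain l where l: "\<And>b. (\<lambda>n. f n \<bullet> b) \<longlonglongrightarrow> l b"
    by metis
  have "(\<lambda>n. \<Sum>b\<in>C. ((f n \<bullet> b) * inverse (b \<bullet> b)) *\<^sub>R b) \<longlonglongrightarrow> (\<Sum>b\<in>C. (l b * inverse (b \<bullet> b)) *\<^sub>R b)"
    by (intro tendsto_sum tendsto_scaleR tendsto_mult l tendsto_const)
  moreover have "f = (\<lambda>n. \<Sum>b\<in>C. ((f n \<bullet> b) * inverse (b \<bullet> b)) *\<^sub>R b)"
    using C(2) by (simp add: divide_inverse)
  ultimately show "\<exists>l\<in>UNIV. f \<longlonglongrightarrow> l"
    by auto
qed

text \<open>The constant is explicit in the values \<open>f b\<close>: if these tend to 0 for the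
  finitely many \<open>b\<close>, so does the operator norm. Directional information thus becomes
  uniform.\<close>

lemma linear_norm_le_basis:
  fixes f :: "'e::real_inner \<Rightarrow> 'f::real_normed_vector"
  assumes "linear f" "\<And>x. x = (\<Sum>b\<in>C. ((x \<bullet> b) / (b \<bullet> b)) *\<^sub>R b)"
  shows "norm (f x) \<le> (\<Sum>b\<in>C. norm (f b) * (norm b / (b \<bullet> b))) * norm x"
proof -
  have "f x = (\<Sum>b\<in>C. ((x \<bullet> b) / (b \<bullet> b)) *\<^sub>R f b)"
    by (subst assms(2)[of x]) (simp add: linear_sum[OF assms(1)] linear_scale[OF assms(1)])
  also have "norm \<dots> \<le> (\<Sum>b\<in>C. norm (f b) * (norm b / (b \<bullet> b)) * norm x)"
  proof (rule sum_norm_le)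
    fix b
    have "norm (((x \<bullet> b) / (b \<bullet> b)) *\<^sub>R f b) = (\<bar>x \<bullet> b\<bar> / (b \<bullet> b)) * norm (f b)"
      by simp
    also have "\<dots> \<le> (norm x * norm b / (b \<bullet> b)) * norm (f b)"
      by (intro mult_right_mono divide_right_mono Cauchy_Schwarz_ineq2) auto
    finally show "norm (((x \<bullet> b) / (b \<bullet> b)) *\<^sub>R f b) \<le> norm (f b) * (norm b / (b \<bullet> b)) * norm x"
      by (simp add: mult_ac)
  qed
  finally show ?thesis
    by (simp add: sum_distrib_right)
qed

lemma finite_dim_linear_bounded:
  fixes f :: "'e::real_inner \<Rightarrow> 'f::real_normed_vector"
  assumes "\<exists>B::'e set. finite B \<and> span B = UNIV" "linear f"
  shows "bounded_linear f"
proof -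
  obtain C :: "'e set" where C: "\<And>x. x = (\<Sum>b\<in>C. ((x \<bullet> b) / (b \<bullet> b)) *\<^sub>R b)"
    using finite_dim_expansion[OF assms(1)] by blast
  show ?thesis
    using linear_norm_le_basis[OF assms(2) C] assms(2)
    by (intro bounded_linear_intro[where K = "\<Sum>b\<in>C. norm (f b) * (norm b / (b \<bullet> b))"])
       (auto simp: linear_add linear_scale mult.commute)
qed

section \<open>Lifting curves along a map with surjective derivative\<close>

text \<open>Smoothness as defined gives continuity of each directional derivative separately. Finite
  dimension upgrades this to continuity in operator norm, and the mean value inequality on a ball
  makes \<open>T - D\<close> Lipschitz with a constant as small as desired.\<close>

lemma continuous_partials_imp_strict_derivative:
  fixes T :: "'e::real_inner \<Rightarrow> 'f::real_normed_vector"
  assumes fin: "\<exists>B::'e set. finite B \<and> span B = UNIV"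
    and V: "open V" "y0 \<in> V"
    and T: "\<And>y. y \<in> V \<Longrightarrow> T differentiable (at y)"
    and cont: "\<And>v. continuous_on V (\<lambda>y. frechet_derivative T (at y) v)"
    and "e > 0"
  defines "D \<equiv> frechet_derivative T (at y0)"
  obtains d where "d > 0" "ball y0 d \<subseteq> V"
    "\<And>x y. x \<in> ball y0 d \<Longrightarrow> y \<in> ball y0 d \<Longrightarrow> norm ((T x - D x) - (T y - D y)) \<le> e * norm (x - y)"
proof -
  define D' where "D' y = frechet_derivative T (at y)" for y
  have D': "(T has_derivative D' y) (at y)" if "y \<in> V" for y
    using T[OF that] by (simp add: D'_def frechet_derivative_works[symmetric])
  have D: "bounded_linear D"
    using D'[OF V(2)] by (auto simp: D_def D'_def has_derivative_def)
  obtain C :: "'e set" where C: "\<And>x. x = (\<Sum>b\<in>C. ((x \<bullet> b) / (b \<bullet> b)) *\<^sub>R b)"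
    using finite_dim_expansion[OF fin] by blast
  \<comment> \<open>\<open>h y\<close> bounds the operator norm of \<open>D' y - D\<close>, is
    continuous in \<open>y\<close> and vanishes at \<open>y0\<close>.\<close>
  define h where "h y = (\<Sum>b\<in>C. norm (D' y b - D b) * (norm b / (b \<bullet> b)))" for y
  have "continuous_on V h"
    unfolding h_def D'_def by (intro continuous_intros cont)
  then have "isCont h y0"
    using V by (simp add: continuous_on_eq_continuous_at)
  moreover have "h y0 = 0"
    by (simp add: h_def D_def D'_def)
  ultimately have "\<forall>\<^sub>F y in nhds y0. h y < e"
    using \<open>e > 0\<close> by (metis order_tendstoD(2) isCont_def tendsto_at_iff_tendsto_nhds)
  moreover have "\<forall>\<^sub>F y in nhds y0. y \<in> V"
    using V by (rule eventually_nhds_in_open)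
  ultimately have "\<forall>\<^sub>F y in nhds y0. y \<in> V \<and> h y < e"
    by eventually_elim auto
  then obtain d where d: "d > 0" "\<And>y. y \<in> ball y0 d \<Longrightarrow> y \<in> V \<and> h y < e"
    unfolding eventually_nhds_metric by (auto simp: dist_commute)
  show ?thesis
  proof (rule that[OF d(1)])
    show "ball y0 d \<subseteq> V"
      using d(2) by auto
    fix x y assume xy: "x \<in> ball y0 d" "y \<in> ball y0 d"
    show "norm ((T x - D x) - (T y - D y)) \<le> e * norm (x - y)"
    proof (rule differentiable_bound[OF convex_ball _ _ xy])
      fix z assume "z \<in> ball y0 d"
      then have z: "z \<in> V" "h z < e"
        using d(2) by auto
      show "((\<lambda>x. T x - D x) has_derivative (\<lambda>v. D' z v - D v)) (at z within ball y0 d)"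
        by (intro has_derivative_diff has_derivative_at_withinI[OF D'[OF z(1)]]
            bounded_linear.has_derivative[OF D] has_derivative_ident)
      have "linear (\<lambda>v. D' z v - D v)"
        using D'[OF z(1)] D by (intro linear_compose_sub) (auto intro: bounded_linear.linear simp: has_derivative_def)
      then have "norm (D' z v - D v) \<le> h z * norm v" for v
        unfolding h_def by (rule linear_norm_le_basis[OF _ C])
      then show "onorm (\<lambda>v. D' z v - D v) \<le> e"
        using z(2) \<open>e > 0\<close>
        by (intro onorm_bound) (auto intro: order_trans[OF _ mult_right_mono[of "h z" e]])
    qed
  qed
qed

text \<open>Meant for a correction term that is chosen independently for each time: its derivative
  at 0 can only come from domination by a function of order o(\<tau>).\<close>

lemma has_vector_derivative_zero_dominated:
  assumes "(r has_vector_derivative 0) (at 0)" "r 0 = 0" "f 0 = 0"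
    and "\<And>\<tau>. norm (f \<tau>) \<le> K * norm (r \<tau>)"
  shows "(f has_vector_derivative 0) (at (0::real))"
proof -
  have "((\<lambda>h. norm (r h) / norm h) \<longlongrightarrow> 0) (at 0)"
    using assms(1,2) unfolding has_vector_derivative_def has_derivative_iff_norm by simp
  then have "((\<lambda>h. K * (norm (r h) / norm h)) \<longlongrightarrow> 0) (at 0)"
    using tendsto_mult_right_zero by blast
  then have "((\<lambda>h. norm (f h) / norm h) \<longlongrightarrow> 0) (at 0)"
  proof (rule Lim_null_comparison[rotated])
    show "\<forall>\<^sub>F h in at 0. norm (norm (f h) / norm h) \<le> K * (norm (r h) / norm h)"
      using assms(4) by (simp add: divide_right_mono)
  qed
  then show ?thesis
    using assms(3) unfolding has_vector_derivative_def has_derivative_iff_norm by simp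
qed

text \<open>Solves \<open>T (y0 + \<tau> w + P z) = u \<tau>\<close> for \<open>z\<close>, where \<open>P\<close> is a right inverse of \<open>D\<close>, by a
  contraction for each fixed \<open>\<tau>\<close>; the fixed point is \<open>o(\<tau>)\<close> because \<open>u\<close> and \<open>T (y0 + \<tau> w)\<close>
  agree to first order.\<close>

lemma lift_curve_along_surjective_derivative:
  fixes T :: "'e::real_inner \<Rightarrow> 'f::real_inner"
  assumes finE: "\<exists>B::'e set. finite B \<and> span B = UNIV"
    and finF: "\<exists>B::'f set. finite B \<and> span B = UNIV"
    and V: "open V" "y0 \<in> V"
    and T: "\<And>y. y \<in> V \<Longrightarrow> T differentiable (at y)"
    and cont: "\<And>v. continuous_on V (\<lambda>y. frechet_derivative T (at y) v)"
    and surj: "surj (frechet_derivative T (at y0))"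
    and u: "u 0 = T y0" "(u has_vector_derivative frechet_derivative T (at y0) w) (at 0)"
  obtains y where "y 0 = y0" "(y has_vector_derivative w) (at 0)" "\<forall>\<^sub>F \<tau> in nhds 0. T (y \<tau>) = u \<tau>"
proof -
  define D where "D = frechet_derivative T (at y0)"
  have TD: "(T has_derivative D) (at y0)"
    using T[OF V(2)] by (simp add: D_def frechet_derivative_works[symmetric])
  then have linD: "linear D"
    by (rule has_derivative_linear)
  obtain P where P: "linear P" "\<And>z. D (P z) = z"
    using linear_surjective_right_inverse[OF linD] surj by (auto simp: D_def fun_eq_iff)
  have blP: "bounded_linear P"
    by (rule finite_dim_linear_bounded[OF finF P(1)])
  then obtain K where K: "K > 0" "\<And>z. norm (P z) \<le> K * norm z"
    using bounded_linear.pos_bounded[OF blP] by (metis mult.commute)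
  define R where "R x = T x - D x" for x
  \<comment> \<open>The factor \<open>1 / (2 * K)\<close> compensates the bound \<open>K\<close> on
    \<open>P\<close>, so that \<open>R\<close> composed with \<open>P\<close> contracts by
    1/2.\<close>
  obtain d where d: "d > 0" and lip: "\<And>x y. x \<in> ball y0 d \<Longrightarrow> y \<in> ball y0 d \<Longrightarrow>
      norm (R x - R y) \<le> (1 / (2 * K)) * norm (x - y)"
    using continuous_partials_imp_strict_derivative[OF finE V T cont, of "1 / (2 * K)"] K(1)
    unfolding R_def D_def by (metis divide_pos_pos mult_pos_pos zero_less_numeral zero_less_one)
  \<comment> \<open>On the ball of this radius \<open>P z\<close> has norm at most
    \<open>d / 4\<close>, which leaves room for \<open>\<tau> *\<^sub>R w\<close>, of norm below
    \<open>d / 2\<close>, inside the ball of radius \<open>d\<close>.\<close>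
  define \<rho> where "\<rho> = d / (4 * K)"
  have \<rho>: "\<rho> > 0"
    using d K(1) by (simp add: \<rho>_def)
  define r where "r \<tau> = u \<tau> - T (y0 + \<tau> *\<^sub>R w)" for \<tau>
  have "((\<lambda>\<tau>. y0 + \<tau> *\<^sub>R w) has_derivative (\<lambda>\<tau>. \<tau> *\<^sub>R w)) (at 0)"
    by (auto intro!: derivative_eq_intros)
  then have "((\<lambda>\<tau>. y0 + \<tau> *\<^sub>R w) has_vector_derivative w) (at 0)"
    by (simp add: has_vector_derivative_def)
  then have "((T \<circ> (\<lambda>\<tau>. y0 + \<tau> *\<^sub>R w)) has_vector_derivative D w) (at 0)"
    using TD by (intro vector_derivative_diff_chain_within[where f'=w]) (auto intro: has_derivative_at_withinI)
  then have r: "(r has_vector_derivative 0) (at 0)"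
    using has_vector_derivative_diff[OF u(2)] by (fastforce simp: r_def[abs_def] D_def o_def)
  have r0: "r 0 = 0"
    by (simp add: r_def u(1))
  have small: "\<exists>z. norm z \<le> 2 * norm (r \<tau>) \<and> T (y0 + \<tau> *\<^sub>R w + P z) = u \<tau>"
    if \<tau>: "norm (\<tau> *\<^sub>R w) < d / 2" "norm (r \<tau>) < \<rho> / 2" for \<tau>
  proof -
    \<comment> \<open>As \<open>T x = R x + D x\<close> and \<open>D (P z) = z\<close>, the fixed
      points of \<open>Q\<close> are the solutions of
      \<open>T (y0 + \<tau> *\<^sub>R w + P z) = u \<tau>\<close>.\<close>
    define Q where "Q z = u \<tau> - R (y0 + \<tau> *\<^sub>R w + P z) - D (y0 + \<tau> *\<^sub>R w)" for z
    have in_ball: "y0 + \<tau> *\<^sub>R w + P z \<in> ball y0 d" if "z \<in> cball 0 \<rho>" for z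
    proof -
      have "norm (P z) \<le> K * \<rho>"
        using K that by (smt (verit, best) mem_cball_0 mult_left_mono)
      also have "\<dots> = d / 4"
        using K(1) by (simp add: \<rho>_def)
      finally have "norm (\<tau> *\<^sub>R w + P z) < d"
        using norm_triangle_ineq[of "\<tau> *\<^sub>R w" "P z"] \<tau>(1) d by linarith
      then show ?thesis
        by (metis ab_semigroup_add_class.add_ac(1) add_diff_cancel_left' dist_norm mem_ball norm_minus_commute)
    qed
    have contr: "dist (Q a) (Q b) \<le> (1/2) * dist a b" if "a \<in> cball 0 \<rho>" "b \<in> cball 0 \<rho>" for a b
    proof -
      have "norm (Q a - Q b) = norm (R (y0 + \<tau> *\<^sub>R w + P a) - R (y0 + \<tau> *\<^sub>R w + P b))"
        by (simp add: Q_def norm_minus_commute)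
      also have "\<dots> \<le> (1 / (2 * K)) * norm (P a - P b)"
        using lip[OF in_ball[OF that(1)] in_ball[OF that(2)]] by simp
      also have "\<dots> \<le> (1 / (2 * K)) * (K * norm (a - b))"
        using K by (intro mult_left_mono) (auto simp: linear_diff[OF P(1), symmetric])
      finally show ?thesis
        using K(1) by (simp add: dist_norm)
    qed
    have Q0: "Q 0 = r \<tau>"
      by (simp add: Q_def r_def R_def linear_0[OF P(1)])
    \<comment> \<open>The centre moves to \<open>r \<tau>\<close>, of norm below
      \<open>\<rho> / 2\<close>, and the contraction adds at most another
      \<open>\<rho> / 2\<close>.\<close>
    have "Q ` cball 0 \<rho> \<subseteq> cball 0 \<rho>"
    proof
      fix z' assume "z' \<in> Q ` cball 0 \<rho>"
      then obtain z where z: "z \<in> cball 0 \<rho>" "z' = Q z"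
        by auto
      have "norm (Q z) \<le> norm (Q 0) + dist (Q z) (Q 0)"
        by (metis dist_norm norm_triangle_sub)
      then show "z' \<in> cball 0 \<rho>"
        using contr[OF z(1), of 0] \<tau>(2) z \<rho> Q0 by simp
    qed
    moreover have "complete (cball (0::'f) \<rho>)"
      using finite_dim_complete[OF finF] by (metis complete_Int_closed closed_cball Int_UNIV_left)
    ultimately obtain z where z: "z \<in> cball 0 \<rho>" "Q z = z"
      using Banach_fix[of "cball 0 \<rho>" "1/2" Q] contr \<rho> by auto
    have "norm z \<le> norm (Q 0) + dist (Q z) (Q 0)"
      using z(2) by (metis dist_norm norm_triangle_sub)
    also have "dist (Q z) (Q 0) \<le> norm z / 2"
      using contr[OF z(1), of 0] \<rho> by simp
    finally have "norm z \<le> 2 * norm (r \<tau>)"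
      by (simp add: Q0)
    moreover have "T (y0 + \<tau> *\<^sub>R w + P z) = u \<tau>"
      using z(2) by (simp add: Q_def R_def linear_add[OF linD] P(2) algebra_simps)
    ultimately show ?thesis
      by blast
  qed
  have "isCont r 0"
    using r by (rule has_vector_derivative_continuous)
  then have "(r \<longlongrightarrow> 0) (nhds 0)"
    by (metis isCont_def r0 tendsto_at_iff_tendsto_nhds)
  then have ev1: "\<forall>\<^sub>F \<tau> in nhds 0. norm (r \<tau>) < \<rho> / 2"
    using \<rho> by (metis half_gt_zero order_tendstoD(2) tendsto_norm_zero)
  have "((\<lambda>\<tau>. norm (\<tau> *\<^sub>R w)) \<longlongrightarrow> norm ((0::real) *\<^sub>R w)) (nhds 0)"
    by (intro tendsto_intros filterlim_ident)
  then have "\<forall>\<^sub>F \<tau>::real in nhds 0. norm (\<tau> *\<^sub>R w) < d / 2"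
    using d by (intro order_tendstoD(2)) auto
  with ev1 have ev: "\<forall>\<^sub>F \<tau> in nhds 0. \<exists>z. norm z \<le> 2 * norm (r \<tau>) \<and> T (y0 + \<tau> *\<^sub>R w + P z) = u \<tau>"
    by eventually_elim (rule small)
  define good where "good \<tau> z \<longleftrightarrow> norm z \<le> 2 * norm (r \<tau>) \<and> T (y0 + \<tau> *\<^sub>R w + P z) = u \<tau>" for \<tau> z
  \<comment> \<open>The default 0 keeps the bound by \<open>2 * norm (r \<tau>)\<close> valid at all
    times, also where no solution exists.\<close>
  define z where "z \<tau> = (if \<exists>z. good \<tau> z then SOME z. good \<tau> z else 0)" for \<tau>
  have z: "\<exists>z. good \<tau> z \<Longrightarrow> good \<tau> (z \<tau>)" for \<tau>
    unfolding z_def by (simp add: someI_ex)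
  have zle: "norm (z \<tau>) \<le> 2 * norm (r \<tau>)" for \<tau>
    using z[of \<tau>] by (cases "\<exists>z. good \<tau> z") (auto simp: good_def z_def)
  show ?thesis
  proof
    show "y0 + 0 *\<^sub>R w + P (z 0) = y0"
      using zle[of 0] r0 by (simp add: linear_0[OF P(1)])
    have "norm (P (z \<tau>)) \<le> (2 * K) * norm (r \<tau>)" for \<tau>
      using order_trans[OF K(2) mult_left_mono[OF zle[of \<tau>], of K]] K(1) by (simp add: mult_ac)
    then have "((\<lambda>\<tau>. P (z \<tau>)) has_vector_derivative 0) (at 0)"
      using zle[of 0] r0 by (intro has_vector_derivative_zero_dominated[OF r r0]) (auto simp: linear_0[OF P(1)])
    with \<open>((\<lambda>\<tau>. y0 + \<tau> *\<^sub>R w) has_vector_derivative w) (at 0)\<close>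
    show "((\<lambda>\<tau>. y0 + \<tau> *\<^sub>R w + P (z \<tau>)) has_vector_derivative w) (at 0)"
      using has_vector_derivative_add by fastforce
    show "\<forall>\<^sub>F \<tau> in nhds 0. T (y0 + \<tau> *\<^sub>R w + P (z \<tau>)) = u \<tau>"
      using ev by eventually_elim (use z in \<open>auto simp: good_def\<close>)
  qed
qed


section \<open>Velocities of curves\<close>

text \<open>Charts are pairs that should be kept atomic.\<close>

declare split_paired_All [simp del] split_paired_Ex [simp del]

lemma smooth_on_differentiable: "smooth_on V f \<Longrightarrow> y \<in> V \<Longrightarrow> f differentiable (at y)"
  unfolding smooth_on_def by (auto dest!: spec[of _ "Suc 0"])

lemma smooth_on_continuous_partials:
  "smooth_on V f \<Longrightarrow> continuous_on V (\<lambda>y. frechet_derivative f (at y) v)"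
  unfolding smooth_on_def by (auto dest!: spec[of _ "Suc 0"])

text \<open>The part of \<open>smooth_manifold\<close> that the calculus of velocities needs; it passes to products.\<close>

definition differentiable_atlas :: "('a, 'e::real_normed_vector) atlas \<Rightarrow> bool" where
  "differentiable_atlas N \<longleftrightarrow>
     (\<forall>\<kappa>\<in>N. inj_on (snd \<kappa>) (fst \<kappa>) \<and> open (snd \<kappa> ` fst \<kappa>)) \<and>
     (\<forall>\<kappa>\<in>N. \<forall>\<mu>\<in>N. open (snd \<kappa> ` (fst \<kappa> \<inter> fst \<mu>)) \<and>
        (\<forall>y\<in>snd \<kappa> ` (fst \<kappa> \<inter> fst \<mu>). transition \<kappa> \<mu> differentiable (at y)))"

lemma smooth_manifold_differentiable_atlas:
  assumes "smooth_manifold N"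
  shows "differentiable_atlas N"
proof -
  have charts: "\<forall>\<kappa>\<in>N. inj_on (snd \<kappa>) (fst \<kappa>) \<and> open (snd \<kappa> ` fst \<kappa>)"
    and trans: "\<forall>\<kappa>\<in>N. \<forall>\<mu>\<in>N. open (snd \<kappa> ` (fst \<kappa> \<inter> fst \<mu>)) \<and>
      smooth_on (snd \<kappa> ` (fst \<kappa> \<inter> fst \<mu>)) (transition \<kappa> \<mu>)"
    using assms unfolding smooth_manifold_def by (simp_all add: case_prod_unfold)
  show ?thesis
    unfolding differentiable_atlas_def
  proof (intro conjI ballI)
    fix \<kappa> \<mu> y assume "\<kappa> \<in> N" "\<mu> \<in> N" "y \<in> snd \<kappa> ` (fst \<kappa> \<inter> fst \<mu>)"
    then show "transition \<kappa> \<mu> differentiable (at y)"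
      using trans smooth_on_differentiable by metis
  qed (use charts trans in auto)
qed

lemma differentiable_atlasD:
  assumes "differentiable_atlas N" "\<kappa> \<in> N"
  shows "inj_on (snd \<kappa>) (fst \<kappa>)" "open (snd \<kappa> ` fst \<kappa>)"
    "\<mu> \<in> N \<Longrightarrow> open (snd \<kappa> ` (fst \<kappa> \<inter> fst \<mu>))"
    "\<mu> \<in> N \<Longrightarrow> x \<in> fst \<kappa> \<Longrightarrow> x \<in> fst \<mu> \<Longrightarrow> transition \<kappa> \<mu> differentiable (at (snd \<kappa> x))"
  using assms unfolding differentiable_atlas_def by blast+

lemma transition_apply:
  "inj_on (snd \<kappa>) (fst \<kappa>) \<Longrightarrow> x \<in> fst \<kappa> \<Longrightarrow> transition \<kappa> \<mu> (snd \<kappa> x) = snd \<mu> x"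
  by (simp add: transition_def)

lemma has_vector_derivative_cong_nhds:
  assumes "(f has_vector_derivative v) (at x)" "\<forall>\<^sub>F \<tau> in nhds x. f \<tau> = g \<tau>"
  shows "(g has_vector_derivative v) (at x)"
  using assms(1) unfolding has_vector_derivative_def
  by (rule has_derivative_transform_eventually)
     (use assms(2) in \<open>auto simp: eventually_at_filter elim: eventually_mono dest: eventually_nhds_x_imp_x\<close>)

lemma has_vector_derivative_eventually_in_open:
  assumes "(f has_vector_derivative v) (at x)" "open W" "f x \<in> W"
  shows "\<forall>\<^sub>F \<tau> in nhds x. f \<tau> \<in> W"
proof -
  have "isCont f x"
    using assms(1) by (rule has_vector_derivative_continuous)
  then have "(f \<longlongrightarrow> f x) (nhds x)"
    by (metis isCont_def tendsto_at_iff_tendsto_nhds)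
  then show ?thesis
    using assms(2,3) by (rule topological_tendstoD)
qed

lemma has_vector_derivative_compose_derivative:
  assumes "(f has_vector_derivative v) (at x)" "(g has_derivative D) (at (f x))"
  shows "((\<lambda>\<tau>. g (f \<tau>)) has_vector_derivative D v) (at x)"
  using vector_derivative_diff_chain_within[OF assms(1) has_derivative_at_withinI[OF assms(2)]]
  by (simp add: o_def)

lemma has_velocity_cong:
  assumes "has_velocity N c X" "\<forall>\<^sub>F \<tau> in nhds 0. c \<tau> = c' \<tau>"
  shows "has_velocity N c' X"
proof -
  have c0: "c 0 = c' 0"
    using assms(2) by (rule eventually_nhds_x_imp_x)
  have "\<forall>\<^sub>F \<tau> in nhds 0. c' \<tau> \<in> fst \<kappa>" if "\<forall>\<^sub>F \<tau> in nhds 0. c \<tau> \<in> fst \<kappa>" for \<kappa> :: "('a, 'b) chart"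
    using that assms(2) by eventually_elim simp
  moreover have "\<forall>\<^sub>F \<tau> in nhds 0. snd \<kappa> (c \<tau>) = snd \<kappa> (c' \<tau>)" for \<kappa> :: "('a, 'b) chart"
    using assms(2) by eventually_elim simp
  ultimately show ?thesis
    using assms(1) c0 unfolding has_velocity_def by (auto intro: has_vector_derivative_cong_nhds)
qed

lemma has_velocity_unique:
  assumes "has_velocity N c X" "has_velocity N c Y"
  shows "X = Y"
proof
  show "X \<kappa> = Y \<kappa>" for \<kappa>
  proof (cases "\<kappa> \<in> N \<and> c 0 \<in> fst \<kappa>")
    case True
    then show ?thesis
      using assms unfolding has_velocity_def by (blast intro: vector_derivative_unique_at)
  next
    case False
    then have "X \<kappa> = 0" "Y \<kappa> = 0"
      using assms unfolding has_velocity_def by blast+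
    then show ?thesis
      by simp
  qed
qed

lemma has_velocityD:
  assumes "has_velocity N c X" "\<kappa> \<in> N" "c 0 \<in> fst \<kappa>"
  shows "\<forall>\<^sub>F \<tau> in nhds 0. c \<tau> \<in> fst \<kappa>" "((\<lambda>\<tau>. snd \<kappa> (c \<tau>)) has_vector_derivative X \<kappa>) (at 0)"
  using assms unfolding has_velocity_def by auto

lemma has_velocity_in_points: "has_velocity N c X \<Longrightarrow> c 0 \<in> points N"
  by (simp add: has_velocity_def)

lemma points_chart: "x \<in> points N \<Longrightarrow> (\<And>\<kappa>. \<kappa> \<in> N \<Longrightarrow> x \<in> fst \<kappa> \<Longrightarrow> thesis) \<Longrightarrow> thesis"
  by (auto simp: points_def)

lemma in_points: "\<kappa> \<in> N \<Longrightarrow> x \<in> fst \<kappa> \<Longrightarrow> x \<in> points N"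
  by (auto simp: points_def)

lemma has_velocity_const: "x \<in> points N \<Longrightarrow> has_velocity N (\<lambda>\<tau>. x) (\<lambda>\<kappa>. 0)"
  by (simp add: has_velocity_def)

section \<open>Coordinate vectors and the linear structure of tangent spaces\<close>

text \<open>Differentiability in one chart suffices: overlaps have open images, so near time 0 the
  curve stays in every other chart around its base point, and the chain rule for the transition map
  gives the component there.\<close>

lemma has_velocity_coord_vec:
  assumes N: "differentiable_atlas N" and \<kappa>: "\<kappa> \<in> N"
    and c: "\<forall>\<^sub>F \<tau> in nhds 0. c \<tau> \<in> fst \<kappa>" "((\<lambda>\<tau>. snd \<kappa> (c \<tau>)) has_vector_derivative v) (at 0)"
  shows "has_velocity N c (coord_vec N \<kappa> (c 0) v)"
proof -
  have c0: "c 0 \<in> fst \<kappa>"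
    using c(1) by (rule eventually_nhds_x_imp_x)
  have "(\<forall>\<^sub>F \<tau> in nhds 0. c \<tau> \<in> fst \<mu>) \<and>
      ((\<lambda>\<tau>. snd \<mu> (c \<tau>)) has_vector_derivative coord_vec N \<kappa> (c 0) v \<mu>) (at 0)"
    if \<mu>: "\<mu> \<in> N" "c 0 \<in> fst \<mu>" for \<mu>
  proof
    have "\<forall>\<^sub>F \<tau> in nhds 0. snd \<kappa> (c \<tau>) \<in> snd \<kappa> ` (fst \<kappa> \<inter> fst \<mu>)"
      using c0 \<mu> by (intro has_vector_derivative_eventually_in_open[OF c(2)]
          differentiable_atlasD(3)[OF N \<kappa>]) auto
    with c(1) show "\<forall>\<^sub>F \<tau> in nhds 0. c \<tau> \<in> fst \<mu>"
      by eventually_elim (use differentiable_atlasD(1)[OF N \<kappa>] in \<open>auto dest: inj_onD\<close>)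
    have "(transition \<kappa> \<mu> has_derivative frechet_derivative (transition \<kappa> \<mu>) (at (snd \<kappa> (c 0))))
        (at (snd \<kappa> (c 0)))"
      using differentiable_atlasD(4)[OF N \<kappa> \<mu>(1) c0 \<mu>(2)] by (simp add: frechet_derivative_works)
    from has_vector_derivative_compose_derivative[OF c(2) this]
    have "((\<lambda>\<tau>. transition \<kappa> \<mu> (snd \<kappa> (c \<tau>))) has_vector_derivative coord_vec N \<kappa> (c 0) v \<mu>) (at 0)"
      using \<mu> by (simp add: coord_vec_def)
    moreover have "\<forall>\<^sub>F \<tau> in nhds 0. transition \<kappa> \<mu> (snd \<kappa> (c \<tau>)) = snd \<mu> (c \<tau>)"
      using c(1) by eventually_elim (rule transition_apply[OF differentiable_atlasD(1)[OF N \<kappa>]])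
    ultimately show "((\<lambda>\<tau>. snd \<mu> (c \<tau>)) has_vector_derivative coord_vec N \<kappa> (c 0) v \<mu>) (at 0)"
      by (rule has_vector_derivative_cong_nhds)
  qed
  moreover have "coord_vec N \<kappa> (c 0) v \<mu> = 0" if "\<not> (\<mu> \<in> N \<and> c 0 \<in> fst \<mu>)" for \<mu>
    using that by (auto simp: coord_vec_def)
  ultimately show ?thesis
    using in_points[OF \<kappa> c0] unfolding has_velocity_def by blast
qed

lemma coord_vec_curve:
  assumes N: "differentiable_atlas N" and \<kappa>: "\<kappa> \<in> N" "x \<in> fst \<kappa>"
  obtains c where "c 0 = x" "has_velocity N c (coord_vec N \<kappa> x v)"
    "((\<lambda>\<tau>. snd \<kappa> (c \<tau>)) has_vector_derivative v) (at 0)"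
proof -
  define l where "l \<tau> = snd \<kappa> x + \<tau> *\<^sub>R v" for \<tau> :: real
  define c where "c \<tau> = inv_into (fst \<kappa>) (snd \<kappa>) (l \<tau>)" for \<tau>
  have c0: "c 0 = x"
    using differentiable_atlasD(1)[OF N \<kappa>(1)] \<kappa>(2) by (simp add: c_def l_def)
  have "(l has_derivative (\<lambda>\<tau>. \<tau> *\<^sub>R v)) (at 0)"
    unfolding l_def[abs_def] by (auto intro!: derivative_eq_intros)
  then have l: "(l has_vector_derivative v) (at 0)"
    by (simp add: has_vector_derivative_def)
  have "\<forall>\<^sub>F \<tau> in nhds 0. l \<tau> \<in> snd \<kappa> ` fst \<kappa>"
    using \<kappa>(2) by (intro has_vector_derivative_eventually_in_open[OF l] differentiable_atlasD(2)[OF N \<kappa>(1)])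
       (simp add: l_def)
  then have ev: "\<forall>\<^sub>F \<tau> in nhds 0. c \<tau> \<in> fst \<kappa> \<and> l \<tau> = snd \<kappa> (c \<tau>)"
    by eventually_elim (auto simp: c_def inv_into_into f_inv_into_f)
  have d: "((\<lambda>\<tau>. snd \<kappa> (c \<tau>)) has_vector_derivative v) (at 0)"
    using l by (rule has_vector_derivative_cong_nhds) (use ev in eventually_elim, simp)
  have "has_velocity N c (coord_vec N \<kappa> (c 0) v)"
    by (rule has_velocity_coord_vec[OF N \<kappa>(1) _ d]) (use ev in eventually_elim, simp)
  with that[OF c0 _ d] c0 show ?thesis
    by simp
qed

text \<open>The component is read off from a curve, by uniqueness of its derivative in
  \<open>\<kappa>\<close>, rather than by differentiating the transition from
  \<open>\<kappa>\<close> to itself.\<close>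

lemma coord_vec_self:
  assumes N: "differentiable_atlas N" and \<kappa>: "\<kappa> \<in> N" "x \<in> fst \<kappa>"
  shows "coord_vec N \<kappa> x v \<kappa> = v"
proof -
  obtain c where c: "c 0 = x" "has_velocity N c (coord_vec N \<kappa> x v)"
    "((\<lambda>\<tau>. snd \<kappa> (c \<tau>)) has_vector_derivative v) (at 0)"
    by (rule coord_vec_curve[OF assms])
  show ?thesis
    using has_velocityD(2)[OF c(2) \<kappa>(1)] c(1,3) \<kappa>(2) by (metis vector_derivative_unique_at)
qed

lemma has_velocity_eq_coord_vec:
  assumes "differentiable_atlas N" "has_velocity N c X" "\<kappa> \<in> N" "c 0 \<in> fst \<kappa>"
  shows "X = coord_vec N \<kappa> (c 0) (X \<kappa>)"
  using has_velocity_unique[OF assms(2) has_velocity_coord_vec[OF assms(1,3) has_velocityD[OF assms(2-4)]]] .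

lemma has_velocity_tangent:
  assumes N: "differentiable_atlas N" and c: "has_velocity N c X"
  shows "X \<in> tangent_space N (c 0)"
proof -
  have "X \<mu> = frechet_derivative (transition \<kappa> \<mu>) (at (snd \<kappa> (c 0))) (X \<kappa>)"
    if "\<kappa> \<in> N" "\<mu> \<in> N" "c 0 \<in> fst \<kappa>" "c 0 \<in> fst \<mu>" for \<kappa> \<mu>
    using fun_cong[OF has_velocity_eq_coord_vec[OF N c that(1,3)], of \<mu>] that by (simp add: coord_vec_def)
  then show ?thesis
    using c unfolding tangent_space_def has_velocity_def by blast
qed

text \<open>One component determines a tangent vector, so that vector space operations can be
  checked in a single chart.\<close>

lemma tangent_eq_coord_vec:
  assumes "X \<in> tangent_space N x" "\<kappa> \<in> N" "x \<in> fst \<kappa>"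
  shows "X = coord_vec N \<kappa> x (X \<kappa>)"
proof
  fix \<mu>
  show "X \<mu> = coord_vec N \<kappa> x (X \<kappa>) \<mu>"
  proof (cases "\<mu> \<in> N \<and> x \<in> fst \<mu>")
    case True
    then have "X \<mu> = frechet_derivative (transition \<kappa> \<mu>) (at (snd \<kappa> x)) (X \<kappa>)"
      using assms unfolding tangent_space_def by blast
    then show ?thesis
      using True by (simp add: coord_vec_def)
  next
    case False
    then have "X \<mu> = 0"
      using assms(1) unfolding tangent_space_def by blast
    then show ?thesis
      using False by (auto simp: coord_vec_def)
  qed
qed

lemma tangent_curve:
  assumes "differentiable_atlas N" "x \<in> points N" "X \<in> tangent_space N x"
  obtains c where "c 0 = x" "has_velocity N c X"
proof -
  obtain \<kappa> where \<kappa>: "\<kappa> \<in> N" "x \<in> fst \<kappa>"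
    using assms(2) by (rule points_chart)
  show ?thesis
    using coord_vec_curve[OF assms(1) \<kappa>, of "X \<kappa>"] tangent_eq_coord_vec[OF assms(3) \<kappa>] that by metis
qed

lemma coord_vec_tangent:
  assumes "differentiable_atlas N" "\<kappa> \<in> N" "x \<in> fst \<kappa>"
  shows "coord_vec N \<kappa> x v \<in> tangent_space N x"
proof -
  obtain c where "c 0 = x" "has_velocity N c (coord_vec N \<kappa> x v)"
    by (rule coord_vec_curve[OF assms])
  then show ?thesis
    using has_velocity_tangent[OF assms(1)] by metis
qed

lemma coord_vec_add:
  assumes "differentiable_atlas N" "\<kappa> \<in> N" "x \<in> fst \<kappa>"
  shows "coord_vec N \<kappa> x (v + w) = (\<lambda>\<mu>. coord_vec N \<kappa> x v \<mu> + coord_vec N \<kappa> x w \<mu>)"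
proof -
  have "linear (frechet_derivative (transition \<kappa> \<mu>) (at (snd \<kappa> x)))" if "\<mu> \<in> N" "x \<in> fst \<mu>" for \<mu>
    using that by (intro linear_frechet_derivative differentiable_atlasD(4)[OF assms(1,2) _ assms(3)])
  then show ?thesis
    by (simp add: coord_vec_def fun_eq_iff linear_add)
qed

lemma coord_vec_scale:
  assumes "differentiable_atlas N" "\<kappa> \<in> N" "x \<in> fst \<kappa>"
  shows "coord_vec N \<kappa> x (a *\<^sub>R v) = (\<lambda>\<mu>. a *\<^sub>R coord_vec N \<kappa> x v \<mu>)"
proof -
  have "linear (frechet_derivative (transition \<kappa> \<mu>) (at (snd \<kappa> x)))" if "\<mu> \<in> N" "x \<in> fst \<mu>" for \<mu>
    using that by (intro linear_frechet_derivative differentiable_atlasD(4)[OF assms(1,2) _ assms(3)])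
  then show ?thesis
    by (simp add: coord_vec_def fun_eq_iff linear_scale)
qed

lemma tangent_add:
  assumes "differentiable_atlas N" "x \<in> points N" "X \<in> tangent_space N x" "Y \<in> tangent_space N x"
  shows "(\<lambda>\<kappa>. X \<kappa> + Y \<kappa>) \<in> tangent_space N x"
proof -
  obtain \<kappa> where \<kappa>: "\<kappa> \<in> N" "x \<in> fst \<kappa>"
    using assms(2) by (rule points_chart)
  have "(\<lambda>\<mu>. X \<mu> + Y \<mu>) = coord_vec N \<kappa> x (X \<kappa> + Y \<kappa>)"
    by (simp only: coord_vec_add[OF assms(1) \<kappa>] tangent_eq_coord_vec[OF assms(3) \<kappa>, symmetric]
        tangent_eq_coord_vec[OF assms(4) \<kappa>, symmetric])
  then show ?thesis
    using coord_vec_tangent[OF assms(1) \<kappa>] by simp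
qed

lemma tangent_scale:
  assumes "differentiable_atlas N" "x \<in> points N" "X \<in> tangent_space N x"
  shows "(\<lambda>\<kappa>. a *\<^sub>R X \<kappa>) \<in> tangent_space N x"
proof -
  obtain \<kappa> where \<kappa>: "\<kappa> \<in> N" "x \<in> fst \<kappa>"
    using assms(2) by (rule points_chart)
  have "(\<lambda>\<mu>. a *\<^sub>R X \<mu>) = coord_vec N \<kappa> x (a *\<^sub>R X \<kappa>)"
    by (simp only: coord_vec_scale[OF assms(1) \<kappa>] tangent_eq_coord_vec[OF assms(3) \<kappa>, symmetric])
  then show ?thesis
    using coord_vec_tangent[OF assms(1) \<kappa>] by simp
qed

lemma tangent_zero:
  assumes "differentiable_atlas N" "x \<in> points N"
  shows "(\<lambda>\<kappa>. 0) \<in> tangent_space N x"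
  using has_velocity_tangent[OF assms(1) has_velocity_const[OF assms(2)]] .

section \<open>Curves and open sets\<close>

lemma openin_manifold_topology_chart:
  "(U, \<phi>) \<in> N \<Longrightarrow> W \<subseteq> U \<Longrightarrow> open (\<phi> ` W) \<Longrightarrow> openin (manifold_topology N) W"
  unfolding manifold_topology_def by (rule topology_generated_by_Basis) auto

text \<open>The topology is given by generators, so the proof follows the generation of the open
  set; for a generator inside a chart the claim is continuity of the coordinate curve together with
  injectivity of the chart.\<close>

lemma has_velocity_eventually_in_open:
  assumes N: "differentiable_atlas N" and c: "has_velocity N c X"
    and W: "openin (manifold_topology N) W" "c 0 \<in> W"
  shows "\<forall>\<^sub>F \<tau> in nhds 0. c \<tau> \<in> W"
proof -
  have "generate_topology_on {W. \<exists>(U, \<phi>)\<in>N. W \<subseteq> U \<and> open (\<phi> ` W)} W"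
    using W(1) unfolding manifold_topology_def openin_topology_generated_by_iff .
  then show ?thesis
    using W(2)
  proof (induction rule: generate_topology_on.induct)
    case (Int a b)
    then have "\<forall>\<^sub>F \<tau> in nhds 0. c \<tau> \<in> a" "\<forall>\<^sub>F \<tau> in nhds 0. c \<tau> \<in> b"
      by auto
    then show ?case
      by eventually_elim simp
  next
    case (UN K)
    then obtain k where "k \<in> K" "\<forall>\<^sub>F \<tau> in nhds 0. c \<tau> \<in> k"
      by auto
    then show ?case
      by (auto elim: eventually_mono)
  next
    case (Basis W)
    then obtain U \<phi> where \<phi>: "(U, \<phi>) \<in> N" "W \<subseteq> U" "open (\<phi> ` W)"
      by auto
    then have c': "\<forall>\<^sub>F \<tau> in nhds 0. c \<tau> \<in> U" "((\<lambda>\<tau>. \<phi> (c \<tau>)) has_vector_derivative X (U, \<phi>)) (at 0)"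
      using has_velocityD[OF c \<phi>(1)] Basis(2) by auto
    have "\<forall>\<^sub>F \<tau> in nhds 0. \<phi> (c \<tau>) \<in> \<phi> ` W"
      using \<phi>(3) Basis(2) by (intro has_vector_derivative_eventually_in_open[OF c'(2)]) auto
    with c'(1) show ?case
      by eventually_elim (use differentiable_atlasD(1)[OF N \<phi>(1)] \<phi>(2) in \<open>auto dest: inj_onD\<close>)
  qed auto
qed


section \<open>Differentials of smooth maps\<close>

text \<open>The description ranges over all curves in \<open>S\<close> with velocity
  \<open>X\<close>. One such curve gives existence; uniqueness requires that all of them have the
  same image velocity, which is the last premise.\<close>

lemma differential_eqI:
  assumes "c 0 = x" "\<forall>\<^sub>F \<tau> in nhds 0. c \<tau> \<in> S" "has_velocity N c X"
    and "\<And>c. c 0 = x \<Longrightarrow> \<forall>\<^sub>F \<tau> in nhds 0. c \<tau> \<in> S \<Longrightarrow> has_velocity N c X \<Longrightarrow> has_velocity P (f \<circ> c) V"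
  shows "differential N P S f x X = V"
  unfolding differential_def
  by (rule the_equality) (use assms has_velocity_unique in blast)+

text \<open>\<open>T\<close> is the coordinate expression of a local extension of \<open>f\<close>.
  It is smooth on an open set but represents \<open>f\<close> only at points of \<open>S\<close>,
  and only where the extension agrees with \<open>f\<close>, which is ensured in
  \<open>W'\<close>.\<close>

lemma smooth_map_local_representation:
  assumes N: "differentiable_atlas N" and f: "smooth_map_on N P S f" "x \<in> S"
  obtains \<kappa> \<mu> W W' T where "\<kappa> \<in> N" "\<mu> \<in> P" "f x \<in> fst \<mu>" "W \<subseteq> fst \<kappa>" "x \<in> W" "open (snd \<kappa> ` W)"
    "smooth_on (snd \<kappa> ` W) T" "openin (manifold_topology N) W'" "x \<in> W'"
    "\<And>y. y \<in> W \<Longrightarrow> y \<in> W' \<Longrightarrow> y \<in> S \<Longrightarrow> f y \<in> fst \<mu> \<and> snd \<mu> (f y) = T (snd \<kappa> y)"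
proof -
  obtain g W' where g: "smooth_at N P g x" "openin (manifold_topology N) W'" "x \<in> W'"
      "\<And>y. y \<in> W' \<Longrightarrow> y \<in> S \<Longrightarrow> g y = f y"
    using f unfolding smooth_map_on_def by (metis IntI)
  obtain U \<phi> V \<psi> W where W: "(U, \<phi>) \<in> N" "(V, \<psi>) \<in> P" "g x \<in> V" "W \<subseteq> U" "x \<in> W" "open (\<phi> ` W)"
      "g ` W \<subseteq> V" "smooth_on (\<phi> ` W) (\<psi> \<circ> g \<circ> inv_into U \<phi>)"
    using g(1) unfolding smooth_at_def by blast
  have "inj_on \<phi> U"
    using differentiable_atlasD(1)[OF N W(1)] by simp
  then have "(\<psi> \<circ> g \<circ> inv_into U \<phi>) (\<phi> y) = \<psi> (g y)" if "y \<in> W" for y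
    using that W(4) by (simp add: subset_iff)
  moreover have "f y \<in> V" if "y \<in> W" "y \<in> W'" "y \<in> S" for y
    using that g(4)[OF that(2,3)] W(7) by auto
  ultimately show ?thesis
    using that[OF W(1,2), of W "\<psi> \<circ> g \<circ> inv_into U \<phi>" W'] W g f(2) by simp
qed

text \<open>\<open>L\<close> is the derivative of a local extension, written in charts. It is
  therefore linear without any reference to \<open>S\<close>, while on curves inside
  \<open>S\<close> it computes the velocity of the image. This makes differentials on subsets well
  defined and linear at once.\<close>

lemma smooth_map_tangent_map:
  assumes N: "differentiable_atlas N" and P: "differentiable_atlas P"
    and f: "smooth_map_on N P S f" "x \<in> S"
  obtains L where "\<And>X Y. L (\<lambda>\<kappa>. X \<kappa> + Y \<kappa>) = (\<lambda>\<kappa>. L X \<kappa> + L Y \<kappa>)"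
    "\<And>a X. L (\<lambda>\<kappa>. a *\<^sub>R X \<kappa>) = (\<lambda>\<kappa>. a *\<^sub>R L X \<kappa>)"
    "\<And>c X. c 0 = x \<Longrightarrow> \<forall>\<^sub>F \<tau> in nhds 0. c \<tau> \<in> S \<Longrightarrow> has_velocity N c X \<Longrightarrow> has_velocity P (f \<circ> c) (L X)"
proof -
  obtain \<kappa> \<mu> W W' T where \<kappa>: "\<kappa> \<in> N" "\<mu> \<in> P" "f x \<in> fst \<mu>" "W \<subseteq> fst \<kappa>" "x \<in> W" "open (snd \<kappa> ` W)"
    "smooth_on (snd \<kappa> ` W) T" "openin (manifold_topology N) W'" "x \<in> W'"
    and T: "\<And>y. y \<in> W \<Longrightarrow> y \<in> W' \<Longrightarrow> y \<in> S \<Longrightarrow> f y \<in> fst \<mu> \<and> snd \<mu> (f y) = T (snd \<kappa> y)"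
    by (rule smooth_map_local_representation[OF N f]) blast
  define D where "D = frechet_derivative T (at (snd \<kappa> x))"
  have D: "(T has_derivative D) (at (snd \<kappa> x))"
    using smooth_on_differentiable[OF \<kappa>(7)] \<kappa>(5) by (simp add: D_def frechet_derivative_works[symmetric])
  define L where "L X = coord_vec P \<mu> (f x) (D (X \<kappa>))" for X
  show ?thesis
  proof
    show "L (\<lambda>\<kappa>. X \<kappa> + Y \<kappa>) = (\<lambda>\<kappa>. L X \<kappa> + L Y \<kappa>)" for X Y
      by (simp add: L_def linear_add[OF has_derivative_linear[OF D]] coord_vec_add[OF P \<kappa>(2,3)])
    show "L (\<lambda>\<kappa>. a *\<^sub>R X \<kappa>) = (\<lambda>\<kappa>. a *\<^sub>R L X \<kappa>)" for a X
      by (simp add: L_def linear_scale[OF has_derivative_linear[OF D]] coord_vec_scale[OF P \<kappa>(2,3)])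
    fix c X assume c: "c 0 = x" "\<forall>\<^sub>F \<tau> in nhds 0. c \<tau> \<in> S" "has_velocity N c X"
    have "openin (manifold_topology N) W"
      using openin_manifold_topology_chart[of "fst \<kappa>" "snd \<kappa>"] \<kappa>(1,4,6) by simp
    then have "\<forall>\<^sub>F \<tau> in nhds 0. c \<tau> \<in> W"
      using c(1) \<kappa>(5) by (intro has_velocity_eventually_in_open[OF N c(3)]) auto
    moreover have "\<forall>\<^sub>F \<tau> in nhds 0. c \<tau> \<in> W'"
      using c(1) \<kappa>(8,9) by (intro has_velocity_eventually_in_open[OF N c(3)]) auto
    ultimately have ev: "\<forall>\<^sub>F \<tau> in nhds 0. f (c \<tau>) \<in> fst \<mu> \<and> snd \<mu> (f (c \<tau>)) = T (snd \<kappa> (c \<tau>))"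
      using c(2) by eventually_elim (rule T)
    have c0: "c 0 \<in> fst \<kappa>"
      using c(1) \<kappa>(4,5) by auto
    have "((\<lambda>\<tau>. T (snd \<kappa> (c \<tau>))) has_vector_derivative D (X \<kappa>)) (at 0)"
      by (rule has_vector_derivative_compose_derivative[OF has_velocityD(2)[OF c(3) \<kappa>(1) c0] D[folded c(1)]])
    then have "((\<lambda>\<tau>. snd \<mu> ((f \<circ> c) \<tau>)) has_vector_derivative D (X \<kappa>)) (at 0)"
      by (rule has_vector_derivative_cong_nhds) (use ev in eventually_elim, simp)
    moreover have "\<forall>\<^sub>F \<tau> in nhds 0. (f \<circ> c) \<tau> \<in> fst \<mu>"
      using ev by eventually_elim simp
    ultimately show "has_velocity P (f \<circ> c) (L X)"
      using has_velocity_coord_vec[OF P \<kappa>(2), of "f \<circ> c"] c(1) by (simp add: L_def)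
  qed
qed

lemma smooth_map_has_velocity:
  assumes "differentiable_atlas N" "differentiable_atlas P" "smooth_map_on N P S f"
    and c: "\<forall>\<^sub>F \<tau> in nhds 0. c \<tau> \<in> S" "has_velocity N c X"
  shows "has_velocity P (f \<circ> c) (differential N P S f (c 0) X)"
proof -
  obtain L where L: "\<And>c' X. c' 0 = c 0 \<Longrightarrow> \<forall>\<^sub>F \<tau> in nhds 0. c' \<tau> \<in> S \<Longrightarrow> has_velocity N c' X \<Longrightarrow>
      has_velocity P (f \<circ> c') (L X)"
    using smooth_map_tangent_map[OF assms(1-3) eventually_nhds_x_imp_x[OF c(1)]] by metis
  have "differential N P S f (c 0) X = L X"
    by (rule differential_eqI[of c]) (use c L in auto)
  then show ?thesis
    using L[OF refl c] by simp
qed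

lemma differential_linear:
  assumes N: "differentiable_atlas N" "differentiable_atlas P" "smooth_map_on N P S f" "x \<in> S"
  obtains L where "\<And>X Y. L (\<lambda>\<kappa>. X \<kappa> + Y \<kappa>) = (\<lambda>\<kappa>. L X \<kappa> + L Y \<kappa>)"
    "\<And>a X. L (\<lambda>\<kappa>. a *\<^sub>R X \<kappa>) = (\<lambda>\<kappa>. a *\<^sub>R L X \<kappa>)"
    "\<And>X. X \<in> tangent_of_subset N S x \<Longrightarrow> differential N P S f x X = L X"
proof (rule smooth_map_tangent_map[OF N])
  fix L assume L: "\<And>X Y. L (\<lambda>\<kappa>. X \<kappa> + Y \<kappa>) = (\<lambda>\<kappa>. L X \<kappa> + L Y \<kappa>)"
    "\<And>a X. L (\<lambda>\<kappa>. a *\<^sub>R X \<kappa>) = (\<lambda>\<kappa>. a *\<^sub>R L X \<kappa>)"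
    "\<And>c X. c 0 = x \<Longrightarrow> \<forall>\<^sub>F \<tau> in nhds 0. c \<tau> \<in> S \<Longrightarrow> has_velocity N c X \<Longrightarrow> has_velocity P (f \<circ> c) (L X)"
  show ?thesis
  proof (rule that[OF L(1,2)])
    fix X assume "X \<in> tangent_of_subset N S x"
    then show "differential N P S f x X = L X"
      using L(3) unfolding tangent_of_subset_def by (blast intro: differential_eqI)
  qed
qed

text \<open>Velocities of curves in an arbitrary subset \<open>S\<close> need not be closed under
  addition, hence the separate premise on the sum.\<close>

lemma differential_add:
  assumes "differentiable_atlas N" "differentiable_atlas P" "smooth_map_on N P S f" "x \<in> S"
    and X: "X \<in> tangent_of_subset N S x" "Y \<in> tangent_of_subset N S x"
      "(\<lambda>\<kappa>. X \<kappa> + Y \<kappa>) \<in> tangent_of_subset N S x"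
  shows "differential N P S f x (\<lambda>\<kappa>. X \<kappa> + Y \<kappa>) =
    (\<lambda>\<kappa>. differential N P S f x X \<kappa> + differential N P S f x Y \<kappa>)"
  by (rule differential_linear[OF assms(1-4)]) (simp add: X)

lemma differential_scale:
  assumes "differentiable_atlas N" "differentiable_atlas P" "smooth_map_on N P S f" "x \<in> S"
    and X: "X \<in> tangent_of_subset N S x" "(\<lambda>\<kappa>. a *\<^sub>R X \<kappa>) \<in> tangent_of_subset N S x"
  shows "differential N P S f x (\<lambda>\<kappa>. a *\<^sub>R X \<kappa>) = (\<lambda>\<kappa>. a *\<^sub>R differential N P S f x X \<kappa>)"
  by (rule differential_linear[OF assms(1-4)]) (simp add: X)

lemma has_velocity_eventually_points:
  assumes "has_velocity N c X"
  shows "\<forall>\<^sub>F \<tau> in nhds 0. c \<tau> \<in> points N"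
proof -
  obtain \<kappa> where \<kappa>: "\<kappa> \<in> N" "c 0 \<in> fst \<kappa>"
    using has_velocity_in_points[OF assms] by (rule points_chart)
  show ?thesis
    using has_velocityD(1)[OF assms \<kappa>] by eventually_elim (rule in_points[OF \<kappa>(1)])
qed

lemma tangent_of_points:
  assumes "differentiable_atlas N" "x \<in> points N"
  shows "tangent_of_subset N (points N) x = tangent_space N x"
proof (intro set_eqI iffI)
  fix X
  show "X \<in> tangent_space N x" if "X \<in> tangent_of_subset N (points N) x"
    using that has_velocity_tangent[OF assms(1)] by (auto simp: tangent_of_subset_def)
  show "X \<in> tangent_of_subset N (points N) x" if X: "X \<in> tangent_space N x"
  proof -
    obtain c where "c 0 = x" "has_velocity N c X"
      by (rule tangent_curve[OF assms X])
    then show ?thesis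
      using has_velocity_eventually_points[of N c X] by (auto simp: tangent_of_subset_def)
  qed
qed

lemma diff_has_velocity:
  assumes "differentiable_atlas N" "differentiable_atlas P" "smooth_map_on N P (points N) f"
    and c: "has_velocity N c X"
  shows "has_velocity P (\<lambda>\<tau>. f (c \<tau>)) (diff N P f (c 0) X)"
  using smooth_map_has_velocity[OF assms(1-3) has_velocity_eventually_points[OF c] c] by (simp add: o_def)

section \<open>Lifting curves along submersions\<close>

text \<open>The coordinate lifting result transported to manifolds. The velocity \<open>Y\<close> of
  the lift is prescribed, not just its image; this is what later realises composable tangent vectors
  by composable curves.\<close>

lemma submersion_lift_curve:
  fixes N :: "('a, 'e::real_inner) atlas" and P :: "('b, 'f::real_inner) atlas"
  assumes N: "smooth_manifold N" and P: "smooth_manifold P" and f: "submersion N P f"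
    and x: "x \<in> points N" and Y: "Y \<in> tangent_space N x"
    and u: "u 0 = f x" "has_velocity P u (diff N P f x Y)"
  obtains b where "b 0 = x" "has_velocity N b Y" "\<forall>\<^sub>F \<tau> in nhds 0. f (b \<tau>) = u \<tau>"
proof -
  note dN = smooth_manifold_differentiable_atlas[OF N]
    and dP = smooth_manifold_differentiable_atlas[OF P]
  have sf: "smooth_map_on N P (points N) f"
    using f by (simp add: submersion_def)
  obtain \<kappa> \<mu> W W' T where \<kappa>: "\<kappa> \<in> N" "\<mu> \<in> P" "f x \<in> fst \<mu>" "W \<subseteq> fst \<kappa>" "x \<in> W" "open (snd \<kappa> ` W)"
    "smooth_on (snd \<kappa> ` W) T" "openin (manifold_topology N) W'" "x \<in> W'"
    and T: "\<And>y. y \<in> W \<Longrightarrow> y \<in> W' \<Longrightarrow> y \<in> points N \<Longrightarrow> f y \<in> fst \<mu> \<and> snd \<mu> (f y) = T (snd \<kappa> y)"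
    by (rule smooth_map_local_representation[OF dN sf x]) blast
  have WN: "y \<in> points N" if "y \<in> W" for y
    using that \<kappa>(1,4) by (blast intro: in_points)
  define D where "D = frechet_derivative T (at (snd \<kappa> x))"
  have TD: "(T has_derivative D) (at (snd \<kappa> x))"
    using smooth_on_differentiable[OF \<kappa>(7)] \<kappa>(5) by (simp add: D_def frechet_derivative_works[symmetric])
  have W_open: "openin (manifold_topology N) W"
    using openin_manifold_topology_chart[of "fst \<kappa>" "snd \<kappa>"] \<kappa>(1,4,6) by simp
  \<comment> \<open>In the charts \<open>\<kappa>\<close> and \<open>\<mu>\<close> the differential
    of \<open>f\<close> is \<open>D\<close>, so that surjectivity passes from the submersion to
    \<open>D\<close>.\<close>
  have D: "diff N P f x X \<mu> = D (X \<kappa>)" if X: "X \<in> tangent_space N x" for X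
  proof -
    obtain c where c: "c 0 = x" "has_velocity N c X"
      by (rule tangent_curve[OF dN x X])
    have "\<forall>\<^sub>F \<tau> in nhds 0. c \<tau> \<in> W"
      using c(1) \<kappa>(5) W_open by (intro has_velocity_eventually_in_open[OF dN c(2)]) auto
    moreover have "\<forall>\<^sub>F \<tau> in nhds 0. c \<tau> \<in> W'"
      using c(1) \<kappa>(8,9) by (intro has_velocity_eventually_in_open[OF dN c(2)]) auto
    ultimately have ev: "\<forall>\<^sub>F \<tau> in nhds 0. T (snd \<kappa> (c \<tau>)) = snd \<mu> (f (c \<tau>))"
      by eventually_elim (use T WN in auto)
    have c0: "c 0 \<in> fst \<kappa>"
      using c(1) \<kappa>(4,5) by auto
    have "((\<lambda>\<tau>. T (snd \<kappa> (c \<tau>))) has_vector_derivative D (X \<kappa>)) (at 0)"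
      by (rule has_vector_derivative_compose_derivative[OF has_velocityD(2)[OF c(2) \<kappa>(1) c0] TD[folded c(1)]])
    then have "((\<lambda>\<tau>. snd \<mu> (f (c \<tau>))) has_vector_derivative D (X \<kappa>)) (at 0)"
      using ev by (rule has_vector_derivative_cong_nhds)
    then show ?thesis
      using has_velocityD(2)[OF diff_has_velocity[OF dN dP sf c(2)] \<kappa>(2)] c(1) \<kappa>(3)
      by (metis vector_derivative_unique_at)
  qed
  have "surj D"
    unfolding surj_def
  proof
    fix v
    have "coord_vec P \<mu> (f x) v \<in> diff N P f x ` tangent_space N x"
      using f x coord_vec_tangent[OF dP \<kappa>(2,3)] by (simp add: submersion_def)
    then obtain X where "X \<in> tangent_space N x" "coord_vec P \<mu> (f x) v = diff N P f x X"
      by auto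
    then show "\<exists>y. v = D y"
      using D coord_vec_self[OF dP \<kappa>(2,3)] by metis
  qed
  moreover have "((\<lambda>\<tau>. snd \<mu> (u \<tau>)) has_vector_derivative D (Y \<kappa>)) (at 0)"
    using has_velocityD(2)[OF u(2) \<kappa>(2)] u(1) \<kappa>(3) D[OF Y] by simp
  moreover have "snd \<mu> (u 0) = T (snd \<kappa> x)"
    using T[OF \<kappa>(5,9) x] u(1) by simp
  moreover have "\<exists>B::'e set. finite B \<and> span B = UNIV" "\<exists>B::'f set. finite B \<and> span B = UNIV"
    using N P by (auto simp: smooth_manifold_def)
  ultimately obtain y where y: "y 0 = snd \<kappa> x" "(y has_vector_derivative Y \<kappa>) (at 0)"
      "\<forall>\<^sub>F \<tau> in nhds 0. T (y \<tau>) = snd \<mu> (u \<tau>)"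
    using lift_curve_along_surjective_derivative[OF _ _ \<kappa>(6) _ smooth_on_differentiable[OF \<kappa>(7)]
        smooth_on_continuous_partials[OF \<kappa>(7)], of "snd \<kappa> x" "\<lambda>\<tau>. snd \<mu> (u \<tau>)" "Y \<kappa>"] \<kappa>(5)
    unfolding D_def by blast
  define b where "b \<tau> = inv_into (fst \<kappa>) (snd \<kappa>) (y \<tau>)" for \<tau>
  have inj: "inj_on (snd \<kappa>) (fst \<kappa>)" "inj_on (snd \<mu>) (fst \<mu>)"
    using differentiable_atlasD(1) dN dP \<kappa>(1,2) by blast+
  have b0: "b 0 = x"
    using inj \<kappa>(4,5) y(1) by (auto simp: b_def)
  have "\<forall>\<^sub>F \<tau> in nhds 0. y \<tau> \<in> snd \<kappa> ` W"
    using y(1) \<kappa>(5,6) by (intro has_vector_derivative_eventually_in_open[OF y(2)]) auto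
  then have ev: "\<forall>\<^sub>F \<tau> in nhds 0. b \<tau> \<in> W \<and> y \<tau> = snd \<kappa> (b \<tau>)"
    by eventually_elim (use inj \<kappa>(4) in \<open>auto simp: b_def subset_iff\<close>)
  have "((\<lambda>\<tau>. snd \<kappa> (b \<tau>)) has_vector_derivative Y \<kappa>) (at 0)"
    using y(2) by (rule has_vector_derivative_cong_nhds) (use ev in eventually_elim, simp)
  moreover have "\<forall>\<^sub>F \<tau> in nhds 0. b \<tau> \<in> fst \<kappa>"
    using ev by eventually_elim (use \<kappa>(4) in auto)
  ultimately have b: "has_velocity N b Y"
    using has_velocity_coord_vec[OF dN \<kappa>(1), of b "Y \<kappa>"] tangent_eq_coord_vec[OF Y \<kappa>(1)] b0 \<kappa>(4,5)
    by (metis subsetD)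
  \<comment> \<open>\<open>T\<close> represents \<open>f\<close> only on the intersection of
    \<open>W\<close> and \<open>W'\<close>, and \<open>snd \<mu>\<close> is injective only on its
    domain. Once both curves stay there, equal coordinates mean equal points.\<close>
  have "\<forall>\<^sub>F \<tau> in nhds 0. b \<tau> \<in> W'"
    using b0 \<kappa>(8,9) by (intro has_velocity_eventually_in_open[OF dN b]) auto
  moreover have "\<forall>\<^sub>F \<tau> in nhds 0. u \<tau> \<in> fst \<mu>"
    using has_velocityD(1)[OF u(2) \<kappa>(2)] u(1) \<kappa>(3) by simp
  ultimately have "\<forall>\<^sub>F \<tau> in nhds 0. f (b \<tau>) = u \<tau>"
    using ev y(3) by eventually_elim (metis T WN inj(2) inj_onD)
  then show ?thesis
    using that b0 b by blast
qed


section \<open>Product manifolds\<close>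

definition prod_chart :: "('a, 'e) chart \<Rightarrow> ('b, 'f) chart \<Rightarrow> ('a \<times> 'b, 'e \<times> 'f) chart" where
  "prod_chart \<kappa> \<mu> = (fst \<kappa> \<times> fst \<mu>, map_prod (snd \<kappa>) (snd \<mu>))"

lemma prod_chart_simps [simp]:
  "fst (prod_chart \<kappa> \<mu>) = fst \<kappa> \<times> fst \<mu>"
  "snd (prod_chart \<kappa> \<mu>) = map_prod (snd \<kappa>) (snd \<mu>)"
  by (simp_all add: prod_chart_def)

lemma prod_atlas_iff: "\<nu> \<in> prod_atlas N P \<longleftrightarrow> (\<exists>\<kappa>\<in>N. \<exists>\<mu>\<in>P. \<nu> = prod_chart \<kappa> \<mu>)"
proof
  assume "\<nu> \<in> prod_atlas N P"
  then obtain U \<phi> V \<psi> where "\<nu> = (U \<times> V, map_prod \<phi> \<psi>)" "(U, \<phi>) \<in> N" "(V, \<psi>) \<in> P"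
    unfolding prod_atlas_def by blast
  then show "\<exists>\<kappa>\<in>N. \<exists>\<mu>\<in>P. \<nu> = prod_chart \<kappa> \<mu>"
    by (intro bexI[of _ "(U, \<phi>)"] bexI[of _ "(V, \<psi>)"]) (simp_all add: prod_chart_def)
next
  assume "\<exists>\<kappa>\<in>N. \<exists>\<mu>\<in>P. \<nu> = prod_chart \<kappa> \<mu>"
  then obtain \<kappa> \<mu> where "(fst \<kappa>, snd \<kappa>) \<in> N" "(fst \<mu>, snd \<mu>) \<in> P" "\<nu> = prod_chart \<kappa> \<mu>"
    by auto
  then show "\<nu> \<in> prod_atlas N P"
    unfolding prod_atlas_def prod_chart_def by blast
qed

lemma prod_chart_in_prod_atlas: "\<kappa> \<in> N \<Longrightarrow> \<mu> \<in> P \<Longrightarrow> prod_chart \<kappa> \<mu> \<in> prod_atlas N P"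
  unfolding prod_atlas_iff by blast

text \<open>A product of sets determines its factors only if it is not empty, whence the points
  \<open>x\<close> and \<open>y\<close>. The coordinate maps are total functions and are recovered
  from \<open>map_prod\<close> everywhere.\<close>

lemma prod_chart_eqD:
  assumes "prod_chart \<kappa> \<mu> = prod_chart \<kappa>' \<mu>'" "x \<in> fst \<kappa>" "y \<in> fst \<mu>"
  shows "\<kappa> = \<kappa>'" "\<mu> = \<mu>'"
proof -
  have "fst \<kappa> \<times> fst \<mu> = fst \<kappa>' \<times> fst \<mu>'" and eq: "map_prod (snd \<kappa>) (snd \<mu>) = map_prod (snd \<kappa>') (snd \<mu>')"
    using assms(1) by (simp_all add: prod_chart_def)
  then have "fst \<kappa> = fst \<kappa>'" "fst \<mu> = fst \<mu>'"
    using assms(2,3) by (auto simp: times_eq_iff)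
  moreover have "snd \<kappa> p = snd \<kappa>' p" "snd \<mu> q = snd \<mu>' q" for p q
    using fun_cong[OF eq, of "(p, q)"] by auto
  ultimately show "\<kappa> = \<kappa>'" "\<mu> = \<mu>'"
    by (auto simp: prod_eq_iff)
qed

lemma points_prod_atlas: "points (prod_atlas N P) = points N \<times> points P"
proof (intro set_eqI iffI)
  fix z assume "z \<in> points (prod_atlas N P)"
  then obtain \<nu> where "\<nu> \<in> prod_atlas N P" "z \<in> fst \<nu>"
    by (rule points_chart)
  then show "z \<in> points N \<times> points P"
    unfolding prod_atlas_iff by (auto simp: mem_Times_iff intro: in_points)
next
  fix z assume "z \<in> points N \<times> points P"
  then have "fst z \<in> points N" "snd z \<in> points P"
    by auto
  then obtain \<kappa> \<mu> where "\<kappa> \<in> N" "fst z \<in> fst \<kappa>" "\<mu> \<in> P" "snd z \<in> fst \<mu>"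
    by (meson points_chart)
  then show "z \<in> points (prod_atlas N P)"
    by (intro in_points[OF prod_chart_in_prod_atlas]) (auto simp: mem_Times_iff)
qed

lemma differentiable_map_prod:
  assumes "f differentiable (at a)" "g differentiable (at b)"
  shows "map_prod f g differentiable (at (a, b))"
proof -
  have f: "(f has_derivative frechet_derivative f (at a)) (at (fst (a, b)))"
    and g: "(g has_derivative frechet_derivative g (at b)) (at (snd (a, b)))"
    using assms by (simp_all add: frechet_derivative_works)
  have "((\<lambda>z. (f (fst z), g (snd z))) has_derivative
      (\<lambda>h. (frechet_derivative f (at a) (fst h), frechet_derivative g (at b) (snd h)))) (at (a, b))"
    by (intro has_derivative_Pair has_derivative_compose[OF has_derivative_fst[OF has_derivative_ident] f]
        has_derivative_compose[OF has_derivative_snd[OF has_derivative_ident] g])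
  then show ?thesis
    by (auto simp: differentiable_def map_prod_def case_prod_unfold)
qed

lemma differentiable_atlas_prod:
  fixes N :: "('a, 'e::real_normed_vector) atlas" and P :: "('b, 'f::real_normed_vector) atlas"
  assumes N: "differentiable_atlas N" and P: "differentiable_atlas P"
  shows "differentiable_atlas (prod_atlas N P)"
proof -
  have inj: "inj_on (snd (prod_chart \<kappa> \<mu>)) (fst (prod_chart \<kappa> \<mu>))" if "\<kappa> \<in> N" "\<mu> \<in> P" for \<kappa> \<mu>
    using differentiable_atlasD(1)[OF N that(1)] differentiable_atlasD(1)[OF P that(2)]
    by (auto simp: map_prod_inj_on)
  have op: "open (snd (prod_chart \<kappa> \<mu>) ` fst (prod_chart \<kappa> \<mu>))" if "\<kappa> \<in> N" "\<mu> \<in> P" for \<kappa> \<mu>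
    using differentiable_atlasD(2)[OF N that(1)] differentiable_atlasD(2)[OF P that(2)]
    by (simp add: map_prod_surj_on open_Times)
  have trans: "open (snd (prod_chart \<kappa> \<mu>) ` (fst (prod_chart \<kappa> \<mu>) \<inter> fst (prod_chart \<kappa>' \<mu>')))"
      (is "open ?O")
    and trans_diff: "\<forall>z\<in>snd (prod_chart \<kappa> \<mu>) ` (fst (prod_chart \<kappa> \<mu>) \<inter> fst (prod_chart \<kappa>' \<mu>')).
      transition (prod_chart \<kappa> \<mu>) (prod_chart \<kappa>' \<mu>') differentiable (at z)"
    if \<kappa>: "\<kappa> \<in> N" "\<mu> \<in> P" "\<kappa>' \<in> N" "\<mu>' \<in> P" for \<kappa> \<mu> \<kappa>' \<mu>'
  proof -
    have "?O = (snd \<kappa> ` (fst \<kappa> \<inter> fst \<kappa>')) \<times> (snd \<mu> ` (fst \<mu> \<inter> fst \<mu>'))"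
      by (auto simp: Times_Int_Times map_prod_surj_on)
    then show op: "open ?O"
      using differentiable_atlasD(3)[OF N \<kappa>(1,3)] differentiable_atlasD(3)[OF P \<kappa>(2,4)]
      by (simp only: open_Times)
    show "\<forall>z\<in>?O. transition (prod_chart \<kappa> \<mu>) (prod_chart \<kappa>' \<mu>') differentiable (at z)"
    proof
      fix z assume z: "z \<in> ?O"
      then obtain x y where xy: "z = (snd \<kappa> x, snd \<mu> y)" "x \<in> fst \<kappa>" "x \<in> fst \<kappa>'" "y \<in> fst \<mu>" "y \<in> fst \<mu>'"
        by auto
      let ?t = "map_prod (transition \<kappa> \<kappa>') (transition \<mu> \<mu>')"
      \<comment> \<open>Outside the chart image \<open>inv_into\<close> is unspecified. The two maps
        are compared on the open set \<open>?O\<close> only, which is enough for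
        derivatives.\<close>
      have eq: "?t w = transition (prod_chart \<kappa> \<mu>) (prod_chart \<kappa>' \<mu>') w" if w: "w \<in> ?O" for w
      proof -
        obtain p q where pq: "w = (snd \<kappa> p, snd \<mu> q)" "p \<in> fst \<kappa>" "q \<in> fst \<mu>"
          using w by auto
        have "?t w = (snd \<kappa>' p, snd \<mu>' q)"
          using pq differentiable_atlasD(1)[OF N \<kappa>(1)] differentiable_atlasD(1)[OF P \<kappa>(2)]
          by (simp add: transition_apply)
        moreover have "transition (prod_chart \<kappa> \<mu>) (prod_chart \<kappa>' \<mu>') w = (snd \<kappa>' p, snd \<mu>' q)"
          using transition_apply[OF inj[OF \<kappa>(1,2)], of "(p, q)" "prod_chart \<kappa>' \<mu>'"] pq by simp
        ultimately show ?thesis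
          by simp
      qed
      have "?t differentiable (at z)"
        unfolding xy(1)
        using differentiable_atlasD(4)[OF N \<kappa>(1,3) xy(2,3)] differentiable_atlasD(4)[OF P \<kappa>(2,4) xy(4,5)]
        by (rule differentiable_map_prod)
      then have "(?t has_derivative frechet_derivative ?t (at z)) (at z)"
        by (simp add: frechet_derivative_works)
      from has_derivative_transform_within_open[OF this op z eq]
      show "transition (prod_chart \<kappa> \<mu>) (prod_chart \<kappa>' \<mu>') differentiable (at z)"
        unfolding differentiable_def by blast
    qed
  qed
  show ?thesis
    unfolding differentiable_atlas_def
  proof (intro conjI ballI)
    fix \<nu> assume "\<nu> \<in> prod_atlas N P"
    then obtain \<kappa> \<mu> where \<nu>: "\<nu> = prod_chart \<kappa> \<mu>" "\<kappa> \<in> N" "\<mu> \<in> P"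
      unfolding prod_atlas_iff by blast
    show "inj_on (snd \<nu>) (fst \<nu>)" "open (snd \<nu> ` fst \<nu>)"
      unfolding \<nu>(1) using inj op \<nu>(2,3) by blast+
    fix \<nu>' assume "\<nu>' \<in> prod_atlas N P"
    then obtain \<kappa>' \<mu>' where \<nu>': "\<nu>' = prod_chart \<kappa>' \<mu>'" "\<kappa>' \<in> N" "\<mu>' \<in> P"
      unfolding prod_atlas_iff by blast
    show "open (snd \<nu> ` (fst \<nu> \<inter> fst \<nu>'))"
      unfolding \<nu>(1) \<nu>'(1) by (rule trans[OF \<nu>(2,3) \<nu>'(2,3)])
    show "transition \<nu> \<nu>' differentiable (at z)" if "z \<in> snd \<nu> ` (fst \<nu> \<inter> fst \<nu>')" for z
      using trans_diff[OF \<nu>(2,3) \<nu>'(2,3)] that unfolding \<nu>(1) \<nu>'(1) by blast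
  qed
qed

text \<open>An explicit form of \<open>tpair\<close>. The description picks the factors of a product chart, which
  are unique because its domain is not empty.\<close>

definition tangent_pair ::
  "('a, 'e::real_normed_vector) atlas \<Rightarrow> ('b, 'f::real_normed_vector) atlas \<Rightarrow> 'a \<Rightarrow> 'b
     \<Rightarrow> ('a, 'e) tvec \<Rightarrow> ('b, 'f) tvec \<Rightarrow> ('a \<times> 'b, 'e \<times> 'f) tvec" where
  "tangent_pair N P x y X Y = (\<lambda>\<nu>. if \<nu> \<in> prod_atlas N P \<and> (x, y) \<in> fst \<nu>
     then THE v. \<exists>\<kappa>\<in>N. \<exists>\<mu>\<in>P. \<nu> = prod_chart \<kappa> \<mu> \<and> v = (X \<kappa>, Y \<mu>) else 0)"

lemma tangent_pair_prod_chart: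
  assumes "\<kappa> \<in> N" "\<mu> \<in> P" "x \<in> fst \<kappa>" "y \<in> fst \<mu>"
  shows "tangent_pair N P x y X Y (prod_chart \<kappa> \<mu>) = (X \<kappa>, Y \<mu>)"
proof -
  have "(THE v. \<exists>\<kappa>'\<in>N. \<exists>\<mu>'\<in>P. prod_chart \<kappa> \<mu> = prod_chart \<kappa>' \<mu>' \<and> v = (X \<kappa>', Y \<mu>')) = (X \<kappa>, Y \<mu>)"
  proof (rule the_equality)
    show "\<exists>\<kappa>'\<in>N. \<exists>\<mu>'\<in>P. prod_chart \<kappa> \<mu> = prod_chart \<kappa>' \<mu>' \<and> (X \<kappa>, Y \<mu>) = (X \<kappa>', Y \<mu>')"
      using assms(1,2) by blast
    fix v assume "\<exists>\<kappa>'\<in>N. \<exists>\<mu>'\<in>P. prod_chart \<kappa> \<mu> = prod_chart \<kappa>' \<mu>' \<and> v = (X \<kappa>', Y \<mu>')"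
    then show "v = (X \<kappa>, Y \<mu>)"
      using prod_chart_eqD[OF _ assms(3,4)] by blast
  qed
  then show ?thesis
    using assms prod_chart_in_prod_atlas[OF assms(1,2)] by (simp add: tangent_pair_def)
qed

lemma tangent_pair_outside:
  "\<not> (\<nu> \<in> prod_atlas N P \<and> (x, y) \<in> fst \<nu>) \<Longrightarrow> tangent_pair N P x y X Y \<nu> = 0"
  unfolding tangent_pair_def by (rule if_not_P)

lemma tangent_pair_eqI:
  assumes "\<And>\<kappa> \<mu>. \<kappa> \<in> N \<Longrightarrow> \<mu> \<in> P \<Longrightarrow> x \<in> fst \<kappa> \<Longrightarrow> y \<in> fst \<mu> \<Longrightarrow> Z (prod_chart \<kappa> \<mu>) = (X \<kappa>, Y \<mu>)"
    and "\<And>\<nu>. \<not> (\<nu> \<in> prod_atlas N P \<and> (x, y) \<in> fst \<nu>) \<Longrightarrow> Z \<nu> = 0"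
  shows "Z = tangent_pair N P x y X Y"
proof
  fix \<nu>
  show "Z \<nu> = tangent_pair N P x y X Y \<nu>"
  proof (cases "\<nu> \<in> prod_atlas N P \<and> (x, y) \<in> fst \<nu>")
    case True
    then obtain \<kappa> \<mu> where "\<nu> = prod_chart \<kappa> \<mu>" "\<kappa> \<in> N" "\<mu> \<in> P" "x \<in> fst \<kappa>" "y \<in> fst \<mu>"
      unfolding prod_atlas_iff by auto
    then show ?thesis
      using assms(1) by (simp add: tangent_pair_prod_chart)
  next
    case False
    show ?thesis
      using assms(2)[OF False] tangent_pair_outside[OF False] by metis
  qed
qed

lemma tangent_pair_add:
  "(\<lambda>\<nu>. tangent_pair N P x y X Y \<nu> + tangent_pair N P x y X' Y' \<nu>) =
    tangent_pair N P x y (\<lambda>\<kappa>. X \<kappa> + X' \<kappa>) (\<lambda>\<mu>. Y \<mu> + Y' \<mu>)"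
  by (rule tangent_pair_eqI) (simp add: tangent_pair_prod_chart, metis tangent_pair_outside add_0)

lemma tangent_pair_scale:
  "(\<lambda>\<nu>. a *\<^sub>R tangent_pair N P x y X Y \<nu>) =
    tangent_pair N P x y (\<lambda>\<kappa>. a *\<^sub>R X \<kappa>) (\<lambda>\<mu>. a *\<^sub>R Y \<mu>)"
  by (rule tangent_pair_eqI) (simp add: tangent_pair_prod_chart, metis tangent_pair_outside scaleR_zero_right)

lemma tangent_pair_inject:
  assumes "tangent_pair N P x y X Y = tangent_pair N P x y X' Y'"
    and x: "x \<in> points N" "X \<in> tangent_space N x" "X' \<in> tangent_space N x"
    and y: "y \<in> points P" "Y \<in> tangent_space P y" "Y' \<in> tangent_space P y"
  shows "X = X'" "Y = Y'"
proof -
  obtain \<kappa> \<mu> where \<kappa>: "\<kappa> \<in> N" "x \<in> fst \<kappa>" and \<mu>: "\<mu> \<in> P" "y \<in> fst \<mu>"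
    using x(1) y(1) by (meson points_chart)
  have "X \<kappa> = X' \<kappa>" "Y \<mu> = Y' \<mu>"
    using fun_cong[OF assms(1), of "prod_chart \<kappa> \<mu>"] \<kappa> \<mu> by (simp_all add: tangent_pair_prod_chart)
  then show "X = X'" "Y = Y'"
    using tangent_eq_coord_vec[OF x(2) \<kappa>] tangent_eq_coord_vec[OF x(3) \<kappa>]
      tangent_eq_coord_vec[OF y(2) \<mu>] tangent_eq_coord_vec[OF y(3) \<mu>] by metis+
qed

lemma has_velocity_tangent_pair:
  assumes a: "has_velocity N a X" and b: "has_velocity P b Y"
  shows "has_velocity (prod_atlas N P) (\<lambda>\<tau>. (a \<tau>, b \<tau>)) (tangent_pair N P (a 0) (b 0) X Y)"
proof -
  have "(\<forall>\<^sub>F \<tau> in nhds 0. (a \<tau>, b \<tau>) \<in> fst \<nu>) \<and>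
     ((\<lambda>\<tau>. snd \<nu> (a \<tau>, b \<tau>)) has_vector_derivative tangent_pair N P (a 0) (b 0) X Y \<nu>) (at 0)"
    if \<nu>: "\<nu> \<in> prod_atlas N P" "(a 0, b 0) \<in> fst \<nu>" for \<nu>
  proof -
    obtain \<kappa> \<mu> where \<kappa>: "\<nu> = prod_chart \<kappa> \<mu>" "\<kappa> \<in> N" "\<mu> \<in> P" "a 0 \<in> fst \<kappa>" "b 0 \<in> fst \<mu>"
      using \<nu> unfolding prod_atlas_iff by auto
    have "\<forall>\<^sub>F \<tau> in nhds 0. (a \<tau>, b \<tau>) \<in> fst \<nu>"
      using has_velocityD(1)[OF a \<kappa>(2,4)] has_velocityD(1)[OF b \<kappa>(3,5)]
      by eventually_elim (simp add: \<kappa>(1))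
    moreover have "((\<lambda>\<tau>. (snd \<kappa> (a \<tau>), snd \<mu> (b \<tau>))) has_vector_derivative (X \<kappa>, Y \<mu>)) (at 0)"
      by (intro has_vector_derivative_Pair has_velocityD(2)[OF a \<kappa>(2,4)] has_velocityD(2)[OF b \<kappa>(3,5)])
    ultimately show ?thesis
      using \<kappa> by (simp add: tangent_pair_prod_chart)
  qed
  moreover have "(a 0, b 0) \<in> points (prod_atlas N P)"
    using has_velocity_in_points[OF a] has_velocity_in_points[OF b] by (simp add: points_prod_atlas)
  moreover have "tangent_pair N P (a 0) (b 0) X Y \<nu> = 0"
    if "\<not> (\<nu> \<in> prod_atlas N P \<and> (a 0, b 0) \<in> fst \<nu>)" for \<nu>
    using that by (rule tangent_pair_outside)
  ultimately show ?thesis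
    unfolding has_velocity_def by blast
qed

text \<open>Both factors are read off in one product chart and completed to tangent vectors by
  \<open>coord_vec\<close>; uniqueness of velocities then identifies \<open>Z\<close> with the
  resulting pair.\<close>

lemma has_velocity_prodE:
  assumes N: "differentiable_atlas N" and P: "differentiable_atlas P"
    and c: "has_velocity (prod_atlas N P) c Z"
  obtains X Y where "has_velocity N (\<lambda>\<tau>. fst (c \<tau>)) X" "has_velocity P (\<lambda>\<tau>. snd (c \<tau>)) Y"
    "Z = tangent_pair N P (fst (c 0)) (snd (c 0)) X Y"
proof -
  have "c 0 \<in> points N \<times> points P"
    using has_velocity_in_points[OF c] by (simp add: points_prod_atlas)
  then have "fst (c 0) \<in> points N" "snd (c 0) \<in> points P"
    by auto
  then obtain \<kappa> \<mu> where \<kappa>: "\<kappa> \<in> N" "fst (c 0) \<in> fst \<kappa>" and \<mu>: "\<mu> \<in> P" "snd (c 0) \<in> fst \<mu>"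
    by (meson points_chart)
  have "c 0 \<in> fst (prod_chart \<kappa> \<mu>)"
    using \<kappa>(2) \<mu>(2) by (simp add: mem_Times_iff)
  note vel = has_velocityD[OF c prod_chart_in_prod_atlas[OF \<kappa>(1) \<mu>(1)] this]
  let ?z = "Z (prod_chart \<kappa> \<mu>)"
  have fstd: "((\<lambda>\<tau>. snd \<kappa> (fst (c \<tau>))) has_vector_derivative fst ?z) (at 0)"
    using bounded_linear.has_vector_derivative[OF bounded_linear_fst vel(2)] by simp
  have sndd: "((\<lambda>\<tau>. snd \<mu> (snd (c \<tau>))) has_vector_derivative snd ?z) (at 0)"
    using bounded_linear.has_vector_derivative[OF bounded_linear_snd vel(2)] by simp
  have "\<forall>\<^sub>F \<tau> in nhds 0. fst (c \<tau>) \<in> fst \<kappa>" "\<forall>\<^sub>F \<tau> in nhds 0. snd (c \<tau>) \<in> fst \<mu>"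
    using vel(1) by (eventually_elim, simp add: mem_Times_iff)+
  then have XY: "has_velocity N (\<lambda>\<tau>. fst (c \<tau>)) (coord_vec N \<kappa> (fst (c 0)) (fst ?z))"
    "has_velocity P (\<lambda>\<tau>. snd (c \<tau>)) (coord_vec P \<mu> (snd (c 0)) (snd ?z))"
    using has_velocity_coord_vec[OF N \<kappa>(1), of "\<lambda>\<tau>. fst (c \<tau>)"] fstd
      has_velocity_coord_vec[OF P \<mu>(1), of "\<lambda>\<tau>. snd (c \<tau>)"] sndd by blast+
  have "has_velocity (prod_atlas N P) c (tangent_pair N P (fst (c 0)) (snd (c 0))
      (coord_vec N \<kappa> (fst (c 0)) (fst ?z)) (coord_vec P \<mu> (snd (c 0)) (snd ?z)))"
    using has_velocity_tangent_pair[OF XY] by simp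
  then show ?thesis
    by (rule that[OF XY has_velocity_unique[OF c]])
qed

text \<open>Other curves with the same velocity compete in the definition of the differential. Each
  splits into two curves with velocities, and injectivity of \<open>tangent_pair\<close> shows that
  the first of these is \<open>X\<close>.\<close>

lemma differential_fst:
  assumes N: "differentiable_atlas N" and P: "differentiable_atlas P"
    and a: "has_velocity N a X" and b: "has_velocity P b Y" and S: "\<forall>\<^sub>F \<tau> in nhds 0. (a \<tau>, b \<tau>) \<in> S"
  shows "differential (prod_atlas N P) N S fst (a 0, b 0) (tangent_pair N P (a 0) (b 0) X Y) = X"
proof (rule differential_eqI[OF _ S has_velocity_tangent_pair[OF a b]])
  fix c assume c: "c 0 = (a 0, b 0)" "has_velocity (prod_atlas N P) c (tangent_pair N P (a 0) (b 0) X Y)"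
  obtain X' Y' where XY: "has_velocity N (\<lambda>\<tau>. fst (c \<tau>)) X'" "has_velocity P (\<lambda>\<tau>. snd (c \<tau>)) Y'"
    "tangent_pair N P (a 0) (b 0) X Y = tangent_pair N P (a 0) (b 0) X' Y'"
    by (rule has_velocity_prodE[OF N P c(2), unfolded c(1) fst_conv snd_conv])
  have "X = X'"
    using has_velocity_tangent[OF N XY(1)] has_velocity_tangent[OF P XY(2)] has_velocity_tangent[OF N a]
      has_velocity_tangent[OF P b] c(1) has_velocity_in_points[OF a] has_velocity_in_points[OF b]
    by (intro tangent_pair_inject(1)[OF XY(3)]) simp_all
  then show "has_velocity N (fst \<circ> c) X"
    using XY(1) by (simp add: o_def)
qed simp

lemma differential_snd:
  assumes N: "differentiable_atlas N" and P: "differentiable_atlas P"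
    and a: "has_velocity N a X" and b: "has_velocity P b Y" and S: "\<forall>\<^sub>F \<tau> in nhds 0. (a \<tau>, b \<tau>) \<in> S"
  shows "differential (prod_atlas N P) P S snd (a 0, b 0) (tangent_pair N P (a 0) (b 0) X Y) = Y"
proof (rule differential_eqI[OF _ S has_velocity_tangent_pair[OF a b]])
  fix c assume c: "c 0 = (a 0, b 0)" "has_velocity (prod_atlas N P) c (tangent_pair N P (a 0) (b 0) X Y)"
  obtain X' Y' where XY: "has_velocity N (\<lambda>\<tau>. fst (c \<tau>)) X'" "has_velocity P (\<lambda>\<tau>. snd (c \<tau>)) Y'"
    "tangent_pair N P (a 0) (b 0) X Y = tangent_pair N P (a 0) (b 0) X' Y'"
    by (rule has_velocity_prodE[OF N P c(2), unfolded c(1) fst_conv snd_conv])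
  have "Y = Y'"
    using has_velocity_tangent[OF N XY(1)] has_velocity_tangent[OF P XY(2)] has_velocity_tangent[OF N a]
      has_velocity_tangent[OF P b] c(1) has_velocity_in_points[OF a] has_velocity_in_points[OF b]
    by (intro tangent_pair_inject(2)[OF XY(3)]) simp_all
  then show "has_velocity P (snd \<circ> c) Y"
    using XY(2) by (simp add: o_def)
qed simp

lemma tangent_pair_tangent:
  assumes N: "differentiable_atlas N" and P: "differentiable_atlas P"
    and x: "x \<in> points N" "X \<in> tangent_space N x" and y: "y \<in> points P" "Y \<in> tangent_space P y"
  shows "tangent_pair N P x y X Y \<in> tangent_space (prod_atlas N P) (x, y)"
proof -
  obtain a where a: "a 0 = x" "has_velocity N a X"
    by (rule tangent_curve[OF N x])
  obtain b where b: "b 0 = y" "has_velocity P b Y"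
    by (rule tangent_curve[OF P y])
  show ?thesis
    using has_velocity_tangent[OF differentiable_atlas_prod[OF N P] has_velocity_tangent_pair[OF a(2) b(2)]]
      a(1) b(1) by simp
qed

text \<open>The projections recover both entries of a \<open>tangent_pair\<close>, and every tangent
  vector of the product is such a pair, being the velocity of a curve that splits.\<close>

lemma tpair_eq_tangent_pair:
  assumes N: "differentiable_atlas N" and P: "differentiable_atlas P"
    and x: "x \<in> points N" "X \<in> tangent_space N x" and y: "y \<in> points P" "Y \<in> tangent_space P y"
  shows "tpair N P x y X Y = tangent_pair N P x y X Y"
  unfolding tpair_def
proof (rule the_equality)
  have proj: "diff (prod_atlas N P) N fst (x, y) (tangent_pair N P x y X' Y') = X'"
    "diff (prod_atlas N P) P snd (x, y) (tangent_pair N P x y X' Y') = Y'"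
    if X': "X' \<in> tangent_space N x" and Y': "Y' \<in> tangent_space P y" for X' Y'
  proof -
    obtain a where a: "a 0 = x" "has_velocity N a X'"
      by (rule tangent_curve[OF N x(1) X'])
    obtain b where b: "b 0 = y" "has_velocity P b Y'"
      by (rule tangent_curve[OF P y(1) Y'])
    note ev = has_velocity_eventually_points[OF has_velocity_tangent_pair[OF a(2) b(2)]]
    show "diff (prod_atlas N P) N fst (x, y) (tangent_pair N P x y X' Y') = X'"
      using differential_fst[OF N P a(2) b(2) ev] a(1) b(1) by simp
    show "diff (prod_atlas N P) P snd (x, y) (tangent_pair N P x y X' Y') = Y'"
      using differential_snd[OF N P a(2) b(2) ev] a(1) b(1) by simp
  qed
  show "tangent_pair N P x y X Y \<in> tangent_space (prod_atlas N P) (x, y) \<and>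
      diff (prod_atlas N P) N fst (x, y) (tangent_pair N P x y X Y) = X \<and>
      diff (prod_atlas N P) P snd (x, y) (tangent_pair N P x y X Y) = Y"
    using tangent_pair_tangent[OF assms] proj[OF x(2) y(2)] by simp
  fix Z assume Z: "Z \<in> tangent_space (prod_atlas N P) (x, y) \<and>
      diff (prod_atlas N P) N fst (x, y) Z = X \<and> diff (prod_atlas N P) P snd (x, y) Z = Y"
  have xy: "(x, y) \<in> points (prod_atlas N P)"
    using x(1) y(1) by (simp add: points_prod_atlas)
  obtain c where c: "c 0 = (x, y)" "has_velocity (prod_atlas N P) c Z"
    using tangent_curve[OF differentiable_atlas_prod[OF N P] xy conjunct1[OF Z]] .
  obtain X' Y' where XY: "has_velocity N (\<lambda>\<tau>. fst (c \<tau>)) X'" "has_velocity P (\<lambda>\<tau>. snd (c \<tau>)) Y'"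
    "Z = tangent_pair N P x y X' Y'"
    by (rule has_velocity_prodE[OF N P c(2), unfolded c(1) fst_conv snd_conv])
  have "X' \<in> tangent_space N x" "Y' \<in> tangent_space P y"
    using has_velocity_tangent[OF N XY(1)] has_velocity_tangent[OF P XY(2)] c(1) by simp_all
  then show "Z = tangent_pair N P x y X Y"
    using proj[of X' Y'] Z XY(3) by simp
qed


section \<open>Covectors on a product\<close>

lemma diff_inclusion_left:
  assumes N: "differentiable_atlas N" and P: "differentiable_atlas P"
    and x: "x \<in> points N" "X \<in> tangent_space N x" and y: "y \<in> points P"
  shows "diff N (prod_atlas N P) (\<lambda>z. (z, y)) x X = tangent_pair N P x y X (\<lambda>\<mu>. 0)"
proof -
  obtain a where a: "a 0 = x" "has_velocity N a X"
    by (rule tangent_curve[OF N x])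
  show ?thesis
  proof (rule differential_eqI[OF a(1) has_velocity_eventually_points[OF a(2)] a(2)])
    fix c assume "c 0 = x" "has_velocity N c X"
    then show "has_velocity (prod_atlas N P) ((\<lambda>z. (z, y)) \<circ> c) (tangent_pair N P x y X (\<lambda>\<mu>. 0))"
      using has_velocity_tangent_pair[OF _ has_velocity_const[OF y], of N c X] by (simp add: o_def)
  qed
qed

lemma diff_inclusion_right:
  assumes N: "differentiable_atlas N" and P: "differentiable_atlas P"
    and x: "x \<in> points N" and y: "y \<in> points P" "Y \<in> tangent_space P y"
  shows "diff P (prod_atlas N P) (\<lambda>z. (x, z)) y Y = tangent_pair N P x y (\<lambda>\<kappa>. 0) Y"
proof -
  obtain b where b: "b 0 = y" "has_velocity P b Y"
    by (rule tangent_curve[OF P y])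
  show ?thesis
  proof (rule differential_eqI[OF b(1) has_velocity_eventually_points[OF b(2)] b(2)])
    fix c assume "c 0 = y" "has_velocity P c Y"
    then show "has_velocity (prod_atlas N P) ((\<lambda>z. (x, z)) \<circ> c) (tangent_pair N P x y (\<lambda>\<kappa>. 0) Y)"
      using has_velocity_tangent_pair[OF has_velocity_const[OF x], of P c Y] by (simp add: o_def)
  qed
qed

abbreviation covec_left ::
  "('a, 'e::real_normed_vector) atlas \<Rightarrow> ('b, 'f::real_normed_vector) atlas \<Rightarrow> 'a \<Rightarrow> 'b
     \<Rightarrow> ('a \<times> 'b, 'e \<times> 'f) covec \<Rightarrow> ('a, 'e) covec" where
  "covec_left N P x y \<equiv> pullback_covec N (prod_atlas N P) (\<lambda>z. (z, y)) x"

abbreviation covec_right ::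
  "('a, 'e::real_normed_vector) atlas \<Rightarrow> ('b, 'f::real_normed_vector) atlas \<Rightarrow> 'a \<Rightarrow> 'b
     \<Rightarrow> ('a \<times> 'b, 'e \<times> 'f) covec \<Rightarrow> ('b, 'f) covec" where
  "covec_right N P x y \<equiv> pullback_covec P (prod_atlas N P) (\<lambda>z. (x, z)) y"

lemma covec_linear:
  assumes "\<xi> \<in> cotangent_space N x"
  shows "X \<in> tangent_space N x \<Longrightarrow> Y \<in> tangent_space N x \<Longrightarrow> \<xi> (\<lambda>\<kappa>. X \<kappa> + Y \<kappa>) = \<xi> X + \<xi> Y"
    "X \<in> tangent_space N x \<Longrightarrow> \<xi> (\<lambda>\<kappa>. a *\<^sub>R X \<kappa>) = a * \<xi> X"
    "X \<notin> tangent_space N x \<Longrightarrow> \<xi> X = 0"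
  using assms unfolding cotangent_space_def dual_space_def by blast+

lemma cotangentI:
  assumes "\<And>X Y. X \<in> tangent_space N x \<Longrightarrow> Y \<in> tangent_space N x \<Longrightarrow> \<xi> (\<lambda>\<kappa>. X \<kappa> + Y \<kappa>) = \<xi> X + \<xi> Y"
    "\<And>a X. X \<in> tangent_space N x \<Longrightarrow> \<xi> (\<lambda>\<kappa>. a *\<^sub>R X \<kappa>) = a * \<xi> X"
    "\<And>X. X \<notin> tangent_space N x \<Longrightarrow> \<xi> X = 0"
  shows "\<xi> \<in> cotangent_space N x"
  using assms unfolding cotangent_space_def dual_space_def by blast

lemma covec_left_cotangent:
  assumes N: "differentiable_atlas N" and P: "differentiable_atlas P"
    and x: "x \<in> points N" and y: "y \<in> points P"
    and \<xi>: "\<xi> \<in> cotangent_space (prod_atlas N P) (x, y)"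
  shows "covec_left N P x y \<xi> \<in> cotangent_space N x"
proof -
  note tp = tangent_pair_tangent[OF N P x _ y tangent_zero[OF P y]]
  show ?thesis
  proof (rule cotangentI)
    show "covec_left N P x y \<xi> (\<lambda>\<kappa>. X \<kappa> + Y \<kappa>) = covec_left N P x y \<xi> X + covec_left N P x y \<xi> Y"
      if "X \<in> tangent_space N x" "Y \<in> tangent_space N x" for X Y
      using covec_linear(1)[OF \<xi> tp[OF that(1)] tp[OF that(2)]] tangent_add[OF N x that] that
      by (simp add: pullback_covec_def diff_inclusion_left[OF N P x _ y] tangent_pair_add)
    show "covec_left N P x y \<xi> (\<lambda>\<kappa>. a *\<^sub>R X \<kappa>) = a * covec_left N P x y \<xi> X"
      if "X \<in> tangent_space N x" for a X
      using covec_linear(2)[OF \<xi> tp[OF that], of a] tangent_scale[OF N x that, of a] that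
      by (simp add: pullback_covec_def diff_inclusion_left[OF N P x _ y] tangent_pair_scale)
  qed (simp add: pullback_covec_def)
qed

lemma covec_right_cotangent:
  assumes N: "differentiable_atlas N" and P: "differentiable_atlas P"
    and x: "x \<in> points N" and y: "y \<in> points P"
    and \<xi>: "\<xi> \<in> cotangent_space (prod_atlas N P) (x, y)"
  shows "covec_right N P x y \<xi> \<in> cotangent_space P y"
proof -
  note tp = tangent_pair_tangent[OF N P x tangent_zero[OF N x] y]
  show ?thesis
  proof (rule cotangentI)
    show "covec_right N P x y \<xi> (\<lambda>\<kappa>. X \<kappa> + Y \<kappa>) = covec_right N P x y \<xi> X + covec_right N P x y \<xi> Y"
      if "X \<in> tangent_space P y" "Y \<in> tangent_space P y" for X Y
      using covec_linear(1)[OF \<xi> tp[OF that(1)] tp[OF that(2)]] tangent_add[OF P y that] that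
      by (simp add: pullback_covec_def diff_inclusion_right[OF N P x y] tangent_pair_add)
    show "covec_right N P x y \<xi> (\<lambda>\<kappa>. a *\<^sub>R X \<kappa>) = a * covec_right N P x y \<xi> X"
      if "X \<in> tangent_space P y" for a X
      using covec_linear(2)[OF \<xi> tp[OF that], of a] tangent_scale[OF P y that, of a] that
      by (simp add: pullback_covec_def diff_inclusion_right[OF N P x y] tangent_pair_scale)
  qed (simp add: pullback_covec_def)
qed

text \<open>Linearity applied to \<open>(X, Y) = (X, 0) + (0, Y)\<close>; the two summands are the
  images of \<open>X\<close> and \<open>Y\<close> under the inclusions used in
  \<open>mv_sum\<close>.\<close>

lemma covec_tangent_pair:
  assumes N: "differentiable_atlas N" and P: "differentiable_atlas P"
    and x: "x \<in> points N" "X \<in> tangent_space N x" and y: "y \<in> points P" "Y \<in> tangent_space P y"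
    and \<xi>: "\<xi> \<in> cotangent_space (prod_atlas N P) (x, y)"
  shows "\<xi> (tangent_pair N P x y X Y) = covec_left N P x y \<xi> X + covec_right N P x y \<xi> Y"
proof -
  have "\<xi> (tangent_pair N P x y X Y) =
      \<xi> (\<lambda>\<nu>. tangent_pair N P x y X (\<lambda>\<mu>. 0) \<nu> + tangent_pair N P x y (\<lambda>\<kappa>. 0) Y \<nu>)"
    by (simp add: tangent_pair_add)
  also have "\<dots> = \<xi> (tangent_pair N P x y X (\<lambda>\<mu>. 0)) + \<xi> (tangent_pair N P x y (\<lambda>\<kappa>. 0) Y)"
    by (intro covec_linear(1)[OF \<xi>] tangent_pair_tangent[OF N P] x y tangent_zero N P)
  finally show ?thesis
    using x y by (simp add: pullback_covec_def diff_inclusion_left[OF N P] diff_inclusion_right[OF N P])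
qed


section \<open>Lie groupoids\<close>

locale lie_groupoid_structure =
  fixes N :: "('g, 'e::real_inner) atlas" and M :: "('m, 'f::real_inner) atlas"
    and G :: "('g, 'm) groupoid"
  assumes lie_groupoid: "lie_groupoid N M G"
begin

lemma smooth_manifolds: "smooth_manifold N" "smooth_manifold M"
  and Arr_eq: "Arr G = points N"
  and Obj_eq: "Obj G = points M"
  and submersions: "submersion N M (src G)" "submersion N M (tgt G)"
  and smooth_ivt: "smooth_map_on N N (points N) (ivt G)"
  and smooth_mul: "smooth_map_on (prod_atlas N N) N (composable G) (\<lambda>(g, h). mul G g h)"
  and groupoid: "is_groupoid G"
  using lie_groupoid unfolding lie_groupoid_def by blast+

lemma smooth_src: "smooth_map_on N M (points N) (src G)"
  and smooth_tgt: "smooth_map_on N M (points N) (tgt G)"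
  using submersions unfolding submersion_def by blast+

lemmas dN = smooth_manifold_differentiable_atlas[OF smooth_manifolds(1)]
  and dM = smooth_manifold_differentiable_atlas[OF smooth_manifolds(2)]
lemmas dN2 = differentiable_atlas_prod[OF dN dN]
lemmas dN3 = differentiable_atlas_prod[OF dN dN2]

section \<open>Algebra in the groupoid\<close>

lemma composable_iff: "(g, h) \<in> composable G \<longleftrightarrow> g \<in> Arr G \<and> h \<in> Arr G \<and> src G g = tgt G h"
  by (simp add: composable_def)

lemma src_in_Obj: "g \<in> Arr G \<Longrightarrow> src G g \<in> Obj G"
  and tgt_in_Obj: "g \<in> Arr G \<Longrightarrow> tgt G g \<in> Obj G"
  and unt_in_Arr: "x \<in> Obj G \<Longrightarrow> unt G x \<in> Arr G"
  and src_unt: "x \<in> Obj G \<Longrightarrow> src G (unt G x) = x"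
  and tgt_unt: "x \<in> Obj G \<Longrightarrow> tgt G (unt G x) = x"
  and ivt_in_Arr: "g \<in> Arr G \<Longrightarrow> ivt G g \<in> Arr G"
  and src_ivt: "g \<in> Arr G \<Longrightarrow> src G (ivt G g) = tgt G g"
  and tgt_ivt: "g \<in> Arr G \<Longrightarrow> tgt G (ivt G g) = src G g"
  and mul_unt_left: "g \<in> Arr G \<Longrightarrow> mul G (unt G (tgt G g)) g = g"
  and mul_unt_right: "g \<in> Arr G \<Longrightarrow> mul G g (unt G (src G g)) = g"
  and mul_ivt_right: "g \<in> Arr G \<Longrightarrow> mul G g (ivt G g) = unt G (tgt G g)"
  and mul_ivt_left: "g \<in> Arr G \<Longrightarrow> mul G (ivt G g) g = unt G (src G g)"
  using groupoid unfolding is_groupoid_def Pi_def by blast+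

lemma mul_composable:
  assumes "(g, h) \<in> composable G"
  shows "mul G g h \<in> Arr G" "src G (mul G g h) = src G h" "tgt G (mul G g h) = tgt G g"
  using assms groupoid unfolding is_groupoid_def by (blast dest: bspec)+

lemma mul_assoc:
  "(g, h) \<in> composable G \<Longrightarrow> (h, k) \<in> composable G \<Longrightarrow> mul G (mul G g h) k = mul G g (mul G h k)"
  using groupoid unfolding is_groupoid_def by blast

lemma mul_ivt_cancel_right:
  assumes "(g, h) \<in> composable G"
  shows "mul G (mul G g h) (ivt G h) = g"
proof -
  have gh: "g \<in> Arr G" "h \<in> Arr G" "src G g = tgt G h"
    using assms by (simp_all add: composable_iff)
  have "mul G (mul G g h) (ivt G h) = mul G g (mul G h (ivt G h))"
    using gh by (intro mul_assoc assms) (simp add: composable_iff ivt_in_Arr tgt_ivt)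
  then show ?thesis
    using gh mul_unt_right[OF gh(1)] by (simp add: mul_ivt_right)
qed

lemma ivt_mul_cancel_right:
  assumes "g \<in> Arr G" "h \<in> Arr G" "src G g = src G h"
  shows "mul G (mul G g (ivt G h)) h = g"
proof -
  have "mul G (mul G g (ivt G h)) h = mul G g (mul G (ivt G h) h)"
    using assms by (intro mul_assoc) (simp_all add: composable_iff ivt_in_Arr tgt_ivt src_ivt)
  then show ?thesis
    using assms mul_unt_right[OF assms(1)] by (simp add: mul_ivt_left)
qed

section \<open>Composable tangent vectors and composable curves\<close>

lemma velocity_eventually_in_Arr: "has_velocity N c X \<Longrightarrow> \<forall>\<^sub>F \<tau> in nhds 0. c \<tau> \<in> Arr G"
  by (simp add: Arr_eq has_velocity_eventually_points)

lemma tangent_composable_iff: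
  "((g, X), (h, Y)) \<in> composable (tangent_groupoid N M G) \<longleftrightarrow>
    (g, h) \<in> composable G \<and> X \<in> tangent_space N g \<and> Y \<in> tangent_space N h \<and>
    diff N M (src G) g X = diff N M (tgt G) h Y"
  by (auto simp: composable_def tangent_groupoid_def)

text \<open>Differentiate the identity between \<open>src G (a \<tau>)\<close> and
  \<open>tgt G (b \<tau>)\<close>; a curve has only one velocity.\<close>

lemma velocities_composable:
  assumes a: "has_velocity N a X" and b: "has_velocity N b Y"
    and ev: "\<forall>\<^sub>F \<tau> in nhds 0. (a \<tau>, b \<tau>) \<in> composable G"
  shows "((a 0, X), (b 0, Y)) \<in> composable (tangent_groupoid N M G)"
proof -
  have "\<forall>\<^sub>F \<tau> in nhds 0. src G (a \<tau>) = tgt G (b \<tau>)"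
    using ev by eventually_elim (simp add: composable_iff)
  then have "has_velocity M (\<lambda>\<tau>. tgt G (b \<tau>)) (diff N M (src G) (a 0) X)"
    by (rule has_velocity_cong[OF diff_has_velocity[OF dN dM smooth_src a]])
  then have "diff N M (src G) (a 0) X = diff N M (tgt G) (b 0) Y"
    using diff_has_velocity[OF dN dM smooth_tgt b] by (rule has_velocity_unique)
  then show ?thesis
    using eventually_nhds_x_imp_x[OF ev] has_velocity_tangent[OF dN a] has_velocity_tangent[OF dN b]
    by (simp add: tangent_composable_iff)
qed

lemma tangent_mul_eq:
  assumes "((g, X), (h, Y)) \<in> composable (tangent_groupoid N M G)"
  shows "tangent_mul N G g X h Y =
    differential (prod_atlas N N) N (composable G) (\<lambda>(a, b). mul G a b) (g, h) (tangent_pair N N g h X Y)"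
  using assms tpair_eq_tangent_pair[OF dN dN, of g X h Y]
  by (simp add: tangent_mul_def tangent_composable_iff composable_iff Arr_eq)

text \<open>The tangent product is the velocity of the product curve. Most identities for
  \<open>tangent_mul\<close> below are obtained from this by comparing curves of arrows.\<close>

lemma velocity_mul:
  assumes a: "has_velocity N a X" and b: "has_velocity N b Y"
    and ev: "\<forall>\<^sub>F \<tau> in nhds 0. (a \<tau>, b \<tau>) \<in> composable G"
  shows "has_velocity N (\<lambda>\<tau>. mul G (a \<tau>) (b \<tau>)) (tangent_mul N G (a 0) X (b 0) Y)"
  using smooth_map_has_velocity[OF dN2 dN smooth_mul ev has_velocity_tangent_pair[OF a b]]
  by (simp add: tangent_mul_eq[OF velocities_composable[OF a b ev]] o_def)

text \<open>The target is a submersion, so the curve of sources of \<open>a\<close> lifts through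
  \<open>h\<close> with velocity \<open>Y\<close>. The left curve is given in advance, which allows
  two right factors to be lifted over the same \<open>a\<close>.\<close>

lemma composable_lift:
  assumes a: "has_velocity N a X" "a 0 = g"
    and XY: "((g, X), (h, Y)) \<in> composable (tangent_groupoid N M G)"
  obtains b where "b 0 = h" "has_velocity N b Y" "\<forall>\<^sub>F \<tau> in nhds 0. (a \<tau>, b \<tau>) \<in> composable G"
proof -
  have h: "h \<in> points N" "Y \<in> tangent_space N h" and eq: "src G (a 0) = tgt G h"
      "diff N M (src G) (a 0) X = diff N M (tgt G) h Y"
    using XY a(2) by (simp_all add: tangent_composable_iff composable_iff Arr_eq)
  obtain b where b: "b 0 = h" "has_velocity N b Y" "\<forall>\<^sub>F \<tau> in nhds 0. tgt G (b \<tau>) = src G (a \<tau>)"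
    by (rule submersion_lift_curve[OF smooth_manifolds submersions(2) h, of "\<lambda>\<tau>. src G (a \<tau>)"])
       (use eq diff_has_velocity[OF dN dM smooth_src a(1)] in simp_all)
  have "\<forall>\<^sub>F \<tau> in nhds 0. (a \<tau>, b \<tau>) \<in> composable G"
    using b(3) velocity_eventually_in_Arr[OF a(1)] velocity_eventually_in_Arr[OF b(2)]
    by eventually_elim (simp add: composable_iff)
  then show ?thesis
    using that b(1,2) by blast
qed

lemma composable_curves:
  assumes XY: "((g, X), (h, Y)) \<in> composable (tangent_groupoid N M G)"
  obtains a b where "a 0 = g" "has_velocity N a X" "b 0 = h" "has_velocity N b Y"
    "\<forall>\<^sub>F \<tau> in nhds 0. (a \<tau>, b \<tau>) \<in> composable G"
proof -
  have "g \<in> points N" "X \<in> tangent_space N g"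
    using XY by (simp_all add: tangent_composable_iff composable_iff Arr_eq)
  then obtain a where a: "a 0 = g" "has_velocity N a X"
    by (rule tangent_curve[OF dN])
  obtain b where "b 0 = h" "has_velocity N b Y" "\<forall>\<^sub>F \<tau> in nhds 0. (a \<tau>, b \<tau>) \<in> composable G"
    by (rule composable_lift[OF a(2,1) XY])
  then show ?thesis
    by (rule that[OF a])
qed

text \<open>One half of the identification of tangent vectors of \<open>composable G\<close> with
  composable pairs; the other half is \<open>composable_tangent_projections\<close>.\<close>

lemma tangent_pair_tangent_composable:
  assumes XY: "((g, X), (h, Y)) \<in> composable (tangent_groupoid N M G)"
  shows "tangent_pair N N g h X Y \<in> tangent_of_subset (prod_atlas N N) (composable G) (g, h)"
proof -
  obtain a b where ab: "a 0 = g" "has_velocity N a X" "b 0 = h" "has_velocity N b Y"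
    "\<forall>\<^sub>F \<tau> in nhds 0. (a \<tau>, b \<tau>) \<in> composable G"
    by (rule composable_curves[OF XY])
  show ?thesis
    unfolding tangent_of_subset_def
    using ab(1,3,5) has_velocity_tangent_pair[OF ab(2,4)] by (intro CollectI exI[of _ "\<lambda>\<tau>. (a \<tau>, b \<tau>)"]) simp
qed

lemma tangent_mul_tangent:
  assumes XY: "((g, X), (h, Y)) \<in> composable (tangent_groupoid N M G)"
  shows "tangent_mul N G g X h Y \<in> tangent_space N (mul G g h)"
proof -
  obtain a b where ab: "a 0 = g" "has_velocity N a X" "b 0 = h" "has_velocity N b Y"
    "\<forall>\<^sub>F \<tau> in nhds 0. (a \<tau>, b \<tau>) \<in> composable G"
    by (rule composable_curves[OF XY])
  show ?thesis
    using has_velocity_tangent[OF dN velocity_mul[OF ab(2,4,5)]] ab(1,3) by simp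
qed

section \<open>Linearity and surjectivity of the tangent multiplication\<close>

lemma diff_add:
  assumes f: "smooth_map_on N M (points N) f"
    and X: "g \<in> Arr G" "X \<in> tangent_space N g" "X' \<in> tangent_space N g"
  shows "diff N M f g (\<lambda>\<kappa>. X \<kappa> + X' \<kappa>) = (\<lambda>\<kappa>. diff N M f g X \<kappa> + diff N M f g X' \<kappa>)"
proof -
  have g: "g \<in> points N"
    using X(1) by (simp add: Arr_eq)
  show ?thesis
    by (rule differential_add[OF dN dM f g]) (simp_all add: tangent_of_points[OF dN g] tangent_add[OF dN g] X)
qed

lemma diff_scale:
  assumes f: "smooth_map_on N M (points N) f" and X: "g \<in> Arr G" "X \<in> tangent_space N g"
  shows "diff N M f g (\<lambda>\<kappa>. a *\<^sub>R X \<kappa>) = (\<lambda>\<kappa>. a *\<^sub>R diff N M f g X \<kappa>)"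
proof -
  have g: "g \<in> points N"
    using X(1) by (simp add: Arr_eq)
  show ?thesis
    by (rule differential_scale[OF dN dM f g]) (simp_all add: tangent_of_points[OF dN g] tangent_scale[OF dN g] X)
qed

lemma tangent_composable_add:
  assumes "((g, X), (h, Y)) \<in> composable (tangent_groupoid N M G)"
    and "((g, X'), (h, Y')) \<in> composable (tangent_groupoid N M G)"
  shows "((g, \<lambda>\<kappa>. X \<kappa> + X' \<kappa>), (h, \<lambda>\<kappa>. Y \<kappa> + Y' \<kappa>)) \<in> composable (tangent_groupoid N M G)"
  using assms diff_add[OF smooth_src, of g X X'] diff_add[OF smooth_tgt, of h Y Y']
    tangent_add[OF dN, of g X X'] tangent_add[OF dN, of h Y Y']
  unfolding tangent_composable_iff by (simp add: composable_iff Arr_eq)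

lemma tangent_composable_scale:
  assumes "((g, X), (h, Y)) \<in> composable (tangent_groupoid N M G)"
  shows "((g, \<lambda>\<kappa>. a *\<^sub>R X \<kappa>), (h, \<lambda>\<kappa>. a *\<^sub>R Y \<kappa>)) \<in> composable (tangent_groupoid N M G)"
  using assms diff_scale[OF smooth_src, of g X a] diff_scale[OF smooth_tgt, of h Y a]
    tangent_scale[OF dN, of g X a] tangent_scale[OF dN, of h Y a]
  unfolding tangent_composable_iff by (simp add: composable_iff Arr_eq)

text \<open>The interchange law between fibrewise addition and multiplication. It is linearity of
  the differential of the multiplication, available since all three pairs are tangent to
  \<open>composable G\<close>.\<close>

lemma tangent_mul_add:
  assumes XY: "((g, X), (h, Y)) \<in> composable (tangent_groupoid N M G)"
    and XY': "((g, X'), (h, Y')) \<in> composable (tangent_groupoid N M G)"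
  shows "tangent_mul N G g (\<lambda>\<kappa>. X \<kappa> + X' \<kappa>) h (\<lambda>\<kappa>. Y \<kappa> + Y' \<kappa>) =
    (\<lambda>\<kappa>. tangent_mul N G g X h Y \<kappa> + tangent_mul N G g X' h Y' \<kappa>)"
proof -
  note sum = tangent_composable_add[OF XY XY']
  have gh: "(g, h) \<in> composable G"
    using XY by (simp add: tangent_composable_iff)
  have "(\<lambda>\<nu>. tangent_pair N N g h X Y \<nu> + tangent_pair N N g h X' Y' \<nu>)
      \<in> tangent_of_subset (prod_atlas N N) (composable G) (g, h)"
    using tangent_pair_tangent_composable[OF sum] by (simp only: tangent_pair_add)
  from differential_add[OF dN2 dN smooth_mul gh tangent_pair_tangent_composable[OF XY]
      tangent_pair_tangent_composable[OF XY'] this]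
  show ?thesis
    by (simp only: tangent_mul_eq[OF XY] tangent_mul_eq[OF XY'] tangent_mul_eq[OF sum] tangent_pair_add)
qed

lemma tangent_mul_scale:
  assumes XY: "((g, X), (h, Y)) \<in> composable (tangent_groupoid N M G)"
  shows "tangent_mul N G g (\<lambda>\<kappa>. a *\<^sub>R X \<kappa>) h (\<lambda>\<kappa>. a *\<^sub>R Y \<kappa>) = (\<lambda>\<kappa>. a *\<^sub>R tangent_mul N G g X h Y \<kappa>)"
proof -
  note aXY = tangent_composable_scale[OF XY, of a]
  have gh: "(g, h) \<in> composable G"
    using XY by (simp add: tangent_composable_iff)
  have "(\<lambda>\<nu>. a *\<^sub>R tangent_pair N N g h X Y \<nu>) \<in> tangent_of_subset (prod_atlas N N) (composable G) (g, h)"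
    using tangent_pair_tangent_composable[OF aXY] by (simp only: tangent_pair_scale)
  from differential_scale[OF dN2 dN smooth_mul gh tangent_pair_tangent_composable[OF XY] this]
  show ?thesis
    by (simp only: tangent_mul_eq[OF XY] tangent_mul_eq[OF aXY] tangent_pair_scale)
qed

text \<open>The differential of the target at \<open>h\<close> is onto, so it attains the value of
  the differential of the source at \<open>X\<close>.\<close>

lemma tangent_composable_exists_right:
  assumes "(g, h) \<in> composable G" "X \<in> tangent_space N g"
  obtains Y where "((g, X), (h, Y)) \<in> composable (tangent_groupoid N M G)"
proof -
  have gh: "g \<in> points N" "h \<in> points N" "src G g = tgt G h"
    using assms(1) by (simp_all add: composable_iff Arr_eq)
  have "diff N M (src G) g X \<in> tangent_space M (src G g)"
    using submersions(1) gh(1) assms(2) unfolding submersion_def by blast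
  also have "\<dots> = diff N M (tgt G) h ` tangent_space N h"
    using submersions(2) gh(2,3) unfolding submersion_def by simp
  finally obtain Y where "Y \<in> tangent_space N h" "diff N M (src G) g X = diff N M (tgt G) h Y"
    by blast
  then show ?thesis
    using that assms by (simp add: tangent_composable_iff)
qed

text \<open>A curve \<open>w\<close> through \<open>g h\<close> factors as \<open>(w b\<^sup>-\<^sup>1) b\<close>, for a lift \<open>b\<close> through \<open>h\<close> of
  its source.\<close>

lemma tangent_mul_surj:
  assumes gh: "(g, h) \<in> composable G" and W: "W \<in> tangent_space N (mul G g h)"
  obtains X Y where "((g, X), (h, Y)) \<in> composable (tangent_groupoid N M G)" "tangent_mul N G g X h Y = W"
proof -
  note m = mul_composable[OF gh]
  have h: "h \<in> points N" and mN: "mul G g h \<in> points N"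
    using gh m(1) by (simp_all add: composable_iff Arr_eq)
  obtain w where w: "w 0 = mul G g h" "has_velocity N w W"
    by (rule tangent_curve[OF dN mN W])
  have "diff N M (src G) (mul G g h) W \<in> tangent_space M (src G (mul G g h))"
    using submersions(1) mN W unfolding submersion_def by blast
  also have "\<dots> = diff N M (src G) h ` tangent_space N h"
    using submersions(1) h m(2) unfolding submersion_def by simp
  finally obtain Y where Y: "Y \<in> tangent_space N h" "diff N M (src G) (mul G g h) W = diff N M (src G) h Y"
    by blast
  obtain b where b: "b 0 = h" "has_velocity N b Y" "\<forall>\<^sub>F \<tau> in nhds 0. src G (b \<tau>) = src G (w \<tau>)"
    by (rule submersion_lift_curve[OF smooth_manifolds submersions(1) h Y(1), of "\<lambda>\<tau>. src G (w \<tau>)"])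
       (use w(1) m(2) Y(2) diff_has_velocity[OF dN dM smooth_src w(2)] in simp_all)
  note ib = diff_has_velocity[OF dN dN smooth_ivt b(2)]
  define a where "a \<tau> = mul G (w \<tau>) (ivt G (b \<tau>))" for \<tau>
  have ev: "\<forall>\<^sub>F \<tau> in nhds 0. w \<tau> \<in> Arr G \<and> b \<tau> \<in> Arr G \<and> src G (w \<tau>) = src G (b \<tau>)"
    using b(3) velocity_eventually_in_Arr[OF w(2)] velocity_eventually_in_Arr[OF b(2)]
    by eventually_elim simp
  then have "\<forall>\<^sub>F \<tau> in nhds 0. (w \<tau>, ivt G (b \<tau>)) \<in> composable G"
    by eventually_elim (simp add: composable_iff ivt_in_Arr tgt_ivt)
  from velocity_mul[OF w(2) ib this] obtain X where X: "has_velocity N a X"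
    unfolding a_def by blast
  have ab: "\<forall>\<^sub>F \<tau> in nhds 0. (a \<tau>, b \<tau>) \<in> composable G \<and> mul G (a \<tau>) (b \<tau>) = w \<tau>"
    using ev
  proof eventually_elim
    case (elim \<tau>)
    then have "(w \<tau>, ivt G (b \<tau>)) \<in> composable G"
      by (simp add: composable_iff ivt_in_Arr tgt_ivt)
    from mul_composable[OF this] show ?case
      using elim by (simp add: a_def composable_iff src_ivt ivt_mul_cancel_right)
  qed
  have a0: "a 0 = g"
    using mul_ivt_cancel_right[OF gh] by (simp add: a_def w(1) b(1))
  have ab1: "\<forall>\<^sub>F \<tau> in nhds 0. (a \<tau>, b \<tau>) \<in> composable G"
    and ab2: "\<forall>\<^sub>F \<tau> in nhds 0. mul G (a \<tau>) (b \<tau>) = w \<tau>"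
    using ab by (eventually_elim, simp)+
  have "tangent_mul N G g X h Y = W"
    using has_velocity_unique[OF has_velocity_cong[OF velocity_mul[OF X b(2) ab1] ab2] w(2)]
    by (simp add: a0 b(1))
  then show ?thesis
    using that velocities_composable[OF X b(2) ab1] by (simp add: a0 b(1))
qed

section \<open>Translates of Lie algebroid elements\<close>

text \<open>Lifting the constant curve at \<open>x\<close> realises a vector in the kernel of
  \<open>ds\<close> by a curve inside the source fibre, which is where right translation is
  defined.\<close>

lemma algebroid_curve:
  assumes x: "x \<in> Obj G" and u: "u \<in> algebroid_fibre N M G x"
  obtains e where "e 0 = unt G x" "has_velocity N e u" "\<forall>\<^sub>F \<tau> in nhds 0. e \<tau> \<in> Arr G \<and> src G (e \<tau>) = x"
proof -
  have xN: "unt G x \<in> points N" "x \<in> points M"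
    using unt_in_Arr[OF x] x by (simp_all add: Arr_eq Obj_eq)
  have uN: "u \<in> tangent_space N (unt G x)" "diff N M (src G) (unt G x) u = (\<lambda>\<kappa>. 0)"
    using u by (simp_all add: algebroid_fibre_def)
  obtain e where e: "e 0 = unt G x" "has_velocity N e u" "\<forall>\<^sub>F \<tau> in nhds 0. src G (e \<tau>) = x"
    by (rule submersion_lift_curve[OF smooth_manifolds submersions(1) xN(1) uN(1), of "\<lambda>\<tau>. x"])
       (use src_unt[OF x] has_velocity_const[OF xN(2)] uN(2) in simp_all)
  have "\<forall>\<^sub>F \<tau> in nhds 0. e \<tau> \<in> Arr G \<and> src G (e \<tau>) = x"
    using e(3) velocity_eventually_in_Arr[OF e(2)] by eventually_elim simp
  then show ?thesis
    by (rule that[OF e(1,2)])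
qed

lemma velocity_const_Arr: "g \<in> Arr G \<Longrightarrow> has_velocity N (\<lambda>\<tau>. g) (\<lambda>\<kappa>. 0)"
  by (simp add: Arr_eq has_velocity_const)

text \<open>Right translation by \<open>g\<close> is tangent multiplication by the zero vector at
  \<open>g\<close>; hence every curve in the source fibre with velocity \<open>u\<close> yields the
  same result.\<close>

lemma right_vec_velocity:
  assumes g: "g \<in> Arr G" and e: "e 0 = unt G (tgt G g)" "has_velocity N e u"
    and ev: "\<forall>\<^sub>F \<tau> in nhds 0. e \<tau> \<in> Arr G \<and> src G (e \<tau>) = tgt G g"
  shows "has_velocity N (\<lambda>\<tau>. mul G (e \<tau>) g) (right_vec N G g u)"
proof -
  let ?V = "tangent_mul N G (unt G (tgt G g)) u g (\<lambda>\<kappa>. 0)"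
  have *: "has_velocity N (\<lambda>\<tau>. mul G (c \<tau>) g) ?V"
    if c: "c 0 = unt G (tgt G g)" "has_velocity N c u"
      "\<forall>\<^sub>F \<tau> in nhds 0. c \<tau> \<in> {k \<in> Arr G. src G k = tgt G g}" for c
  proof -
    have "\<forall>\<^sub>F \<tau> in nhds 0. (c \<tau>, g) \<in> composable G"
      using c(3) by eventually_elim (simp add: composable_iff g)
    from velocity_mul[OF c(2) velocity_const_Arr[OF g] this] show ?thesis
      by (simp add: c(1))
  qed
  have ev': "\<forall>\<^sub>F \<tau> in nhds 0. e \<tau> \<in> {k \<in> Arr G. src G k = tgt G g}"
    using ev by simp
  have "right_vec N G g u = ?V"
    unfolding right_vec_def by (rule differential_eqI[OF e(1) ev' e(2)]) (simp add: o_def *)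
  then show ?thesis
    using *[OF e ev'] by simp
qed

text \<open>\<open>left_vec\<close> carries a minus sign in front of the translated inverse, so its
  negative is the velocity of \<open>g\<close> times the inverse curve.\<close>

lemma left_vec_velocity:
  assumes g: "g \<in> Arr G" and e: "e 0 = unt G (src G g)" "has_velocity N e u"
    and ev: "\<forall>\<^sub>F \<tau> in nhds 0. e \<tau> \<in> Arr G \<and> src G (e \<tau>) = src G g"
  shows "has_velocity N (\<lambda>\<tau>. mul G g (ivt G (e \<tau>))) (\<lambda>\<kappa>. - left_vec N G g u \<kappa>)"
proof -
  let ?x = "src G g"
  define w where "w = diff N N (ivt G) (unt G ?x) u"
  let ?V = "tangent_mul N G g (\<lambda>\<kappa>. 0) (unt G ?x) w"
  have x: "?x \<in> Obj G"
    using g by (rule src_in_Obj)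
  \<comment> \<open>Units are their own inverses, so the curve \<open>ivt G (e \<tau>)\<close>
    starts at the unit as well.\<close>
  have "ivt G (unt G ?x) = unt G ?x"
    using mul_unt_left[OF ivt_in_Arr[OF unt_in_Arr[OF x]]] mul_ivt_right[OF unt_in_Arr[OF x]]
    by (simp add: tgt_ivt src_unt tgt_unt unt_in_Arr x)
  then have e0: "ivt G (e 0) = unt G ?x"
    by (simp add: e(1))
  have ie: "has_velocity N (\<lambda>\<tau>. ivt G (e \<tau>)) w"
    using diff_has_velocity[OF dN dN smooth_ivt e(2)] by (simp add: e(1) w_def)
  have *: "has_velocity N (\<lambda>\<tau>. mul G g (c \<tau>)) ?V"
    if c: "c 0 = unt G ?x" "has_velocity N c w"
      "\<forall>\<^sub>F \<tau> in nhds 0. c \<tau> \<in> {k \<in> Arr G. tgt G k = src G g}" for c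
  proof -
    have "\<forall>\<^sub>F \<tau> in nhds 0. (g, c \<tau>) \<in> composable G"
      using c(3) by eventually_elim (simp add: composable_iff g)
    from velocity_mul[OF velocity_const_Arr[OF g] c(2) this] show ?thesis
      by (simp add: c(1))
  qed
  have ev': "\<forall>\<^sub>F \<tau> in nhds 0. ivt G (e \<tau>) \<in> {k \<in> Arr G. tgt G k = src G g}"
    using ev by eventually_elim (simp add: ivt_in_Arr tgt_ivt)
  have "differential N N {k \<in> Arr G. tgt G k = src G g} (\<lambda>k. mul G g k) (unt G ?x) w = ?V"
    by (rule differential_eqI[of "\<lambda>\<tau>. ivt G (e \<tau>)", OF e0 ev' ie]) (simp add: o_def *)
  then have "(\<lambda>\<kappa>. - left_vec N G g u \<kappa>) = ?V"
    by (simp add: left_vec_def w_def)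
  then show ?thesis
    using *[OF e0 ie ev'] by simp
qed

text \<open>The two vectors are the velocities of \<open>k e\<^sup>-\<^sup>1\<close> and \<open>e g\<close>, whose product is constant.\<close>

lemma left_right_vec_cancel:
  assumes kg: "(k, g) \<in> composable G" and u: "u \<in> algebroid_fibre N M G (tgt G g)"
  shows "((k, \<lambda>\<kappa>. - left_vec N G k u \<kappa>), (g, right_vec N G g u)) \<in> composable (tangent_groupoid N M G)"
    and "tangent_mul N G k (\<lambda>\<kappa>. - left_vec N G k u \<kappa>) g (right_vec N G g u) = (\<lambda>\<kappa>. 0)"
proof -
  have k: "k \<in> Arr G" "g \<in> Arr G" "src G k = tgt G g"
    using kg by (simp_all add: composable_iff)
  obtain e where e: "e 0 = unt G (tgt G g)" "has_velocity N e u"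
    "\<forall>\<^sub>F \<tau> in nhds 0. e \<tau> \<in> Arr G \<and> src G (e \<tau>) = tgt G g"
    by (rule algebroid_curve[OF tgt_in_Obj[OF k(2)] u])
  note r = right_vec_velocity[OF k(2) e]
    and l = left_vec_velocity[OF k(1), unfolded k(3), OF e]
  have ev: "\<forall>\<^sub>F \<tau> in nhds 0. (mul G k (ivt G (e \<tau>)), mul G (e \<tau>) g) \<in> composable G \<and>
      mul G (mul G k (ivt G (e \<tau>))) (mul G (e \<tau>) g) = mul G k g"
    using e(3)
  proof eventually_elim
    case (elim \<tau>)
    then have c: "(k, ivt G (e \<tau>)) \<in> composable G" "(e \<tau>, g) \<in> composable G"
      by (simp_all add: composable_iff ivt_in_Arr tgt_ivt k)
    note c1 = mul_composable[OF c(1)] and c2 = mul_composable[OF c(2)]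
    have "(mul G k (ivt G (e \<tau>)), e \<tau>) \<in> composable G"
      using elim c1 by (simp add: composable_iff src_ivt)
    then have "mul G (mul G k (ivt G (e \<tau>))) (mul G (e \<tau>) g) = mul G (mul G (mul G k (ivt G (e \<tau>))) (e \<tau>)) g"
      using mul_assoc[OF _ c(2)] by simp
    also have "\<dots> = mul G k g"
      using elim k ivt_mul_cancel_right[of k "e \<tau>"] by simp
    finally show ?case
      using elim c1 c2 by (simp add: composable_iff src_ivt)
  qed
  have ev1: "\<forall>\<^sub>F \<tau> in nhds 0. (mul G k (ivt G (e \<tau>)), mul G (e \<tau>) g) \<in> composable G"
    and ev2: "\<forall>\<^sub>F \<tau> in nhds 0. mul G (mul G k (ivt G (e \<tau>))) (mul G (e \<tau>) g) = mul G k g"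
    using ev by (eventually_elim, simp)+
  have x: "tgt G g \<in> Obj G"
    using k(2) by (rule tgt_in_Obj)
  \<comment> \<open>Cancellation turns this product, multiplied by the unit once more, into
    \<open>k\<close>; the right unit law removes the extra unit.\<close>
  have "mul G k (ivt G (e 0)) = k"
    using ivt_mul_cancel_right[OF k(1) unt_in_Arr[OF x]] k
      mul_unt_right[of "mul G k (ivt G (unt G (tgt G g)))"]
      mul_composable[of k "ivt G (unt G (tgt G g))"]
    by (simp add: e(1) composable_iff src_ivt tgt_ivt ivt_in_Arr unt_in_Arr[OF x] src_unt[OF x] tgt_unt[OF x])
  moreover have "mul G (e 0) g = g"
    by (simp add: e(1) mul_unt_left k(2))
  ultimately have 0: "mul G k (ivt G (e 0)) = k" "mul G (e 0) g = g" .
  show "((k, \<lambda>\<kappa>. - left_vec N G k u \<kappa>), (g, right_vec N G g u)) \<in> composable (tangent_groupoid N M G)"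
    using velocities_composable[OF l r ev1] unfolding 0 .
  have "has_velocity N (\<lambda>\<tau>. mul G k g)
      (tangent_mul N G k (\<lambda>\<kappa>. - left_vec N G k u \<kappa>) g (right_vec N G g u))"
    using has_velocity_cong[OF velocity_mul[OF l r ev1] ev2] unfolding 0 .
  then show "tangent_mul N G k (\<lambda>\<kappa>. - left_vec N G k u \<kappa>) g (right_vec N G g u) = (\<lambda>\<kappa>. 0)"
    using velocity_const_Arr[OF mul_composable(1)[OF kg]] by (rule has_velocity_unique)
qed

end


section \<open>Affine tensors\<close>

text \<open>Origin of the sign \<open>(-1) ^ p\<close> in the multivector case: homogeneity is
  applied in each slot in turn, by induction on the number of leading entries already
  negated.\<close>

lemma alternating_multilinear_uminus:
  assumes f: "alternating_multilinear V k f" and xs: "length xs = k" "set xs \<subseteq> V"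
    and V: "\<And>x. x \<in> V \<Longrightarrow> (\<lambda>j. - x j) \<in> V"
  shows "f (map (\<lambda>x j. - x j) xs) = (-1) ^ k * f xs"
proof -
  let ?neg = "\<lambda>x j. - x j"
  have "f (map ?neg (take n xs) @ drop n xs) = (-1) ^ n * f xs" if "n \<le> k" for n
    using that
  proof (induction n)
    case (Suc n)
    let ?ys = "map ?neg (take n xs) @ drop n xs"
    have n: "n < length xs"
      using Suc.prems xs(1) by simp
    have len: "length ?ys = k"
      using n xs(1) by simp
    have ys: "set ?ys \<subseteq> V"
      using xs(2) V by (auto dest: in_set_takeD in_set_dropD)
    have x: "xs ! n \<in> V"
      using xs(2) n by auto
    have "map ?neg (take (Suc n) xs) @ drop (Suc n) xs = ?ys[n := ?neg (xs ! n)]"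
      using n by (simp add: take_Suc_conv_app_nth Cons_nth_drop_Suc[symmetric] list_update_append)
    moreover have "?ys[n := xs ! n] = ?ys"
      using n by (simp add: Cons_nth_drop_Suc[symmetric] list_update_append)
    moreover have "\<forall>a. \<forall>x\<in>V. f (?ys[n := \<lambda>j. a *\<^sub>R x j]) = a * f (?ys[n := x])"
      using f[unfolded alternating_multilinear_def, rule_format, OF conjI[OF len ys] Suc_le_lessD[OF Suc.prems]]
      by blast
    from this[rule_format, OF x, of "-1"] have "f (?ys[n := ?neg (xs ! n)]) = - f (?ys[n := xs ! n])"
      by simp
    ultimately show ?case
      using Suc by simp
  qed simp
  from this[of k] show ?thesis
    using xs(1) by simp
qed

lemma alternating_multilinear_0: "alternating_multilinear V 0 f"
  by (simp add: alternating_multilinear_def)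

context lie_groupoid_structure
begin

section \<open>Products in the cotangent groupoid\<close>

lemma covec_uminus:
  assumes "\<xi> \<in> cotangent_space N g"
  shows "(\<lambda>X. - \<xi> X) \<in> cotangent_space N g"
  using covec_linear[OF assms] by (intro cotangentI) simp_all

lemma covec_zero:
  assumes "\<xi> \<in> cotangent_space N g" "g \<in> Arr G"
  shows "\<xi> (\<lambda>\<kappa>. 0) = 0"
  using covec_linear(2)[OF assms(1) tangent_zero[OF dN], of 0] assms(2) by (simp add: Arr_eq)

text \<open>Every tangent vector at \<open>g h\<close> is a product of composable ones by
  \<open>tangent_mul_surj\<close>, so the multiplicative property determines \<open>\<zeta>\<close>
  on the tangent space; off it all covectors vanish.\<close>

lemma cotangent_mul_eqI:
  assumes gh: "(g, h) \<in> composable G"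
    and \<zeta>: "\<zeta> \<in> cotangent_space N (mul G g h)"
    and mult: "\<And>X Y. ((g, X), (h, Y)) \<in> composable (tangent_groupoid N M G) \<Longrightarrow>
      \<zeta> (tangent_mul N G g X h Y) = \<xi> X + \<eta> Y"
  shows "mul (cotangent_groupoid N M G) (g, \<xi>) (h, \<eta>) = (mul G g h, \<zeta>)"
proof -
  have "(THE \<zeta>. \<zeta> \<in> cotangent_space N (mul G g h) \<and>
      (\<forall>X Y. ((g, X), (h, Y)) \<in> composable (tangent_groupoid N M G) \<longrightarrow>
        \<zeta> (tangent_mul N G g X h Y) = \<xi> X + \<eta> Y)) = \<zeta>"
  proof (rule the_equality)
    show "\<zeta> \<in> cotangent_space N (mul G g h) \<and>
      (\<forall>X Y. ((g, X), (h, Y)) \<in> composable (tangent_groupoid N M G) \<longrightarrow>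
        \<zeta> (tangent_mul N G g X h Y) = \<xi> X + \<eta> Y)"
      using \<zeta> mult by blast
    fix \<zeta>' assume \<zeta>': "\<zeta>' \<in> cotangent_space N (mul G g h) \<and>
      (\<forall>X Y. ((g, X), (h, Y)) \<in> composable (tangent_groupoid N M G) \<longrightarrow>
        \<zeta>' (tangent_mul N G g X h Y) = \<xi> X + \<eta> Y)"
    show "\<zeta>' = \<zeta>"
    proof
      fix W
      show "\<zeta>' W = \<zeta> W"
      proof (cases "W \<in> tangent_space N (mul G g h)")
        case True
        obtain X Y where XY: "((g, X), (h, Y)) \<in> composable (tangent_groupoid N M G)"
            "tangent_mul N G g X h Y = W"
          by (rule tangent_mul_surj[OF gh True])
        have "\<zeta>' (tangent_mul N G g X h Y) = \<xi> X + \<eta> Y"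
          using \<zeta>' XY(1) by blast
        then show ?thesis
          using mult[OF XY(1)] XY(2) by simp
      next
        case False
        then show ?thesis
          using covec_linear(3)[OF \<zeta> False] covec_linear(3)[OF conjunct1[OF \<zeta>'] False] by simp
      qed
    qed
  qed
  then show ?thesis
    by (simp add: cotangent_groupoid_def)
qed

text \<open>Evaluate \<open>\<zeta>\<close> on the product of \<open>- left_vec N G k u\<close> and
  \<open>right_vec N G g u\<close>. This product is zero, so the two contributions cancel, which is
  the equality of source and target at \<open>u\<close>.\<close>

lemma cotangent_src_eq_tgtI:
  assumes kg: "(k, g) \<in> composable G"
    and \<kappa>: "\<kappa> \<in> cotangent_space N k"
    and \<zeta>: "\<zeta> \<in> cotangent_space N (mul G k g)"
    and mult: "\<And>X Y. ((k, X), (g, Y)) \<in> composable (tangent_groupoid N M G) \<Longrightarrow>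
      \<zeta> (tangent_mul N G k X g Y) = \<kappa> X + \<eta> Y"
  shows "src (cotangent_groupoid N M G) (k, \<kappa>) = tgt (cotangent_groupoid N M G) (g, \<eta>)"
proof -
  have "\<kappa> (left_vec N G k u) = \<eta> (right_vec N G g u)" if u: "u \<in> algebroid_fibre N M G (tgt G g)" for u
  proof -
    note lr = left_right_vec_cancel[OF kg u]
    have "(\<lambda>\<kappa>. - left_vec N G k u \<kappa>) \<in> tangent_space N k"
      using lr(1) by (simp add: tangent_composable_iff)
    then have "\<kappa> (\<lambda>\<kappa>. - left_vec N G k u \<kappa>) = - \<kappa> (left_vec N G k u)"
      using covec_linear(2)[OF \<kappa>, of "\<lambda>\<kappa>. - left_vec N G k u \<kappa>" "-1"] by simp
    moreover have "\<zeta> (\<lambda>\<kappa>. 0) = 0"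
      by (rule covec_zero[OF \<zeta> mul_composable(1)[OF kg]])
    ultimately show ?thesis
      using mult[OF lr(1)] lr(2) by simp
  qed
  then show ?thesis
    using kg by (auto simp: cotangent_groupoid_def composable_iff)
qed

text \<open>The conormal condition says \<open>(-\<xi>2) \<cdot> \<xi>1\<^sup>-\<^sup>1 = \<xi>4 \<cdot> (-\<xi>3)\<^sup>-\<^sup>1\<close> in the cotangent groupoid;
  \<open>\<kappa>\<close> is this common element.\<close>

lemma conormal_factorization:
  assumes kg: "(k, g) \<in> composable G" and kl: "(k, l) \<in> composable G"
    and \<xi>1: "\<xi>1 \<in> cotangent_space N g" and \<xi>2: "\<xi>2 \<in> cotangent_space N (mul G k g)"
    and conormal: "\<And>X Y Z. ((k, X), (g, Y)) \<in> composable (tangent_groupoid N M G) \<Longrightarrow>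
      ((k, X), (l, Z)) \<in> composable (tangent_groupoid N M G) \<Longrightarrow>
      \<xi>1 Y + \<xi>2 (tangent_mul N G k X g Y) + \<xi>3 Z + \<xi>4 (tangent_mul N G k X l Z) = 0"
  obtains \<kappa> where "\<kappa> \<in> cotangent_space N k"
    "\<And>X Y. ((k, X), (g, Y)) \<in> composable (tangent_groupoid N M G) \<Longrightarrow>
      - \<xi>2 (tangent_mul N G k X g Y) = \<kappa> X + \<xi>1 Y"
    "\<And>X Z. ((k, X), (l, Z)) \<in> composable (tangent_groupoid N M G) \<Longrightarrow>
      \<xi>4 (tangent_mul N G k X l Z) = \<kappa> X + - \<xi>3 Z"
proof -
  have k: "k \<in> points N"
    using kg by (simp add: composable_iff Arr_eq)
  define Z where "Z X = (SOME Z. ((k, X), (l, Z)) \<in> composable (tangent_groupoid N M G))" for X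
  have Z: "((k, X), (l, Z X)) \<in> composable (tangent_groupoid N M G)" if X: "X \<in> tangent_space N k" for X
  proof -
    obtain Z' where "((k, X), (l, Z')) \<in> composable (tangent_groupoid N M G)"
      by (rule tangent_composable_exists_right[OF kl X])
    then show ?thesis
      unfolding Z_def by (rule someI[where P = "\<lambda>Z. ((k, X), (l, Z)) \<in> composable (tangent_groupoid N M G)"])
  qed
  \<comment> \<open>The conormal condition makes the value independent of the chosen
    \<open>Z X\<close>: it equals \<open>- \<xi>2 (tangent_mul N G k X g Y) - \<xi>1 Y\<close> for
    every \<open>Y\<close> composable with \<open>X\<close>.\<close>
  define \<kappa> where "\<kappa> X = (if X \<in> tangent_space N k
    then \<xi>4 (tangent_mul N G k X l (Z X)) + \<xi>3 (Z X) else 0)" for X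
  have 1: "- \<xi>2 (tangent_mul N G k X g Y) = \<kappa> X + \<xi>1 Y"
    if XY: "((k, X), (g, Y)) \<in> composable (tangent_groupoid N M G)" for X Y
  proof -
    have X: "X \<in> tangent_space N k"
      using XY by (simp add: tangent_composable_iff)
    show ?thesis
      using conormal[OF XY Z[OF X]] X by (simp add: \<kappa>_def)
  qed
  have 2: "\<xi>4 (tangent_mul N G k X l Z) = \<kappa> X + - \<xi>3 Z"
    if XZ: "((k, X), (l, Z)) \<in> composable (tangent_groupoid N M G)" for X Z
  proof -
    have X: "X \<in> tangent_space N k"
      using XZ by (simp add: tangent_composable_iff)
    obtain Y where XY: "((k, X), (g, Y)) \<in> composable (tangent_groupoid N M G)"
      by (rule tangent_composable_exists_right[OF kg X])
    show ?thesis
      using conormal[OF XY XZ] 1[OF XY] by linarith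
  qed
  \<comment> \<open>The choice \<open>Z X\<close> is not linear in \<open>X\<close>. Linearity is
    read off from the expression through \<open>\<xi>1\<close> and \<open>\<xi>2\<close>, in which
    \<open>Y\<close> is free, so sums and multiples of composable pairs may be inserted.\<close>
  have "\<kappa> \<in> cotangent_space N k"
  proof (rule cotangentI)
    fix X X' assume X: "X \<in> tangent_space N k" "X' \<in> tangent_space N k"
    obtain Y where Y: "((k, X), (g, Y)) \<in> composable (tangent_groupoid N M G)"
      by (rule tangent_composable_exists_right[OF kg X(1)])
    obtain Y' where Y': "((k, X'), (g, Y')) \<in> composable (tangent_groupoid N M G)"
      by (rule tangent_composable_exists_right[OF kg X(2)])
    have "Y \<in> tangent_space N g" "Y' \<in> tangent_space N g"
      using Y Y' by (simp_all add: tangent_composable_iff)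
    then show "\<kappa> (\<lambda>\<kappa>. X \<kappa> + X' \<kappa>) = \<kappa> X + \<kappa> X'"
      using 1[OF tangent_composable_add[OF Y Y']] 1[OF Y] 1[OF Y']
        covec_linear(1)[OF \<xi>1, of Y Y']
        covec_linear(1)[OF \<xi>2 tangent_mul_tangent[OF Y] tangent_mul_tangent[OF Y']]
      by (simp add: tangent_mul_add[OF Y Y'])
  next
    fix a X assume X: "X \<in> tangent_space N k"
    obtain Y where Y: "((k, X), (g, Y)) \<in> composable (tangent_groupoid N M G)"
      by (rule tangent_composable_exists_right[OF kg X])
    have eq: "\<kappa> X = - \<xi>2 (tangent_mul N G k X g Y) - \<xi>1 Y"
      using 1[OF Y] by simp
    have "Y \<in> tangent_space N g"
      using Y by (simp add: tangent_composable_iff)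
    then show "\<kappa> (\<lambda>\<kappa>. a *\<^sub>R X \<kappa>) = a * \<kappa> X"
      using 1[OF tangent_composable_scale[OF Y, of a]] covec_linear(2)[OF \<xi>1, of Y a]
        covec_linear(2)[OF \<xi>2 tangent_mul_tangent[OF Y], of a]
      by (simp add: eq tangent_mul_scale[OF Y] algebra_simps)
  qed (simp add: \<kappa>_def)
  then show ?thesis
    using 1 2 by (rule that)
qed

section \<open>Affine (p,0)-tensors are affine p-vector fields\<close>

text \<open>Affinity for \<open>p\<close> cotangent products at once, indexed by a common list to
  keep the slots aligned. The unit term is written through \<open>k\<close> and
  \<open>\<kappa>\<close> alone, so that it coincides in two applications that share them.\<close>

lemma affine_multivector_mul:
  assumes F: "affine_function
      (direct_sum_groupoid 0 p G (tangent_groupoid N M G) (cotangent_groupoid N M G)) (\<lambda>(g, Xs, \<xi>s). F g Xs \<xi>s)"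
    and kg: "(k, g) \<in> composable G" and xs: "length xs = p"
    and \<kappa>: "\<And>x. x \<in> set xs \<Longrightarrow> \<kappa> x \<in> cotangent_space N k"
    and \<eta>: "\<And>x. x \<in> set xs \<Longrightarrow> \<eta> x \<in> cotangent_space N g"
    and \<zeta>: "\<And>x. x \<in> set xs \<Longrightarrow> \<zeta> x \<in> cotangent_space N (mul G k g)"
    and mult: "\<And>x X Y. x \<in> set xs \<Longrightarrow> ((k, X), (g, Y)) \<in> composable (tangent_groupoid N M G) \<Longrightarrow>
      \<zeta> x (tangent_mul N G k X g Y) = \<kappa> x X + \<eta> x Y"
  shows "F (mul G k g) [] (map \<zeta> xs) = F k [] (map \<kappa> xs) + F g [] (map \<eta> xs)
    - F (unt G (src G k)) [] (map (\<lambda>x. snd (unt (cotangent_groupoid N M G)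
        (src G k, snd (src (cotangent_groupoid N M G) (k, \<kappa> x))))) xs)"
proof -
  let ?D = "direct_sum_groupoid 0 p G (tangent_groupoid N M G) (cotangent_groupoid N M G)"
  let ?C = "cotangent_groupoid N M G"
  have kgA: "k \<in> Arr G" "g \<in> Arr G" "src G k = tgt G g"
    using kg by (simp_all add: composable_iff)
  have src: "src ?C (k, \<kappa> x) = tgt ?C (g, \<eta> x)" if x: "x \<in> set xs" for x
    by (rule cotangent_src_eq_tgtI[OF kg \<kappa>[OF x] \<zeta>[OF x] mult[OF x]])
  have mul: "mul ?C (k, \<kappa> x) (g, \<eta> x) = (mul G k g, \<zeta> x)" if x: "x \<in> set xs" for x
    by (rule cotangent_mul_eqI[OF kg \<zeta>[OF x] mult[OF x]])
  have arr: "(g, \<xi>) \<in> Arr ?C \<longleftrightarrow> g \<in> Arr G \<and> \<xi> \<in> cotangent_space N g" for g \<xi>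
    by (simp add: cotangent_groupoid_def)
  have comp: "((k, [], map \<kappa> xs), (g, [], map \<eta> xs)) \<in> composable ?D"
    using kgA xs src \<kappa> \<eta> by (simp add: composable_def direct_sum_groupoid_def arr)
  have "F (mul G k g) [] (map2 (\<lambda>\<xi> \<eta>. snd (mul ?C (k, \<xi>) (g, \<eta>))) (map \<kappa> xs) (map \<eta> xs)) =
      F k [] (map \<kappa> xs) + F g [] (map \<eta> xs)
      - F (unt G (src G k)) [] (map (\<lambda>x. snd (unt ?C (src G k, snd (src ?C (k, \<kappa> x))))) xs)"
    using F[unfolded affine_function_def, rule_format, OF comp]
    by (simp add: direct_sum_groupoid_def o_def)
  moreover have "map2 (\<lambda>\<xi> \<eta>. snd (mul ?C (k, \<xi>) (g, \<eta>))) (map \<kappa> xs) (map \<eta> xs) = map \<zeta> xs"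
    using mul by (simp add: map2_map_map)
  ultimately show ?thesis
    by simp
qed

text \<open>Both products below have the same left factor, so the values at units cancel.\<close>

lemma affine_multivector_conormal:
  assumes F: "affine_tensor N M G p 0 F"
    and g: "g \<in> Arr G" and h: "h \<in> Arr G" and l: "l \<in> Arr G"
    and st: "src G g = src G h" "tgt G g = tgt G l"
    and r: "r = mul G (mul G h (ivt G g)) l" and \<xi>s: "length \<xi>s = p"
    and \<xi>: "\<And>\<xi>. \<xi> \<in> set \<xi>s \<Longrightarrow> c1 \<xi> \<in> cotangent_space N g"
      "\<And>\<xi>. \<xi> \<in> set \<xi>s \<Longrightarrow> c2 \<xi> \<in> cotangent_space N h"
      "\<And>\<xi>. \<xi> \<in> set \<xi>s \<Longrightarrow> c3 \<xi> \<in> cotangent_space N l"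
      "\<And>\<xi>. \<xi> \<in> set \<xi>s \<Longrightarrow> c4 \<xi> \<in> cotangent_space N r"
    and conormal: "\<And>\<xi> X Y Z. \<xi> \<in> set \<xi>s \<Longrightarrow>
      ((mul G h (ivt G g), X), (g, Y)) \<in> composable (tangent_groupoid N M G) \<Longrightarrow>
      ((mul G h (ivt G g), X), (l, Z)) \<in> composable (tangent_groupoid N M G) \<Longrightarrow>
      c1 \<xi> Y + c2 \<xi> (tangent_mul N G (mul G h (ivt G g)) X g Y) + c3 \<xi> Z +
      c4 \<xi> (tangent_mul N G (mul G h (ivt G g)) X l Z) = 0"
  shows "F g [] (map c1 \<xi>s) + (-1) ^ (p + 1) * F h [] (map c2 \<xi>s) +
    (-1) ^ (p + 1) * F l [] (map c3 \<xi>s) + F r [] (map c4 \<xi>s) = 0"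
proof -
  define k where "k = mul G h (ivt G g)"
  have hg: "(h, ivt G g) \<in> composable G"
    using g h st by (simp add: composable_iff ivt_in_Arr tgt_ivt)
  have kg: "(k, g) \<in> composable G" and kl: "(k, l) \<in> composable G"
    using mul_composable[OF hg] g l st by (simp_all add: k_def composable_iff src_ivt)
  have h_eq: "h = mul G k g"
    using ivt_mul_cancel_right[OF h g] st by (simp add: k_def)
  have r_eq: "r = mul G k l"
    by (simp add: r k_def)
  \<comment> \<open>Each covector of the list receives one \<open>\<kappa>\<close>, which serves for
    both products \<open>h = k g\<close> and \<open>r = k l\<close>.\<close>
  have "\<exists>\<kappa>\<in>cotangent_space N k.
      (\<forall>X Y. ((k, X), (g, Y)) \<in> composable (tangent_groupoid N M G) \<longrightarrow>
        - c2 \<xi> (tangent_mul N G k X g Y) = \<kappa> X + c1 \<xi> Y) \<and>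
      (\<forall>X Z. ((k, X), (l, Z)) \<in> composable (tangent_groupoid N M G) \<longrightarrow>
        c4 \<xi> (tangent_mul N G k X l Z) = \<kappa> X + - c3 \<xi> Z)" if x: "\<xi> \<in> set \<xi>s" for \<xi>
    by (rule conormal_factorization[OF kg kl \<xi>(1)[OF x] \<xi>(2)[OF x, unfolded h_eq]
          conormal[OF x, folded k_def]]) blast+
  then obtain \<kappa> where \<kappa>: "\<And>\<xi>. \<xi> \<in> set \<xi>s \<Longrightarrow> \<kappa> \<xi> \<in> cotangent_space N k"
    "\<And>\<xi> X Y. \<xi> \<in> set \<xi>s \<Longrightarrow> ((k, X), (g, Y)) \<in> composable (tangent_groupoid N M G) \<Longrightarrow>
      - c2 \<xi> (tangent_mul N G k X g Y) = \<kappa> \<xi> X + c1 \<xi> Y"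
    "\<And>\<xi> X Z. \<xi> \<in> set \<xi>s \<Longrightarrow> ((k, X), (l, Z)) \<in> composable (tangent_groupoid N M G) \<Longrightarrow>
      c4 \<xi> (tangent_mul N G k X l Z) = \<kappa> \<xi> X + - c3 \<xi> Z"
    by metis
  have aff: "affine_function
      (direct_sum_groupoid 0 p G (tangent_groupoid N M G) (cotangent_groupoid N M G)) (\<lambda>(g, Xs, \<xi>s). F g Xs \<xi>s)"
    and tens: "tensor_field N p 0 F"
    using F by (simp_all add: affine_tensor_def)
  have c2: "(\<lambda>X. - c2 \<xi> X) \<in> cotangent_space N (mul G k g)" if "\<xi> \<in> set \<xi>s" for \<xi>
    using covec_uminus[OF \<xi>(2)[OF that]] by (simp add: h_eq)
  have c3: "(\<lambda>X. - c3 \<xi> X) \<in> cotangent_space N l" if "\<xi> \<in> set \<xi>s" for \<xi>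
    by (rule covec_uminus[OF \<xi>(3)[OF that]])
  have c4: "c4 \<xi> \<in> cotangent_space N (mul G k l)" if "\<xi> \<in> set \<xi>s" for \<xi>
    using \<xi>(4)[OF that] by (simp add: r_eq)
  have "F h [] (map (\<lambda>\<xi> X. - c2 \<xi> X) \<xi>s) - F g [] (map c1 \<xi>s) =
      F r [] (map c4 \<xi>s) - F l [] (map (\<lambda>\<xi> X. - c3 \<xi> X) \<xi>s)"
    using affine_multivector_mul[where \<kappa> = \<kappa> and \<eta> = c1 and \<zeta> = "\<lambda>\<xi> X. - c2 \<xi> X",
        OF aff kg \<xi>s \<kappa>(1) \<xi>(1) c2 \<kappa>(2)]
      affine_multivector_mul[where \<kappa> = \<kappa> and \<eta> = "\<lambda>\<xi> X. - c3 \<xi> X" and \<zeta> = c4,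
        OF aff kl \<xi>s \<kappa>(1) c3 c4 \<kappa>(3)]
    unfolding h_eq[symmetric] r_eq[symmetric] by linarith
  moreover have "F x [] (map (\<lambda>\<xi> X. - c \<xi> X) \<xi>s) = (-1) ^ p * F x [] (map c \<xi>s)"
    if x: "x \<in> Arr G" and c: "\<And>\<xi>. \<xi> \<in> set \<xi>s \<Longrightarrow> c \<xi> \<in> cotangent_space N x" for x c
  proof -
    have "alternating_multilinear (cotangent_space N x) p (\<lambda>\<xi>s. F x [] \<xi>s)"
      using tens x unfolding tensor_field_def Arr_eq by simp
    from alternating_multilinear_uminus[OF this, of "map c \<xi>s"] show ?thesis
      using \<xi>s c covec_uminus by (auto simp: o_def)
  qed
  ultimately show ?thesis
    using h l \<xi>(2,3) by simp
qed

text \<open>With \<open>k = h g\<^sup>-\<^sup>1\<close> the set consists of the points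
  \<open>(g, k g, l, k l)\<close>. Lifting \<open>Y\<close> and \<open>Z\<close> over one and the
  same curve through \<open>k\<close> gives a curve in it; a conormal covector can therefore be
  evaluated on these vectors.\<close>

lemma coisotropic_tangent:
  assumes kg: "((k, X), (g, Y)) \<in> composable (tangent_groupoid N M G)"
    and kl: "((k, X), (l, Z)) \<in> composable (tangent_groupoid N M G)"
  shows "tangent_pair N (prod_atlas N (prod_atlas N N)) g (mul G k g, l, mul G k l) Y
      (tangent_pair N (prod_atlas N N) (mul G k g) (l, mul G k l) (tangent_mul N G k X g Y)
        (tangent_pair N N l (mul G k l) Z (tangent_mul N G k X l Z)))
    \<in> tangent_of_subset (prod_atlas N (prod_atlas N (prod_atlas N N)))
        {(g, h, l, mul G (mul G h (ivt G g)) l) | g h l.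
          g \<in> Arr G \<and> h \<in> Arr G \<and> l \<in> Arr G \<and> src G g = src G h \<and> tgt G g = tgt G l}
        (g, mul G k g, l, mul G k l)"
    (is "?Z \<in> tangent_of_subset _ ?S _")
proof -
  obtain a b where ab: "a 0 = k" "has_velocity N a X" "b 0 = g" "has_velocity N b Y"
    "\<forall>\<^sub>F \<tau> in nhds 0. (a \<tau>, b \<tau>) \<in> composable G"
    by (rule composable_curves[OF kg])
  obtain c where c: "c 0 = l" "has_velocity N c Z" "\<forall>\<^sub>F \<tau> in nhds 0. (a \<tau>, c \<tau>) \<in> composable G"
    by (rule composable_lift[OF ab(2,1) kl])
  let ?w = "\<lambda>\<tau>. (b \<tau>, mul G (a \<tau>) (b \<tau>), c \<tau>, mul G (a \<tau>) (c \<tau>))"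
  have "has_velocity (prod_atlas N (prod_atlas N (prod_atlas N N))) ?w ?Z"
    using has_velocity_tangent_pair[OF ab(4) has_velocity_tangent_pair[OF velocity_mul[OF ab(2,4,5)]
        has_velocity_tangent_pair[OF c(2) velocity_mul[OF ab(2) c(2,3)]]]]
    by (simp add: ab(1,3) c(1))
  moreover have "\<forall>\<^sub>F \<tau> in nhds 0. ?w \<tau> \<in> ?S"
    using ab(5) c(3)
  proof eventually_elim
    case (elim \<tau>)
    have "mul G (mul G (mul G (a \<tau>) (b \<tau>)) (ivt G (b \<tau>))) (c \<tau>) = mul G (a \<tau>) (c \<tau>)"
      by (simp add: mul_ivt_cancel_right[OF elim(1)])
    moreover have "b \<tau> \<in> Arr G" "mul G (a \<tau>) (b \<tau>) \<in> Arr G" "c \<tau> \<in> Arr G"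
      "src G (b \<tau>) = src G (mul G (a \<tau>) (b \<tau>))" "tgt G (b \<tau>) = tgt G (c \<tau>)"
      using elim mul_composable[OF elim(1)] by (simp_all add: composable_iff)
    ultimately show ?case
      by (intro CollectI exI[of _ "b \<tau>"] exI[of _ "mul G (a \<tau>) (b \<tau>)"] exI[of _ "c \<tau>"]) simp
  qed
  ultimately show ?thesis
    unfolding tangent_of_subset_def using ab(1,3) c(1) by (intro CollectI exI[of _ ?w]) simp
qed

lemma affine_tensor_imp_affine_multivector_field:
  assumes F: "affine_tensor N M G p 0 F"
  shows "affine_multivector_field N G p (\<lambda>g \<xi>s. F g [] \<xi>s)"
proof -
  let ?N2 = "prod_atlas N N"
  let ?N3 = "prod_atlas N ?N2"
  let ?N4 = "prod_atlas N ?N3"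
  let ?S = "{(g, h, l, mul G (mul G h (ivt G g)) l) | g h l.
    g \<in> Arr G \<and> h \<in> Arr G \<and> l \<in> Arr G \<and> src G g = src G h \<and> tgt G g = tgt G l}"
  let ?L = "\<lambda>g \<xi>s. F g [] \<xi>s"
  let ?L' = "\<lambda>g \<xi>s. (-1) ^ (p + 1) * F g [] \<xi>s"
  have "mv_sum N ?N3 ?L (mv_sum N ?N2 ?L' (mv_sum N N ?L' ?L)) x \<xi>s = 0"
    if x: "x \<in> ?S" and \<xi>s: "length \<xi>s = p" "set \<xi>s \<subseteq> cotangent_space ?N4 x"
      and ann: "\<And>\<xi> X. \<xi> \<in> set \<xi>s \<Longrightarrow> X \<in> tangent_of_subset ?N4 ?S x \<Longrightarrow> \<xi> X = 0" for x \<xi>s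
  proof -
    obtain g h l r where ghl: "g \<in> Arr G" "h \<in> Arr G" "l \<in> Arr G" "src G g = src G h" "tgt G g = tgt G l"
      and r: "r = mul G (mul G h (ivt G g)) l" and x_eq: "x = (g, h, l, r)"
      using x by blast
    define k where "k = mul G h (ivt G g)"
    have hg: "(h, ivt G g) \<in> composable G"
      using ghl by (simp add: composable_iff ivt_in_Arr tgt_ivt)
    have kl: "(k, l) \<in> composable G"
      using mul_composable[OF hg] ghl by (simp add: k_def composable_iff src_ivt)
    have h_eq: "mul G k g = h" and r_eq: "mul G k l = r"
      using ivt_mul_cancel_right[OF ghl(2,1)] ghl(4) by (simp_all add: k_def r)
    have pts: "g \<in> points N" "h \<in> points N" "l \<in> points N" "r \<in> points N"
      using ghl mul_composable(1)[OF kl] by (simp_all add: Arr_eq r_eq)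
    have pts2: "(l, r) \<in> points ?N2" "(h, l, r) \<in> points ?N3"
      using pts by (simp_all add: points_prod_atlas)
    \<comment> \<open>The fourfold product is nested to the right: \<open>r1\<close> and
      \<open>r2\<close> are the restrictions to the last three and the last two factors, from which
      \<open>c1\<close> to \<open>c4\<close> are split off as in \<open>mv_sum\<close>.\<close>
    define r1 where "r1 = covec_right N ?N3 g (h, l, r)"
    define r2 where "r2 \<xi> = covec_right N ?N2 h (l, r) (r1 \<xi>)" for \<xi>
    define c1 where "c1 = covec_left N ?N3 g (h, l, r)"
    define c2 where "c2 \<xi> = covec_left N ?N2 h (l, r) (r1 \<xi>)" for \<xi>
    define c3 where "c3 \<xi> = covec_left N N l r (r2 \<xi>)" for \<xi>
    define c4 where "c4 \<xi> = covec_right N N l r (r2 \<xi>)" for \<xi>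
    have cot: "\<xi> \<in> cotangent_space ?N4 (g, h, l, r)" if "\<xi> \<in> set \<xi>s" for \<xi>
      using \<xi>s(2) that x_eq by blast
    have cr1: "r1 \<xi> \<in> cotangent_space ?N3 (h, l, r)" if "\<xi> \<in> set \<xi>s" for \<xi>
      unfolding r1_def by (rule covec_right_cotangent[OF dN dN3 pts(1) pts2(2) cot[OF that]])
    have cr2: "r2 \<xi> \<in> cotangent_space ?N2 (l, r)" if "\<xi> \<in> set \<xi>s" for \<xi>
      unfolding r2_def by (rule covec_right_cotangent[OF dN dN2 pts(2) pts2(1) cr1[OF that]])
    have cc1: "c1 \<xi> \<in> cotangent_space N g" if "\<xi> \<in> set \<xi>s" for \<xi>
      unfolding c1_def by (rule covec_left_cotangent[OF dN dN3 pts(1) pts2(2) cot[OF that]])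
    have cc2: "c2 \<xi> \<in> cotangent_space N h" if "\<xi> \<in> set \<xi>s" for \<xi>
      unfolding c2_def by (rule covec_left_cotangent[OF dN dN2 pts(2) pts2(1) cr1[OF that]])
    have cc3: "c3 \<xi> \<in> cotangent_space N l" if "\<xi> \<in> set \<xi>s" for \<xi>
      unfolding c3_def by (rule covec_left_cotangent[OF dN dN pts(3,4) cr2[OF that]])
    have cc4: "c4 \<xi> \<in> cotangent_space N r" if "\<xi> \<in> set \<xi>s" for \<xi>
      unfolding c4_def by (rule covec_right_cotangent[OF dN dN pts(3,4) cr2[OF that]])
    have conormal: "c1 \<xi> Y + c2 \<xi> (tangent_mul N G k X g Y) + c3 \<xi> Z + c4 \<xi> (tangent_mul N G k X l Z) = 0"
      if \<xi>: "\<xi> \<in> set \<xi>s" and XY: "((k, X), (g, Y)) \<in> composable (tangent_groupoid N M G)"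
        and XZ: "((k, X), (l, Z)) \<in> composable (tangent_groupoid N M G)" for \<xi> X Y Z
    proof -
      let ?U = "tangent_mul N G k X g Y"
      let ?W = "tangent_mul N G k X l Z"
      have tan: "Y \<in> tangent_space N g" "?U \<in> tangent_space N h" "Z \<in> tangent_space N l" "?W \<in> tangent_space N r"
        using XY XZ tangent_mul_tangent[OF XY] tangent_mul_tangent[OF XZ]
        by (simp_all add: tangent_composable_iff h_eq r_eq)
      let ?T2 = "tangent_pair N N l r Z ?W"
      let ?T3 = "tangent_pair N ?N2 h (l, r) ?U ?T2"
      have T2: "?T2 \<in> tangent_space ?N2 (l, r)"
        by (rule tangent_pair_tangent[OF dN dN pts(3) tan(3) pts(4) tan(4)])
      have T3: "?T3 \<in> tangent_space ?N3 (h, l, r)"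
        by (rule tangent_pair_tangent[OF dN dN2 pts(2) tan(2) pts2(1) T2])
      have "\<xi> (tangent_pair N ?N3 g (h, l, r) Y ?T3) = 0"
        using ann[OF \<xi>, unfolded x_eq] coisotropic_tangent[OF XY XZ] unfolding h_eq r_eq by blast
      moreover have "\<xi> (tangent_pair N ?N3 g (h, l, r) Y ?T3) = c1 \<xi> Y + r1 \<xi> ?T3"
        unfolding c1_def r1_def by (rule covec_tangent_pair[OF dN dN3 pts(1) tan(1) pts2(2) T3 cot[OF \<xi>]])
      moreover have "r1 \<xi> ?T3 = c2 \<xi> ?U + r2 \<xi> ?T2"
        unfolding c2_def r2_def by (rule covec_tangent_pair[OF dN dN2 pts(2) tan(2) pts2(1) T2 cr1[OF \<xi>]])
      moreover have "r2 \<xi> ?T2 = c3 \<xi> Z + c4 \<xi> ?W"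
        unfolding c3_def c4_def by (rule covec_tangent_pair[OF dN dN pts(3) tan(3) pts(4) tan(4) cr2[OF \<xi>]])
      ultimately show ?thesis
        by simp
    qed
    have "F g [] (map c1 \<xi>s) + (-1) ^ (p + 1) * F h [] (map c2 \<xi>s) +
        (-1) ^ (p + 1) * F l [] (map c3 \<xi>s) + F r [] (map c4 \<xi>s) = 0"
      by (rule affine_multivector_conormal[OF F ghl r \<xi>s(1) cc1 cc2 cc3 cc4 conormal[unfolded k_def]])
    moreover have "mv_sum N ?N3 ?L (mv_sum N ?N2 ?L' (mv_sum N N ?L' ?L)) (g, h, l, r) \<xi>s =
        F g [] (map c1 \<xi>s) + ((-1) ^ (p + 1) * F h [] (map c2 \<xi>s) +
        ((-1) ^ (p + 1) * F l [] (map c3 \<xi>s) + F r [] (map c4 \<xi>s)))"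
      by (simp add: mv_sum_def c1_def c2_def[abs_def] c3_def[abs_def] c4_def[abs_def] r1_def r2_def[abs_def] o_def)
    ultimately show ?thesis
      by (simp add: x_eq)
  qed
  then have "coisotropic ?N4 p (mv_sum N ?N3 ?L (mv_sum N ?N2 ?L' (mv_sum N N ?L' ?L))) ?S"
    unfolding coisotropic_def by blast
  moreover have "multivector_field N p ?L"
    using F by (simp add: affine_tensor_def multivector_field_def tensor_field_def alternating_multilinear_0)
  ultimately show ?thesis
    unfolding affine_multivector_field_def Let_def by blast
qed

section \<open>Affine (0,q)-tensors are affine q-forms\<close>

text \<open>A curve of composable pairs splits into two curves whose velocities are composable. Thus
  the three differentials in the definition of an affine form become the two factors and their
  tangent product.\<close>

lemma composable_tangent_projections:
  assumes z: "(g, h) \<in> composable G" and Z: "Z \<in> tangent_of_subset (prod_atlas N N) (composable G) (g, h)"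
  defines "X \<equiv> differential (prod_atlas N N) N (composable G) fst (g, h) Z"
    and "Y \<equiv> differential (prod_atlas N N) N (composable G) snd (g, h) Z"
  shows "((g, X), (h, Y)) \<in> composable (tangent_groupoid N M G)"
    "tangent_mul N G g X h Y = differential (prod_atlas N N) N (composable G) (\<lambda>(g, h). mul G g h) (g, h) Z"
proof -
  obtain c where c: "c 0 = (g, h)" "\<forall>\<^sub>F \<tau> in nhds 0. c \<tau> \<in> composable G" "has_velocity (prod_atlas N N) c Z"
    using Z unfolding tangent_of_subset_def by blast
  obtain X' Y' where XY: "has_velocity N (\<lambda>\<tau>. fst (c \<tau>)) X'" "has_velocity N (\<lambda>\<tau>. snd (c \<tau>)) Y'"
    "Z = tangent_pair N N g h X' Y'"
    by (rule has_velocity_prodE[OF dN dN c(3), unfolded c(1) fst_conv snd_conv])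
  have ev: "\<forall>\<^sub>F \<tau> in nhds 0. (fst (c \<tau>), snd (c \<tau>)) \<in> composable G"
    using c(2) by simp
  have X: "X = X'" and Y: "Y = Y'"
    using differential_fst[OF dN dN XY(1,2) ev] differential_snd[OF dN dN XY(1,2) ev]
    by (simp_all add: X_def Y_def XY(3) c(1))
  show XYc: "((g, X), (h, Y)) \<in> composable (tangent_groupoid N M G)"
    using velocities_composable[OF XY(1,2) ev] by (simp add: c(1) X Y)
  show "tangent_mul N G g X h Y = differential (prod_atlas N N) N (composable G) (\<lambda>(g, h). mul G g h) (g, h) Z"
    using tangent_mul_eq[OF XYc] by (simp only: X Y XY(3))
qed

text \<open>Both conditions agree term by term under projection of the vectors \<open>Zs\<close> to
  the two factors. In particular the unit at the source of \<open>X\<close> in the tangent groupoid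
  is \<open>d\<iota>(ds(X))\<close>, the argument produced by pulling back along units, source and
  first projection.\<close>

lemma affine_tensor_imp_affine_form:
  assumes F: "affine_tensor N M G 0 q F"
  shows "affine_form N M G q (\<lambda>g Xs. F g Xs [])"
proof -
  let ?N2 = "prod_atlas N N"
  let ?G2 = "composable G"
  let ?T = "tangent_groupoid N M G"
  let ?D = "direct_sum_groupoid q 0 G ?T (cotangent_groupoid N M G)"
  let ?Th = "\<lambda>g Xs. F g Xs []"
  have aff: "affine_function ?D (\<lambda>(g, Xs, \<xi>s). F g Xs \<xi>s)"
    using F by (simp add: affine_tensor_def)
  have "pullback_form ?N2 N ?G2 (\<lambda>(g, h). mul G g h) ?Th z Zs =
      pullback_form ?N2 N ?G2 fst ?Th z Zs + pullback_form ?N2 N ?G2 snd ?Th z Zs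
      - pullback_form ?N2 N ?G2 fst
          (pullback_form N M (points N) (src G) (pullback_form M N (points M) (unt G) ?Th)) z Zs"
    if z: "z \<in> ?G2" and Zs: "length Zs = q" "set Zs \<subseteq> tangent_of_subset ?N2 ?G2 z" for z Zs
  proof -
    obtain g h where zgh: "z = (g, h)"
      by (cases z)
    define X where "X = differential ?N2 N ?G2 fst (g, h)"
    define Y where "Y = differential ?N2 N ?G2 snd (g, h)"
    have gh: "(g, h) \<in> ?G2"
      using z zgh by simp
    have comp: "((g, X Z), (h, Y Z)) \<in> composable ?T"
      and mul: "tangent_mul N G g (X Z) h (Y Z) = differential ?N2 N ?G2 (\<lambda>(g, h). mul G g h) (g, h) Z"
      if "Z \<in> set Zs" for Z
      using composable_tangent_projections[OF gh] Zs(2) that unfolding X_def Y_def zgh by blast+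
    have "((g, map X Zs, []), (h, map Y Zs, [])) \<in> composable ?D"
      using Zs(1) comp gh by (simp add: composable_def direct_sum_groupoid_def tangent_groupoid_def)
    from aff[unfolded affine_function_def, rule_format, OF this]
    have "F (mul G g h) (map2 (\<lambda>X Y. tangent_mul N G g X h Y) (map X Zs) (map Y Zs)) [] =
        F g (map X Zs) [] + F h (map Y Zs) [] -
        F (unt G (src G g)) (map (\<lambda>Z. diff M N (unt G) (src G g) (diff N M (src G) g (X Z))) Zs) []"
      by (simp add: direct_sum_groupoid_def tangent_groupoid_def o_def)
    moreover have "map2 (\<lambda>X Y. tangent_mul N G g X h Y) (map X Zs) (map Y Zs) =
        map (differential ?N2 N ?G2 (\<lambda>(g, h). mul G g h) (g, h)) Zs"
      using mul by (simp add: map2_map_map)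
    ultimately show ?thesis
      by (simp add: pullback_form_def zgh X_def Y_def o_def)
  qed
  moreover have "differential_form N q ?Th"
    using F by (simp add: affine_tensor_def differential_form_def tensor_field_def alternating_multilinear_0)
  ultimately show ?thesis
    unfolding affine_form_def Let_def by blast
qed

end

theorem proposition5p5:
  fixes N :: "('g, 'e::real_inner) atlas"
    and M :: "('m, 'f::real_inner) atlas"
    and G :: "('g, 'm) groupoid"
  assumes "lie_groupoid N M G"
  shows "(\<forall>p (F :: ('g, 'e) tensor). affine_tensor N M G p 0 F \<longrightarrow>
            affine_multivector_field N G p (\<lambda>g \<xi>s. F g [] \<xi>s)) \<and>
         (\<forall>q (F :: ('g, 'e) tensor). affine_tensor N M G 0 q F \<longrightarrow>
            affine_form N M G q (\<lambda>g Xs. F g Xs []))"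
proof -
  interpret lie_groupoid_structure N M G
    by unfold_locales (rule assms)
  show ?thesis
    using affine_tensor_imp_affine_multivector_field affine_tensor_imp_affine_form by blast
qed

end
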